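(* Let $d\ge2$. The family $\mathcal{C}_{ar,abs}^d$ of all absolutely continuous $d$-dimensional Archimedean copulas is of first Baire category in $(\mathcal{C}_{ar}^d,d_\infty)$.
   Context: Notation: $\mathbb{I}=[0,1]$; $\inf\emptyset=\infty$. The uniform metric is $d_\infty(A,B)=\sup_{\mathbf{x}\in\mathbb{I}^d}|A(\mathbf{x})-B(\mathbf{x})|$. A subset of a topological space is of first Baire category if it can be covered by countably many nowhere dense sets. A generator is a continuous non-increasing $\psi:[0,\infty)\to\mathbb{I}$ with $\psi(0)=1$, $\psi(\infty):=\lim_{z\to\infty}\psi(z)=0$, strictly decreasing on $[0,\inf\{x:\psi(x)=0\})$; its pseudo-inverse is $\varphi(y)=\inf\{z\in[0,\infty]:\psi(z)=y\}$, $y\in\mathbb{I}$. $\mathcal{C}_{ar}^d$ is the set of $d$-dimensional Archimedean copulas, i.e. copulas of the form $C(\mathbf{x})=\psi(\sum_{i=1}^d\varphi(x_i))$ (this function is a copula iff $\psi$ is $d$-monotone, i.e., with $\psi$ continuous on $[0,\infty)$, on $(0,\infty)$ $\psi$ is differentiable up to order $d-2$, $(-1)^k\psi^{(k)}\ge0$ for $k\le d-2$, and $(-1)^{d-2}\psi^{(d-2)}$ is non-increasing and convex). $\mu_C$ is the probability measure on $\mathbb{I}^d$ with distribution function $C$; $C^{1:d-1}$ is the marginal copula of the first $d-1$ coordinates, with measure $\mu_{C^{1:d-1}}$ (always absolutely continuous for $C\in\mathcal{C}_{ar}^d$). Let $K_C:\mathbb{I}^{d-1}\times\mathcal{B}(\mathbb{I})\to\mathbb{I}$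 be (a version of) the regular conditional distribution of the last coordinate given the first $d-1$ under $\mu_C$, and let $K_C^{abs}(\mathbf{x},\cdot)$ be the part of $K_C(\mathbf{x},\cdot)$ that is absolutely continuous w.r.t. Lebesgue measure. Define $\mu_C^{abs}(E\times F)=\int_E K_C^{abs}(\mathbf{x},F)\,d\mu_{C^{1:d-1}}(\mathbf{x})$ for Borel $E\subseteq\mathbb{I}^{d-1}$, $F\subseteq\mathbb{I}$. $C$ is called absolutely continuous if $\mu_C^{abs}(\mathbb{I}^d)=1$. *)

theory Defs
  imports "HOL-Probability.Probability"
begin

section \<open>The unit cube and the uniform metric\<close>

text \<open>
  Points of the \<open>d\<close>-dimensional unit cube are the functions on \<open>{..<d}\<close> with values in \<open>[0,1]\<close>,
  taking the value \<^const>\<open>undefined\<close> outside \<open>{..<d}\<close>. The coordinates, numbered from 1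
  to \<open>d\<close> in the usual notation, are numbered from \<open>0\<close> to \<open>d - 1\<close> here; in particular the last
  coordinate is \<open>x (d - 1)\<close>.
\<close>

definition unit_cube :: "nat \<Rightarrow> (nat \<Rightarrow> real) set" where
  "unit_cube d = ({..<d} \<rightarrow>\<^sub>E {0..1})"

definition unit_borel :: "real measure" where
  "unit_borel = restrict_space borel {0..1}"

definition unit_lebesgue :: "real measure" where
  "unit_lebesgue = restrict_space lborel {0..1}"

definition cube_borel :: "nat \<Rightarrow> (nat \<Rightarrow> real) measure" where
  "cube_borel d = PiM {..<d} (\<lambda>_. unit_borel)"

lemma space_unit_borel [simp]: "space unit_borel = {0..1}"
  by (simp add: unit_borel_def space_restrict_space)

lemma space_cube_borel [simp]: "space (cube_borel d) = unit_cube d"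
  by (simp add: cube_borel_def unit_cube_def space_PiM)

lemma sets_unit_lebesgue: "sets unit_lebesgue = sets unit_borel"
  unfolding unit_lebesgue_def unit_borel_def by (rule sets_restrict_space_cong) simp

text \<open>
  The library's uniform distance of bounded functions on a set, with
  value \<open>0\<close> unless both arguments are bounded on the cube and undefined outside of it;
  see \<open>uniform_dist_eq\<close> below for copulas.
\<close>

definition uniform_dist :: "nat \<Rightarrow> ((nat \<Rightarrow> real) \<Rightarrow> real) \<Rightarrow> ((nat \<Rightarrow> real) \<Rightarrow> real) \<Rightarrow> real" where
  "uniform_dist d = Met_TC.fdist (unit_cube d)"


section \<open>Copulas and their measures\<close>

text \<open>\<open>M\<close> is a probability measure on the cube whose distribution function is \<open>C\<close>.\<close>

definition has_cdf :: "nat \<Rightarrow> (nat \<Rightarrow> real) measure \<Rightarrow> ((nat \<Rightarrow> real) \<Rightarrow> real) \<Rightarrow> bool" where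
  "has_cdf d M C \<longleftrightarrow> prob_space M \<and> sets M = sets (cube_borel d) \<and>
     (\<forall>x\<in>unit_cube d. measure M {y \<in> unit_cube d. \<forall>i<d. y i \<le> x i} = C x)"

text \<open>
  A copula is (the restriction to the unit cube of) a distribution function all of whose
  univariate marginals are uniform on \<open>[0,1]\<close>. Requiring copulas to be undefined outside of the
  cube makes equality of copulas equality as functions on the cube.
\<close>

definition copula :: "nat \<Rightarrow> ((nat \<Rightarrow> real) \<Rightarrow> real) \<Rightarrow> bool" where
  "copula d C \<longleftrightarrow> C \<in> extensional (unit_cube d) \<and>
     (\<exists>M. has_cdf d M C \<and>
       (\<forall>i<d. distr M borel (\<lambda>x. x i) = uniform_measure lborel {0..1}))"

definition copula_measure :: "nat \<Rightarrow> ((nat \<Rightarrow> real) \<Rightarrow> real) \<Rightarrow> (nat \<Rightarrow> real) measure" where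
  "copula_measure d C = (THE M. has_cdf d M C)"

text \<open>The marginal copula of the first \<open>d - 1\<close> coordinates.\<close>

definition front_marginal :: "nat \<Rightarrow> ((nat \<Rightarrow> real) \<Rightarrow> real) \<Rightarrow> (nat \<Rightarrow> real) \<Rightarrow> real" where
  "front_marginal d C = (\<lambda>x\<in>unit_cube (d - 1). C (x(d - 1 := 1)))"


section \<open>Archimedean copulas\<close>

text \<open>
  Only the values of \<open>\<psi>\<close> on \<open>[0,\<infinity>)\<close> matter. The infimum is taken in \<^typ>\<open>ennreal\<close>, so that it is
  \<open>\<infinity>\<close> if \<open>\<psi>\<close> has no zero.
\<close>

definition generator :: "(real \<Rightarrow> real) \<Rightarrow> bool" where
  "generator \<psi> \<longleftrightarrow>
     continuous_on {0..} \<psi> \<and> \<psi> ` {0..} \<subseteq> {0..1} \<and> antimono_on {0..} \<psi> \<and>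
     \<psi> 0 = 1 \<and> (\<psi> \<longlongrightarrow> 0) at_top \<and>
     (\<forall>x y. 0 \<le> x \<and> x < y \<and> ennreal y < Inf (ennreal ` {z. 0 \<le> z \<and> \<psi> z = 0}) \<longrightarrow> \<psi> y < \<psi> x)"

text \<open>
  The extension of \<open>\<psi>\<close> to \<open>[0,\<infinity>]\<close> by \<open>\<psi>(\<infinity>) = 0\<close>, which is the limit of \<open>\<psi>\<close> at \<open>\<infinity>\<close>
  for a generator.
\<close>

definition gen_ext :: "(real \<Rightarrow> real) \<Rightarrow> ennreal \<Rightarrow> real" where
  "gen_ext \<psi> z = (if z = \<infinity> then 0 else \<psi> (enn2real z))"

definition pseudo_inverse :: "(real \<Rightarrow> real) \<Rightarrow> real \<Rightarrow> ennreal" where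
  "pseudo_inverse \<psi> y = Inf {z. gen_ext \<psi> z = y}"

definition archimedean_copulas :: "nat \<Rightarrow> ((nat \<Rightarrow> real) \<Rightarrow> real) set" where
  "archimedean_copulas d = {C. copula d C \<and>
     (\<exists>\<psi>. generator \<psi> \<and>
       (\<forall>x\<in>unit_cube d. C x = gen_ext \<psi> (\<Sum>i<d. pseudo_inverse \<psi> (x i))))}"


section \<open>Absolutely continuous copulas\<close>

text \<open>
  \<open>K\<close> is a version of the regular conditional distribution of the last coordinate given the first
  \<open>d - 1\<close> coordinates under the measure of \<open>C\<close>.
\<close>

definition cond_kernel ::
  "nat \<Rightarrow> ((nat \<Rightarrow> real) \<Rightarrow> real) \<Rightarrow> ((nat \<Rightarrow> real) \<Rightarrow> real measure) \<Rightarrow> bool" where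
  "cond_kernel d C K \<longleftrightarrow>
     K \<in> cube_borel (d - 1) \<rightarrow>\<^sub>M prob_algebra unit_borel \<and>
     (\<forall>E\<in>sets (cube_borel (d - 1)). \<forall>F\<in>sets unit_borel.
        emeasure (copula_measure d C)
          {x \<in> unit_cube d. restrict x {..<d - 1} \<in> E \<and> x (d - 1) \<in> F} =
        (\<integral>\<^sup>+x\<in>E. emeasure (K x) F \<partial>copula_measure (d - 1) (front_marginal d C)))"

definition mutually_singular :: "'a measure \<Rightarrow> 'a measure \<Rightarrow> bool" where
  "mutually_singular M N \<longleftrightarrow>
     (\<exists>Z\<in>sets M. emeasure M Z = 0 \<and> emeasure N (space M - Z) = 0)"

text \<open>The absolutely continuous part of \<open>N\<close> in its Lebesgue decomposition with respect to \<open>L\<close>.\<close>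

definition ac_part :: "'a measure \<Rightarrow> 'a measure \<Rightarrow> 'a measure" where
  "ac_part L N = (THE A. sets A = sets L \<and> absolutely_continuous L A \<and>
     (\<exists>S. sets S = sets L \<and> mutually_singular L S \<and>
       (\<forall>B\<in>sets L. emeasure N B = emeasure A B + emeasure S B)))"

text \<open>
  The value of the absolutely continuous component of the measure of \<open>C\<close> on the rectangle
  \<open>E \<times> F\<close>, computed from the version \<open>K\<close> of the regular conditional distribution.
\<close>

definition abs_component ::
  "nat \<Rightarrow> ((nat \<Rightarrow> real) \<Rightarrow> real) \<Rightarrow> ((nat \<Rightarrow> real) \<Rightarrow> real measure) \<Rightarrow>
    (nat \<Rightarrow> real) set \<Rightarrow> real set \<Rightarrow> ennreal" where
  "abs_component d C K E F =
     (\<integral>\<^sup>+x\<in>E. emeasure (ac_part unit_lebesgue (K x)) F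
        \<partial>copula_measure (d - 1) (front_marginal d C))"

text \<open>
  Two versions of the regular conditional distribution agree for almost every \<open>x\<close>, so it does not
  matter which of them is used.
\<close>

definition abs_cont_copula :: "nat \<Rightarrow> ((nat \<Rightarrow> real) \<Rightarrow> real) \<Rightarrow> bool" where
  "abs_cont_copula d C \<longleftrightarrow>
     (\<exists>K. cond_kernel d C K \<and> abs_component d C K (unit_cube (d - 1)) {0..1} = 1)"

definition abs_cont_archimedean_copulas :: "nat \<Rightarrow> ((nat \<Rightarrow> real) \<Rightarrow> real) set" where
  "abs_cont_archimedean_copulas d = {C \<in> archimedean_copulas d. abs_cont_copula d C}"


section \<open>Baire category\<close>

definition nowhere_dense_in :: "'a topology \<Rightarrow> 'a set \<Rightarrow> bool" where
  "nowhere_dense_in X N \<longleftrightarrow> N \<subseteq> topspace X \<and> X interior_of (X closure_of N) = {}"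

definition first_category_in :: "'a topology \<Rightarrow> 'a set \<Rightarrow> bool" where
  "first_category_in X S \<longleftrightarrow>
     (\<exists>\<N>. countable \<N> \<and> (\<forall>N\<in>\<N>. nowhere_dense_in X N) \<and> S \<subseteq> \<Union>\<N>)"


section \<open>Well-definedness\<close>

lemma copula_in_fspace:
  assumes "copula d C"
  shows "C \<in> Met_TC.fspace (unit_cube d)"
proof -
  obtain M where M: "has_cdf d M C"
    using assms by (auto simp: copula_def)
  then interpret prob_space M
    by (simp add: has_cdf_def)
  have "C x \<in> {0..1}" if "x \<in> unit_cube d" for x
  proof -
    have "C x = prob {y \<in> unit_cube d. \<forall>i<d. y i \<le> x i}"
      using M that by (simp only: has_cdf_def)
    then show ?thesis
      by simp
  qed
  then have "C ` unit_cube d \<subseteq> {0..1}"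
    by blast
  then have "bounded (C ` unit_cube d)"
    by (rule bounded_subset[OF bounded_closed_interval])
  then show ?thesis
    using assms by (auto simp: Met_TC.fspace_def copula_def)
qed

lemma uniform_dist_eq:
  assumes "copula d A" "copula d B"
  shows "uniform_dist d A B = (SUP x\<in>unit_cube d. \<bar>A x - B x\<bar>)"
proof -
  have "unit_cube d \<noteq> {}"
    by (auto simp: unit_cube_def PiE_eq_empty_iff)
  with assms show ?thesis
    by (simp add: uniform_dist_def Met_TC.fdist_def copula_in_fspace dist_real_def)
qed

lemma Metric_space_archimedean_copulas:
  "Metric_space (archimedean_copulas d) (uniform_dist d)"
  unfolding uniform_dist_def
  by (rule Metric_space.subspace[OF Met_TC.Metric_space_funspace])
    (auto simp: archimedean_copulas_def copula_in_fspace)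

lemma unit_cubeD:
  assumes "x \<in> unit_cube d" "i < d"
  shows "0 \<le> x i" "x i \<le> 1"
  using assms by (auto simp: unit_cube_def PiE_iff)

lemma sets_cube_borel_eq:
  "sets (cube_borel d) =
     sigma_sets (unit_cube d) {{y \<in> unit_cube d. \<forall>i<d. y i \<le> x i} | x. x \<in> unit_cube d}"
    (is "_ = sigma_sets _ ?E")
proof
  define \<Sigma> where "\<Sigma> = sigma (unit_cube d) ?E"
  have sub: "?E \<subseteq> Pow (unit_cube d)"
    by auto
  have S: "space \<Sigma> = unit_cube d" "sets \<Sigma> = sigma_sets (unit_cube d) ?E"
    by (simp_all only: \<Sigma>_def space_measure_of[OF sub] sets_measure_of[OF sub])
  have le: "{y \<in> space \<Sigma>. y i \<le> t} \<in> sets \<Sigma>" if i: "i < d" for i t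
  proof -
    consider "t < 0" | "1 < t" | "0 \<le> t" "t \<le> 1"
      by linarith
    then show ?thesis
    proof cases
      case 1
      have "\<not> y i \<le> t" if "y \<in> space \<Sigma>" for y
        using unit_cubeD(1)[OF _ i, of y] that 1 unfolding S by linarith
      then have "{y \<in> space \<Sigma>. y i \<le> t} = {}"
        by blast
      then show ?thesis
        by (simp only: sets.empty_sets)
    next
      case 2
      have "y i \<le> t" if "y \<in> space \<Sigma>" for y
        using unit_cubeD(2)[OF _ i, of y] that 2 unfolding S by linarith
      then have "{y \<in> space \<Sigma>. y i \<le> t} = space \<Sigma>"
        by blast
      then show ?thesis
        by (simp only: sets.top)
    next
      case 3
      define x where "x = (\<lambda>j\<in>{..<d}. if j = i then t else 1)"
      have "x \<in> unit_cube d"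
        using 3 by (auto simp: x_def unit_cube_def)
      moreover have "y i \<le> t \<longleftrightarrow> (\<forall>j<d. y j \<le> x j)" if "y \<in> unit_cube d" for y
        using i unit_cubeD(2)[OF that] by (auto simp: x_def)
      then have "{y \<in> space \<Sigma>. y i \<le> t} = {y \<in> unit_cube d. \<forall>j<d. y j \<le> x j}"
        unfolding S by blast
      ultimately show ?thesis
        unfolding S by (intro sigma_sets.Basic) blast
    qed
  qed
  have "(\<lambda>y. y i) \<in> \<Sigma> \<rightarrow>\<^sub>M unit_borel" if i: "i < d" for i
  proof -
    have "(\<lambda>y. y i) \<in> borel_measurable \<Sigma>"
      unfolding borel_measurable_iff_le using le[OF i] by blast
    moreover have "(\<lambda>y. y i) \<in> space \<Sigma> \<rightarrow> {0..1}"
      unfolding S using unit_cubeD[OF _ i] by auto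
    ultimately show ?thesis
      unfolding unit_borel_def by (intro measurable_restrict_space2)
  qed
  then have "(\<lambda>y. \<lambda>i\<in>{..<d}. y i) \<in> \<Sigma> \<rightarrow>\<^sub>M cube_borel d"
    unfolding cube_borel_def by (intro measurable_restrict) blast
  moreover have "(\<lambda>i\<in>{..<d}. y i) = y" if "y \<in> space \<Sigma>" for y
    using that unfolding S unit_cube_def by (rule PiE_restrict)
  ultimately have id: "(\<lambda>y. y) \<in> \<Sigma> \<rightarrow>\<^sub>M cube_borel d"
    using measurable_cong[of \<Sigma> "\<lambda>y. \<lambda>i\<in>{..<d}. y i" "\<lambda>y. y" "cube_borel d"] by blast
  show "sets (cube_borel d) \<subseteq> sigma_sets (unit_cube d) ?E"
  proof
    fix A assume A: "A \<in> sets (cube_borel d)"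
    then have "A \<subseteq> unit_cube d"
      using sets.sets_into_space[OF A] by (simp only: space_cube_borel)
    then show "A \<in> sigma_sets (unit_cube d) ?E"
      using measurable_sets[OF id A] by (simp add: S Int_absorb2)
  qed
  have comp: "(\<lambda>y. y i) \<in> borel_measurable (cube_borel d)" if "i < d" for i
  proof -
    have "(\<lambda>y. y i) \<in> cube_borel d \<rightarrow>\<^sub>M unit_borel"
      unfolding cube_borel_def using that by (intro measurable_component_singleton) auto
    then show ?thesis
      unfolding unit_borel_def by (simp add: measurable_restrict_space2_iff)
  qed
  have "{y \<in> unit_cube d. \<forall>i<d. y i \<le> x i} \<in> sets (cube_borel d)" for x :: "nat \<Rightarrow> real"
  proof -
    have "{y \<in> space (cube_borel d). \<forall>i\<in>{..<d}. y i \<le> x i} \<in> sets (cube_borel d)"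
      using comp by (intro sets.sets_Collect_finite_All) (auto simp: borel_measurable_iff_le)
    then show ?thesis
      by (simp only: space_cube_borel Ball_def lessThan_iff)
  qed
  then have "?E \<subseteq> sets (cube_borel d)"
    by blast
  then show "sigma_sets (unit_cube d) ?E \<subseteq> sets (cube_borel d)"
    using sets.sigma_sets_subset[of ?E "cube_borel d"] by (simp only: space_cube_borel)
qed

lemma has_cdf_unique:
  assumes M: "has_cdf d M C" and N: "has_cdf d N C"
  shows "M = N"
proof (rule measure_eqI_generator_eq)
  let ?E = "{{y \<in> unit_cube d. \<forall>i<d. y i \<le> x i} | x. x \<in> unit_cube d}"
  interpret M: prob_space M using M by (simp add: has_cdf_def)
  interpret N: prob_space N using N by (simp add: has_cdf_def)
  show "Int_stable ?E"
  proof (rule Int_stableI)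
    fix A B assume "A \<in> ?E" "B \<in> ?E"
    then obtain x y where x: "x \<in> unit_cube d" "A = {z \<in> unit_cube d. \<forall>i<d. z i \<le> x i}"
      and y: "y \<in> unit_cube d" "B = {z \<in> unit_cube d. \<forall>i<d. z i \<le> y i}"
      by auto
    have "(\<lambda>i\<in>{..<d}. min (x i) (y i)) \<in> unit_cube d"
      using x(1) y(1) by (auto simp: unit_cube_def PiE_iff min_def)
    moreover have "A \<inter> B = {z \<in> unit_cube d. \<forall>i<d. z i \<le> (\<lambda>i\<in>{..<d}. min (x i) (y i)) i}"
      using x(2) y(2) by auto
    ultimately show "A \<inter> B \<in> ?E"
      by blast
  qed
  show "?E \<subseteq> Pow (unit_cube d)"
    by auto
  show "emeasure M X = emeasure N X" if "X \<in> ?E" for X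
    using that M N by (auto simp: has_cdf_def M.emeasure_eq_measure N.emeasure_eq_measure)
  show "sets M = sigma_sets (unit_cube d) ?E" "sets N = sigma_sets (unit_cube d) ?E"
    using M N by (simp_all add: has_cdf_def sets_cube_borel_eq)
  have "(\<lambda>i\<in>{..<d}. 1) \<in> unit_cube d"
    by (auto simp: unit_cube_def)
  moreover have "unit_cube d = {y \<in> unit_cube d. \<forall>i<d. y i \<le> (\<lambda>i\<in>{..<d}. 1) i}"
    using unit_cubeD(2) by fastforce
  ultimately have "unit_cube d \<in> ?E"
    by blast
  then show "range (\<lambda>_::nat. unit_cube d) \<subseteq> ?E"
    by auto
  show "(\<Union>i::nat. unit_cube d) = unit_cube d"
    by simp
  show "emeasure M (unit_cube d) \<noteq> \<infinity>" for i :: nat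
    by simp
qed

lemma has_cdf_copula_measure:
  assumes "copula d C"
  shows "has_cdf d (copula_measure d C) C"
proof -
  obtain M where M: "has_cdf d M C"
    using assms by (auto simp: copula_def)
  show ?thesis
    unfolding copula_measure_def by (rule theI[where a = M]) (rule M, rule has_cdf_unique[OF _ M])
qed

end

theory Submission
  imports Defs
begin

text \<open>
  The sets \<open>N n\<close> of Archimedean copulas \<open>C\<close> such that \<open>\<mu>\<^sub>C V \<le> 1 / 2\<close> for every finite Boolean combination
  \<open>V\<close> of boxes with \<open>\<nu>\<^sub>C V < 1 / (n + 1)\<close>, where \<open>\<nu>\<^sub>C\<close> is the product of the marginal of the first
  \<open>d - 1\<close> coordinates and Lebesgue measure, cover the absolutely continuous copulas, since
  absolute continuity of \<open>C\<close> means that \<open>\<mu>\<^sub>C\<close> has a density with respect to \<open>\<nu>\<^sub>C\<close>. They are closed,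
  because \<open>\<mu>\<^sub>C V\<close> and \<open>\<nu>\<^sub>C V\<close> are linear combinations of finitely many values of \<open>C\<close>. They have no interior,
  because every generator is a uniform limit of finite mixtures of the functions
  \<open>max 0 (1 - x / r) ^ (d - 1)\<close>: the copula of such a mixture is the distribution of a
  transformed point of a randomly scaled simplex, so it lives on finitely many hypersurfaces
  \<open>\<Sum>i. \<phi> (x i) = r\<close>, which are graphs over the first \<open>d - 1\<close> coordinates and hence \<open>\<nu>\<^sub>C\<close>-null.
\<close>

section \<open>Generators and pseudo-inverses\<close>

text \<open>Two obstacles shape the argument. Uniform convergence of copulas controls the measures
  of boxes, not of arbitrary Borel sets. Hence the test sets are finite Boolean combinations of
  boxes, and the Borel set that separates the two measures of a mixture has to be approximated by
  such a combination in both measures at once. The product measure moves with \<open>C\<close> as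
  well, but its value on a box is again expressed by \<open>C\<close>: the last coordinate is raised
  to 1 and reappears as a factor. Density rests on differences of the generator instead of
  derivatives. Boxes have nonnegative probability, which along a lattice makes the differences of
  order d of the generator nonnegative. A sequence tending to 0 is recovered from such differences
  by repeated summation by parts, a discrete form of the Williamson transform, and truncating the
  resulting series leaves finitely many radii.\<close>

lemma generatorD:
  assumes "generator \<psi>"
  shows "continuous_on {0..} \<psi>" "\<psi> 0 = 1" "(\<psi> \<longlongrightarrow> 0) at_top"
    "\<And>x. 0 \<le> x \<Longrightarrow> 0 \<le> \<psi> x" "\<And>x. 0 \<le> x \<Longrightarrow> \<psi> x \<le> 1"
    "\<And>x y. 0 \<le> x \<Longrightarrow> x \<le> y \<Longrightarrow> \<psi> y \<le> \<psi> x"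
  using assms by (auto simp: generator_def monotone_on_def image_subset_iff)

lemma generator_attains:
  assumes g: "generator \<psi>" and y: "0 < y" "y \<le> 1"
  obtains z where "0 \<le> z" "\<psi> z = y"
proof -
  have "eventually (\<lambda>x. \<psi> x < y) at_top"
    using generatorD(3)[OF g] y(1) by (rule order_tendstoD)
  then have "eventually (\<lambda>x. \<psi> x < y \<and> 0 \<le> x) at_top"
    using eventually_ge_at_top[of "0::real"] by eventually_elim simp
  then obtain b where b: "\<psi> b < y" "0 \<le> b"
    using eventually_happens by force
  have "\<exists>z\<ge>0. z \<le> b \<and> \<psi> z = y"
    using b y generatorD(2)[OF g] continuous_on_subset[OF generatorD(1)[OF g], of "{0..b}"]
    by (intro IVT2') auto
  then show ?thesis
    using that by blast
qed

text \<open>Half of the value is attained too, and monotonicity puts it further right. This is the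
  room that the strict bound by the infimum of the zeros in \<open>generator\<close> asks
  for.\<close>

lemma generator_positive_beyond:
  assumes g: "generator \<psi>" and z: "0 \<le> z" "0 < \<psi> z"
  obtains z' where "z < z'" "0 < \<psi> z'"
proof -
  obtain z' where z': "0 \<le> z'" "\<psi> z' = \<psi> z / 2"
    using generator_attains[OF g, of "\<psi> z / 2"] z generatorD(5)[OF g z(1)] by auto
  moreover have "z < z'"
    using generatorD(6)[OF g z'(1), of z] z z'(2) by (cases "z < z'") auto
  ultimately show ?thesis
    using that z by auto
qed

lemma generator_strict:
  assumes g: "generator \<psi>" and x: "0 \<le> x" "x < y" "0 < \<psi> x"
  shows "\<psi> y < \<psi> x"
proof (cases "0 < \<psi> y")
  case True
  obtain y' where y': "y < y'" "0 < \<psi> y'"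
    using generator_positive_beyond[OF g _ True] x by auto
  \<comment> \<open>Monotonicity keeps all zeros beyond \<open>y'\<close>, where the generator is
    still positive, so \<open>y\<close> lies strictly below their infimum, also when there is no
    zero.\<close>
  have "ennreal y' \<le> Inf (ennreal ` {z. 0 \<le> z \<and> \<psi> z = 0})"
  proof (rule Inf_greatest)
    fix v assume "v \<in> ennreal ` {z. 0 \<le> z \<and> \<psi> z = 0}"
    then obtain z where z: "v = ennreal z" "0 \<le> z" "\<psi> z = 0"
      by auto
    have "y' \<le> z"
      using generatorD(6)[OF g z(2), of y'] y' z by (cases "y' \<le> z") auto
    then show "ennreal y' \<le> v"
      using z by (simp add: ennreal_leI)
  qed
  moreover have "ennreal y < ennreal y'"
    using x y' by (simp add: ennreal_less_iff)
  ultimately have "ennreal y < Inf (ennreal ` {z. 0 \<le> z \<and> \<psi> z = 0})"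
    by order
  then show ?thesis
    using g x unfolding generator_def by blast
next
  case False
  then show ?thesis
    using x by linarith
qed

text \<open>Strict decrease while the generator is positive makes the level set a singleton, so no
  infimum is left to compute.\<close>

lemma pseudo_inverse_pos:
  assumes g: "generator \<psi>" and z: "0 \<le> z" "0 < \<psi> z"
  shows "pseudo_inverse \<psi> (\<psi> z) = ennreal z"
proof -
  have "{v. gen_ext \<psi> v = \<psi> z} = {ennreal z}"
  proof (intro equalityI subsetI)
    fix v assume "v \<in> {v. gen_ext \<psi> v = \<psi> z}"
    then have v: "v \<noteq> \<infinity>" "\<psi> (enn2real v) = \<psi> z"
      using z by (auto simp: gen_ext_def split: if_splits)
    have "enn2real v = z"
      using generator_strict[OF g z(1) _ z(2), of "enn2real v"]
        generator_strict[OF g, of "enn2real v" z] v z by (cases "enn2real v" z rule: linorder_cases) auto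
    then show "v \<in> {ennreal z}"
      using v by (auto simp: ennreal_enn2real_if)
  qed (use z in \<open>auto simp: gen_ext_def\<close>)
  then show ?thesis
    by (simp add: pseudo_inverse_def)
qed

text \<open>The level set of 0 may be a half-line or just \<infinity>. A positive value at
  \<open>z\<close> would leave a positive value at some larger \<open>t\<close>, which is then a
  lower bound of all zeros.\<close>

lemma gen_ext_beyond_zero:
  assumes g: "generator \<psi>" and z: "pseudo_inverse \<psi> 0 \<le> z"
  shows "gen_ext \<psi> z = 0"
proof (rule ccontr)
  assume *: "gen_ext \<psi> z \<noteq> 0"
  then have fin: "z \<noteq> \<infinity>" and "\<psi> (enn2real z) \<noteq> 0"
    by (auto simp: gen_ext_def split: if_splits)
  then have "0 < \<psi> (enn2real z)"
    using generatorD(4)[OF g, of "enn2real z"] by simp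
  then obtain t where t: "enn2real z < t" "0 < \<psi> t"
    using generator_positive_beyond[OF g, of "enn2real z"] by auto
  have t0: "0 \<le> t"
    using t(1) enn2real_nonneg[of z] by linarith
  have "ennreal t \<le> pseudo_inverse \<psi> 0"
    unfolding pseudo_inverse_def
  proof (rule Inf_greatest)
    fix v assume "v \<in> {v. gen_ext \<psi> v = 0}"
    then have "v = \<infinity> \<or> v \<noteq> \<infinity> \<and> \<psi> (enn2real v) = 0"
      by (auto simp: gen_ext_def split: if_splits)
    moreover have "ennreal t \<le> v" if "v \<noteq> \<infinity>" "\<psi> (enn2real v) = 0"
    proof -
      have "t \<le> enn2real v"
        using generatorD(6)[OF g, of "enn2real v" t] t that by (cases "t \<le> enn2real v") auto
      then show ?thesis
        using that by (metis ennreal_enn2real_if ennreal_leI infinity_ennreal_def)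
    qed
    ultimately show "ennreal t \<le> v"
      by auto
  qed
  moreover have "z < ennreal t"
    using t(1) fin t0 by (metis enn2real_nonneg ennreal_enn2real_if ennreal_less_iff infinity_ennreal_def)
  ultimately show False
    using z by order
qed

lemma gen_ext_pseudo_inverse_sum:
  assumes g: "generator \<psi>" and I: "finite I" and z: "\<And>i. i \<in> I \<Longrightarrow> 0 \<le> z i"
  shows "gen_ext \<psi> (\<Sum>i\<in>I. pseudo_inverse \<psi> (\<psi> (z i))) = \<psi> (\<Sum>i\<in>I. z i)"
proof (cases "\<forall>i\<in>I. 0 < \<psi> (z i)")
  case True
  then have "(\<Sum>i\<in>I. pseudo_inverse \<psi> (\<psi> (z i))) = (\<Sum>i\<in>I. ennreal (z i))"
    using pseudo_inverse_pos[OF g] z by (intro sum.cong) auto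
  also have "\<dots> = ennreal (\<Sum>i\<in>I. z i)"
    using z by (intro sum_ennreal) auto
  finally show ?thesis
    using z by (simp add: gen_ext_def sum_nonneg)
next
  \<comment> \<open>The pseudo-inverse of 0 is the first zero and not \<open>z k\<close>, so the two
    sums can differ. Both lie beyond the first zero, where the generator vanishes.\<close>
  case False
  then obtain k where k: "k \<in> I" "\<psi> (z k) = 0"
    using generatorD(4)[OF g] z by (metis antisym_conv2)
  have "pseudo_inverse \<psi> 0 \<le> (\<Sum>i\<in>I. pseudo_inverse \<psi> (\<psi> (z i)))"
    using member_le_sum[OF k(1) _ I, of "\<lambda>i. pseudo_inverse \<psi> (\<psi> (z i))"] k(2) by simp
  moreover have "\<psi> (\<Sum>i\<in>I. z i) = 0"
    using generatorD(6)[OF g z[OF k(1)], of "\<Sum>i\<in>I. z i"] generatorD(4)[OF g, of "\<Sum>i\<in>I. z i"]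
      member_le_sum[OF k(1) _ I, of z] z k(2) by (simp add: sum_nonneg)
  ultimately show ?thesis
    using gen_ext_beyond_zero[OF g] by simp
qed

text \<open>A strictly positive generator takes the value 0 only at \<infinity>, so a point with a
  zero coordinate need not have the form treated in
  \<open>gen_ext_pseudo_inverse_sum\<close>.\<close>

lemma archimedean_zero:
  assumes g: "generator \<psi>" and I: "finite I" "k \<in> I" "x k = 0"
  shows "gen_ext \<psi> (\<Sum>i\<in>I. pseudo_inverse \<psi> (x i)) = 0"
proof (rule gen_ext_beyond_zero[OF g])
  show "pseudo_inverse \<psi> 0 \<le> (\<Sum>i\<in>I. pseudo_inverse \<psi> (x i))"
    using member_le_sum[OF I(2) _ I(1), of "\<lambda>i. pseudo_inverse \<psi> (x i)"] I(3) by simp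
qed

section \<open>Completely monotone sequences of finite order\<close>

text \<open>The sign is opposite to that of the forward difference, so that all iterates are
  nonnegative on completely monotone sequences.\<close>

definition bdiff :: "(nat \<Rightarrow> real) \<Rightarrow> nat \<Rightarrow> real" where
  "bdiff q j = q j - q (Suc j)"

lemma bdiff_pow_Suc: "(bdiff ^^ Suc k) q j = (bdiff ^^ k) q j - (bdiff ^^ k) q (Suc j)"
  by (simp add: bdiff_def)

lemma bdiff_pow_tendsto_0:
  assumes "q \<longlonglongrightarrow> 0"
  shows "(bdiff ^^ k) q \<longlonglongrightarrow> 0"
proof (induction k)
  case (Suc k)
  have "(\<lambda>j. (bdiff ^^ k) q j - (bdiff ^^ k) q (Suc j)) \<longlonglongrightarrow> 0 - 0"
    using Suc by (intro tendsto_diff) (auto simp: filterlim_sequentially_Suc)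
  then show ?case
    by (simp add: bdiff_def[abs_def])
qed (use assms in simp)

lemma bdiff_pow_antimono:
  assumes "\<And>j. 0 \<le> (bdiff ^^ Suc k) q j"
  shows "decseq ((bdiff ^^ k) q)"
  using assms unfolding decseq_Suc_iff bdiff_pow_Suc by simp

text \<open>A nonnegative difference of order \<open>k + 1\<close> makes the one of order
  \<open>k\<close> decrease to its limit 0, so nonnegativity descends from the top order.\<close>

lemma bdiff_pow_nonneg:
  assumes q: "q \<longlonglongrightarrow> 0" and n: "\<And>j. 0 \<le> (bdiff ^^ n) q j" and k: "k \<le> n"
  shows "0 \<le> (bdiff ^^ k) q j"
  using k
proof (induction arbitrary: j rule: inc_induct)
  case (step k)
  then show ?case
    using decseq_ge[OF bdiff_pow_antimono bdiff_pow_tendsto_0[OF q]] by blast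
qed (rule n)

text \<open>A Taylor expansion at infinity: \<open>Suc e\<close> summations undo as many
  differences, and the binomial coefficients are the weights of the iterated sum.\<close>

lemma sums_bdiff_pow:
  assumes q: "q \<longlonglongrightarrow> 0" and n: "\<And>j. 0 \<le> (bdiff ^^ Suc e) q j"
  shows "(\<lambda>m. real ((m + e) choose e) * (bdiff ^^ Suc e) q (j + m)) sums q j"
  using n
proof (induction e)
  case 0
  have "(\<lambda>m. q (j + m)) \<longlonglongrightarrow> 0"
    using LIMSEQ_ignore_initial_segment[OF q, of j] by (simp add: add.commute)
  from telescope_sums'[OF this] show ?case
    by (simp add: bdiff_def)
next
  case (Suc e)
  define a where "a = (bdiff ^^ Suc (Suc e)) q"
  define b where "b = (bdiff ^^ Suc e) q"
  have a: "a i = b i - b (Suc i)" for i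
    unfolding a_def b_def by (rule bdiff_pow_Suc)
  have b0: "0 \<le> b i" for i
    unfolding b_def using Suc.prems by (rule bdiff_pow_nonneg[OF q]) simp
  have a0: "0 \<le> a i" for i
    unfolding a_def by (rule Suc.prems)
  have dec: "decseq b"
    unfolding decseq_Suc_iff using a0 a by simp
  have IH: "(\<lambda>m. real ((m + e) choose e) * b (j + m)) sums q j"
    using b0 unfolding b_def by (rule Suc.IH)
  define s where "s N = (\<Sum>m<N. real ((m + Suc e) choose Suc e) * a (j + m))" for N
  \<comment> \<open>Summation by parts, with Pascal's rule for the increments of the coefficients;
    the hockey-stick identity \<open>ch\<close> absorbs the boundary term into the sum.\<close>
  have s: "s N = (\<Sum>m<N. real ((m + e) choose e) * (b (j + m) - b (j + N)))" for N
  proof -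
    have ch: "(\<Sum>m<N. real ((m + e) choose e)) = real ((N + e) choose Suc e)" for N
      by (induction N) auto
    have "s N + real ((N + e) choose Suc e) * b (j + N) = (\<Sum>m<N. real ((m + e) choose e) * b (j + m))"
      unfolding s_def by (induction N) (auto simp: a algebra_simps)
    then show ?thesis
      by (simp add: right_diff_distrib sum_subtractf sum_distrib_right[symmetric] ch)
  qed
  have le: "s N \<le> q j" for N
  proof -
    have "s N \<le> (\<Sum>m<N. real ((m + e) choose e) * b (j + m))"
      unfolding s using b0 by (intro sum_mono mult_left_mono) auto
    also have "\<dots> \<le> q j"
      using IH b0 sum_le_suminf[OF sums_summable[OF IH]] sums_unique[OF IH] by auto
    finally show ?thesis .
  qed
  have "summable (\<lambda>m. real ((m + Suc e) choose Suc e) * a (j + m))"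
    using le a0 unfolding s_def by (intro summableI_nonneg_bounded) auto
  then obtain L where L: "(\<lambda>m. real ((m + Suc e) choose Suc e) * a (j + m)) sums L"
    by (auto simp: summable_def)
  then have sL: "s \<longlonglongrightarrow> L"
    by (simp add: sums_def s_def[abs_def])
  have "L \<le> q j"
    using LIMSEQ_le_const2[OF sL] le by blast
  \<comment> \<open>Keeping the cutoff \<open>N0\<close> while \<open>N\<close> grows gives the
    lower bound without any rate of decay for the boundary term.\<close>
  moreover have "(\<Sum>m<N0. real ((m + e) choose e) * b (j + m)) \<le> L" for N0
  proof -
    have "(\<lambda>N. b (j + N)) \<longlonglongrightarrow> 0"
      using LIMSEQ_ignore_initial_segment[OF bdiff_pow_tendsto_0[OF q, of "Suc e"], of j]
      by (simp add: add.commute b_def)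
    then have "(\<lambda>N. \<Sum>m<N0. real ((m + e) choose e) * (b (j + m) - b (j + N)))
        \<longlonglongrightarrow> (\<Sum>m<N0. real ((m + e) choose e) * (b (j + m) - 0))"
      by (intro tendsto_intros)
    moreover have "(\<Sum>m<N0. real ((m + e) choose e) * (b (j + m) - b (j + N))) \<le> s N"
      if "N0 \<le> N" for N
      unfolding s using that dec by (intro sum_mono2) (auto simp: decseq_def)
    ultimately show ?thesis
      using LIMSEQ_le[OF _ sL] by fastforce
  qed
  then have "q j \<le> L"
    using LIMSEQ_le_const2[of "\<lambda>N. \<Sum>m<N. real ((m + e) choose e) * b (j + m)" "q j" L] IH
    by (auto simp: sums_def)
  ultimately show ?case
    using L unfolding a_def by simp
qed

section \<open>Mixtures of simplex generators\<close>

text \<open>The Williamson transform, in dimension \<open>e + 1\<close>, of the discrete law with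
  mass \<open>w m\<close> at radius \<open>r m\<close>.\<close>

definition simplex_gen :: "nat \<Rightarrow> nat set \<Rightarrow> (nat \<Rightarrow> real) \<Rightarrow> (nat \<Rightarrow> real) \<Rightarrow> real \<Rightarrow> real" where
  "simplex_gen e I w r x = (\<Sum>m\<in>I. w m * (max 0 (1 - x / r m)) ^ e)"

text \<open>The number \<open>e\<close> is one less than the dimension. For \<open>e = 0\<close>
  every summand would be constant, since \<open>0 ^ 0 = 1\<close>; with \<open>1 \<le> e\<close> a
  summand vanishes beyond its radius.\<close>

locale finite_mixture =
  fixes e :: nat and I :: "nat set" and w r :: "nat \<Rightarrow> real"
  assumes e_pos: "1 \<le> e" and fin: "finite I"
    and w_pos: "\<And>m. m \<in> I \<Longrightarrow> 0 < w m" and w_sum: "sum w I = 1"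
    and r_pos: "\<And>m. m \<in> I \<Longrightarrow> 0 < r m"
begin

abbreviation G :: "real \<Rightarrow> real" where
  "G \<equiv> simplex_gen e I w r"

definition R :: real where
  "R = Max (r ` I)"

lemma nonempty: "I \<noteq> {}"
  using w_sum by auto

lemma r_le_R: "m \<in> I \<Longrightarrow> r m \<le> R"
  unfolding R_def using fin by auto

lemma R_attained: obtains m where "m \<in> I" "r m = R"
proof -
  have "R \<in> r ` I"
    unfolding R_def using fin nonempty by (intro Max_in) auto
  then show ?thesis
    using that by auto
qed

lemma R_pos: "0 < R"
  using R_attained r_pos by metis

lemma G_0: "G 0 = 1"
  by (simp add: simplex_gen_def w_sum)

lemma G_nonneg: "0 \<le> G x"
  unfolding simplex_gen_def using w_pos by (auto intro!: sum_nonneg mult_nonneg_nonneg simp: less_imp_le)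

lemma G_term_antimono:
  assumes "m \<in> I" "x \<le> y"
  shows "w m * (max 0 (1 - y / r m)) ^ e \<le> w m * (max 0 (1 - x / r m)) ^ e"
proof -
  have "x / r m \<le> y / r m"
    using assms r_pos[of m] by (simp add: divide_right_mono)
  then show ?thesis
    using w_pos[OF assms(1)] by (intro mult_left_mono power_mono) auto
qed

lemma G_antimono: "x \<le> y \<Longrightarrow> G y \<le> G x"
  unfolding simplex_gen_def by (intro sum_mono G_term_antimono)

lemma G_beyond: "R \<le> x \<Longrightarrow> G x = 0"
proof -
  assume x: "R \<le> x"
  have "max 0 (1 - x / r m) = 0" if "m \<in> I" for m
    using x r_le_R[OF that] r_pos[OF that] by (simp add: le_divide_eq)
  then show ?thesis
    using e_pos by (simp add: simplex_gen_def zero_power)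
qed

text \<open>The summand of the largest radius alone decreases strictly up to \<open>R\<close>; the
  others only have to be non-increasing.\<close>

lemma G_strict:
  assumes "x < y" "x < R"
  shows "G y < G x"
proof -
  obtain m where m: "m \<in> I" "r m = R"
    by (rule R_attained)
  have "max 0 (1 - y / R) < max 0 (1 - x / R)"
    using assms R_pos by (auto simp: divide_strict_right_mono max_def)
  then have "w m * (max 0 (1 - y / r m)) ^ e < w m * (max 0 (1 - x / r m)) ^ e"
    using w_pos[OF m(1)] m(2) e_pos by (intro mult_strict_left_mono power_strict_mono) auto
  then show ?thesis
    unfolding simplex_gen_def using m(1) fin assms
    by (intro sum_strict_mono_ex1) (auto intro: G_term_antimono)
qed

lemma G_inj: "inj_on G {0..R}"
proof (rule inj_onI)
  fix x y assume "x \<in> {0..R}" "y \<in> {0..R}" "G x = G y"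
  then show "x = y"
    using G_strict[of x y] G_strict[of y x] by (cases x y rule: linorder_cases) auto
qed

lemma generator_G: "generator G"
proof -
  have "continuous_on {0..} G"
    unfolding simplex_gen_def[abs_def] using r_pos
    by (intro continuous_intros) (auto simp: less_imp_neq[symmetric])
  moreover have "G ` {0..} \<subseteq> {0..1}"
    using G_nonneg G_antimono G_0 by fastforce
  moreover have "(G \<longlongrightarrow> 0) at_top"
  proof (rule tendsto_eventually)
    show "eventually (\<lambda>x. G x = 0) at_top"
      using eventually_ge_at_top[of R] by eventually_elim (rule G_beyond)
  qed
  moreover have "G y < G x"
    if "0 \<le> x" "x < y" "ennreal y < Inf (ennreal ` {z. 0 \<le> z \<and> G z = 0})" for x y
  proof (rule G_strict)
    have "Inf (ennreal ` {z. 0 \<le> z \<and> G z = 0}) \<le> ennreal R"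
      using R_pos G_beyond[of R] by (intro Inf_lower) auto
    then have "ennreal y < ennreal R"
      using that(3) by order
    then show "x < R"
      using that by (simp add: ennreal_less_iff)
  qed (rule that)
  ultimately show ?thesis
    unfolding generator_def using G_0 G_antimono by (auto simp: monotone_on_def)
qed

lemma G_attains:
  assumes "0 \<le> y" "y \<le> 1"
  obtains z where "0 \<le> z" "z \<le> R" "G z = y"
proof (cases "y = 0")
  case True
  then show ?thesis
    using that[of R] R_pos G_beyond[of R] by simp
next
  case False
  then obtain z where "0 \<le> z" "G z = y"
    using generator_attains[OF generator_G, of y] assms by auto
  moreover from this have "z \<le> R"
    using G_beyond[of z] False by linarith
  ultimately show ?thesis
    using that by blast
qed

end

section \<open>Uniform approximation of generators by finite mixtures\<close>

lemma power_fact_binomial_bounds: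
  "real n ^ e / fact e \<le> real ((n + e) choose e)"
  "real ((n + e) choose e) \<le> real (n + e) ^ e / fact e"
proof -
  \<comment> \<open>Times \<open>fact e\<close>, the coefficient is the product of the factors
    \<open>n + 1\<close> up to \<open>n + e\<close>, all of which lie between \<open>n\<close> and
    \<open>n + e\<close>.\<close>
  have "real n ^ e \<le> real ((n + e) choose e) * fact e \<and>
      real ((n + e) choose e) * fact e \<le> real (n + e) ^ e"
  proof (induction e)
    case (Suc e)
    have "real (Suc e) * real ((n + Suc e) choose Suc e) = real (Suc (n + e)) * real ((n + e) choose e)"
      unfolding of_nat_mult[symmetric] by (simp only: add_Suc_right Suc_times_binomial_eq mult.commute)
    moreover have "real ((n + Suc e) choose Suc e) * fact (Suc e) =
        real (Suc e) * real ((n + Suc e) choose Suc e) * fact e"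
      by (simp only: fact_Suc of_nat_mult mult_ac)
    ultimately have eq: "real ((n + Suc e) choose Suc e) * fact (Suc e) =
        real (n + Suc e) * (real ((n + e) choose e) * fact e)"
      by (simp only: add_Suc_right mult.assoc)
    have "real n ^ Suc e \<le> real (n + Suc e) * (real ((n + e) choose e) * fact e)"
      using Suc by (simp only: power_Suc) (intro mult_mono; simp)
    moreover have "real (n + e) ^ e \<le> real (n + Suc e) ^ e"
      by (intro power_mono) auto
    then have "real (n + Suc e) * (real ((n + e) choose e) * fact e) \<le> real (n + Suc e) ^ Suc e"
      using Suc by (simp only: power_Suc) (intro mult_left_mono; simp)
    ultimately show ?case
      unfolding eq by blast
  qed simp
  then show "real n ^ e / fact e \<le> real ((n + e) choose e)"
    "real ((n + e) choose e) \<le> real (n + e) ^ e / fact e"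
    by (simp_all add: field_simps)
qed

text \<open>
  On a lattice of mesh \<open>h\<close>, a generator is a mixture of binomial coefficients
  \<open>(m - j + e) choose e\<close>, which are replaced by the powers \<open>(m - j) ^ e / fact e\<close>. The error is
  controlled because the two agree up to a shift of \<open>m\<close> by at most \<open>e\<close>.
\<close>

lemma generator_approximation:
  assumes g: "generator \<psi>" and e: "1 \<le> e" and eps: "0 < \<epsilon>"
    and mono: "\<And>h j. 0 < h \<Longrightarrow> 0 \<le> (bdiff ^^ Suc e) (\<lambda>i. \<psi> (real i * h)) j"
  obtains I w r where "finite_mixture e I w r"
    "\<And>x. 0 \<le> x \<Longrightarrow> \<bar>\<psi> x - simplex_gen e I w r x\<bar> \<le> \<epsilon>"
proof -
  \<comment> \<open>Half of \<open>4 * \<delta>\<close> pays for replacing \<open>\<psi>\<close> by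
    \<open>F\<close>, the other half for dividing by \<open>F 0\<close>. The minimum with 1 keeps
    \<open>F 0\<close> positive.\<close>
  define \<delta> where "\<delta> = min \<epsilon> 1 / 4"
  have \<delta>: "0 < \<delta>" "4 * \<delta> \<le> \<epsilon>" "4 * \<delta> \<le> 1"
    using eps by (auto simp: \<delta>_def)
  have "\<exists>t>0. \<forall>x\<in>{0..}. dist x 0 < t \<longrightarrow> dist (\<psi> x) (\<psi> 0) < \<delta>"
    using bspec[OF generatorD(1)[OF g, unfolded continuous_on_iff], of 0] \<delta>(1)
    by (meson atLeast_iff order_refl)
  then obtain t where t: "0 < t" "\<And>x. 0 \<le> x \<Longrightarrow> x < t \<Longrightarrow> \<bar>\<psi> x - 1\<bar> < \<delta>"
    by (auto simp: dist_real_def generatorD(2)[OF g])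
  \<comment> \<open>Rounding to the lattice costs one step and the binomial shift costs
    \<open>e\<close>, so \<open>Suc e\<close> steps must stay where \<open>\<psi>\<close> is close
    to 1.\<close>
  obtain h where h: "0 < h" "real (Suc e) * h < t"
  proof -
    have "0 < t / real (Suc e)"
      using t(1) by (intro divide_pos_pos) auto
    then obtain h where "0 < h" "h < t / real (Suc e)"
      using dense by blast
    then show ?thesis
      using that[of h] by (simp add: pos_less_divide_eq mult.commute del: of_nat_Suc)
  qed
  define p where "p = (\<lambda>i. \<psi> (real i * h))"
  define a where "a = (bdiff ^^ Suc e) p"
  define c where "c m = real ((m + e) choose e)" for m
  have a0: "0 \<le> a j" for j
    unfolding a_def p_def using mono h(1) by blast
  have p_lim: "p \<longlonglongrightarrow> 0"
    unfolding p_def using generatorD(3)[OF g]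
  proof (rule filterlim_compose)
    show "filterlim (\<lambda>i. real i * h) at_top sequentially"
      using h(1) by (intro filterlim_at_top_mult_tendsto_pos[of _ h]) (auto intro: filterlim_real_sequentially)
  qed
  have p_anti: "p k \<le> p j" if "j \<le> k" for j k
    unfolding p_def using that h(1) by (intro generatorD(6)[OF g]) auto
  have p_sums: "(\<lambda>m. c m * a (j + m)) sums p j" for j
    unfolding c_def a_def by (rule sums_bdiff_pow[OF p_lim]) (use a0 a_def in auto)
  have p0: "p 0 = 1"
    by (simp add: p_def generatorD(2)[OF g])
  \<comment> \<open>Nonnegative second differences, available because \<open>1 \<le> e\<close>, make
    the sequence convex: its largest drop over \<open>Suc e\<close> steps occurs at 0, where
    continuity bounds it.\<close>
  have p_shift: "p j - p (j + Suc e) \<le> \<delta>" for j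
  proof -
    have tel: "p j - p (j + n) = (\<Sum>i<n. bdiff p (j + i))" for j n
      by (induction n) (auto simp: bdiff_def)
    have "0 \<le> (bdiff ^^ 2) p i" for i
      by (rule bdiff_pow_nonneg[OF p_lim, of "Suc e"]) (use e a0 in \<open>auto simp: a_def\<close>)
    then have "decseq (bdiff p)"
      unfolding decseq_Suc_iff by (simp add: numeral_2_eq_2 bdiff_def algebra_simps)
    then have "(\<Sum>i<Suc e. bdiff p (j + i)) \<le> (\<Sum>i<Suc e. bdiff p (0 + i))"
      by (intro sum_mono) (auto simp: decseq_def)
    then have "p j - p (j + Suc e) \<le> p 0 - p (0 + Suc e)"
      unfolding tel .
    also have "\<dots> \<le> \<delta>"
      using t(2)[of "real (Suc e) * h"] h p0 by (simp add: p_def)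
    finally show ?thesis .
  qed
  have "(\<lambda>M. \<Sum>m<M. c m * a m) \<longlonglongrightarrow> p 0"
    using p_sums[of 0] by (simp add: sums_def)
  then have "eventually (\<lambda>M. p 0 - \<delta> < (\<Sum>m<M. c m * a m)) sequentially"
    using \<delta>(1) by (intro order_tendstoD) auto
  \<comment> \<open>Truncation leaves finitely many radii. The loss is measured at 0, where the
    whole series has sum 1.\<close>
  then obtain M where M: "p 0 - (\<Sum>m<M. c m * a m) < \<delta>"
    by (auto simp: eventually_sequentially algebra_simps)
  define F where "F x = (\<Sum>m<M. a m / fact e * (max 0 (real m - x / h)) ^ e)" for x
  have F_anti: "F y \<le> F x" if "x \<le> y" for x y
  proof -
    have "x / h \<le> y / h"
      using that h(1) by (simp add: divide_right_mono)
    then show ?thesis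
      unfolding F_def using a0 by (intro sum_mono mult_left_mono power_mono) auto
  qed
  have F_0: "0 \<le> F x" for x
    unfolding F_def using a0 by (intro sum_nonneg mult_nonneg_nonneg) auto
  have F_upper: "F (real j * h) \<le> p j" for j
  proof -
    have "F (real j * h) = (\<Sum>m<M. a m / fact e * (max 0 (real m - real j)) ^ e)"
      using h(1) by (simp add: F_def)
    also have "\<dots> = (\<Sum>m\<in>{j..<M}. a m / fact e * (max 0 (real m - real j)) ^ e)"
      using e by (intro sum.mono_neutral_right) auto
    also have "\<dots> = (\<Sum>i<M - j. a (j + i) / fact e * real i ^ e)"
      by (intro sum.reindex_bij_witness[of _ "\<lambda>i. j + i" "\<lambda>m. m - j"]) auto
    also have "\<dots> = (\<Sum>i<M - j. real i ^ e / fact e * a (j + i))"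
      by (simp add: field_simps)
    also have "\<dots> \<le> (\<Sum>i<M - j. c i * a (j + i))"
      using a0 unfolding c_def by (intro sum_mono mult_right_mono power_fact_binomial_bounds) auto
    also have "\<dots> \<le> p j"
      using sum_le_suminf[OF sums_summable[OF p_sums[of j]], of "{..<M - j}"] sums_unique[OF p_sums[of j]] a0
      by (simp add: c_def)
    finally show ?thesis .
  qed
  have F_lower: "p (j + e) - \<delta> \<le> F (real j * h)" for j
  proof -
    \<comment> \<open>\<open>N\<close> and \<open>K\<close> mark the same entry of \<open>a\<close>
      in the series for \<open>p (j + e)\<close> and for \<open>p 0\<close>. Binomial coefficients
      grow, so the tail at \<open>j + e\<close> is dominated by the tail at 0, and \<open>K\<close>
      is at least \<open>M\<close>.\<close>
    define N where "N = M - (j + e)"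
    define K where "K = N + (j + e)"
    have S1: "(\<lambda>i. c (i + N) * a (j + e + (i + N))) sums (p (j + e) - (\<Sum>i<N. c i * a (j + e + i)))"
      using p_sums[of "j + e"] by (rule sums_split_initial_segment)
    have S2: "(\<lambda>i. c (i + K) * a (0 + (i + K))) sums (p 0 - (\<Sum>i<K. c i * a (0 + i)))"
      using p_sums[of 0] by (rule sums_split_initial_segment)
    have le: "c (i + N) * a (j + e + (i + N)) \<le> c (i + K) * a (0 + (i + K))" for i
    proof -
      have "c (i + N) \<le> c (i + K)"
        unfolding c_def K_def of_nat_le_iff by (intro binomial_right_mono) simp
      moreover have "j + e + (i + N) = 0 + (i + K)"
        by (simp add: K_def)
      ultimately show ?thesis
        using a0 by (simp only: mult_right_mono)
    qed
    have "p (j + e) - (\<Sum>i<N. c i * a (j + e + i)) \<le> p 0 - (\<Sum>i<K. c i * a (0 + i))"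
      by (rule sums_le[OF le S1 S2])
    also have "\<dots> \<le> p 0 - (\<Sum>i<M. c i * a i)"
      using a0 unfolding K_def N_def c_def by (auto intro!: sum_mono2)
    finally have "p (j + e) - \<delta> \<le> (\<Sum>i<N. c i * a (j + e + i))"
      using M by linarith
    \<comment> \<open>The shift by \<open>e\<close> enters here: for \<open>m = j + e + i\<close>
      the difference \<open>m - j\<close> is \<open>i + e\<close>, the base in the upper bound of
      the binomial coefficient.\<close>
    also have "\<dots> \<le> (\<Sum>i<N. real (i + e) ^ e / fact e * a (j + e + i))"
      using a0 unfolding c_def by (intro sum_mono mult_right_mono power_fact_binomial_bounds) auto
    also have "\<dots> = (\<Sum>m\<in>{j + e..<M}. a m / fact e * (max 0 (real m - real j)) ^ e)"
      unfolding N_def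
      by (intro sum.reindex_bij_witness[of _ "\<lambda>m. m - (j + e)" "\<lambda>i. j + e + i"])
        (auto simp: algebra_simps max_def)
    also have "\<dots> \<le> (\<Sum>m<M. a m / fact e * (max 0 (real m - real j)) ^ e)"
      using a0 by (intro sum_mono2) auto
    also have "\<dots> = F (real j * h)"
      using h(1) by (simp add: F_def)
    finally show ?thesis .
  qed
  have close: "\<bar>\<psi> x - F x\<bar> \<le> 2 * \<delta>" if x: "0 \<le> x" for x
  proof -
    define j where "j = nat \<lfloor>x / h\<rfloor>"
    have "real j \<le> x / h" "x / h \<le> real (Suc j)"
      using x h(1) unfolding j_def by (simp_all, linarith+)
    then have j: "real j * h \<le> x" "x \<le> real (Suc j) * h"
      using h(1) by (simp_all add: field_simps)
    have "\<psi> x \<le> p j" "p (Suc j) \<le> \<psi> x"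
      unfolding p_def using j h(1) x by (auto intro!: generatorD(6)[OF g])
    moreover have "F x \<le> p j" "p (Suc j + e) - \<delta> \<le> F x"
      using F_anti[OF j(1)] F_anti[OF j(2)] F_upper[of j] F_lower[of "Suc j"] by linarith+
    moreover have "p j - p (Suc j + e) \<le> \<delta>" "p (Suc j + e) \<le> p (Suc j)"
      using p_shift[of j] p_anti[of "Suc j" "Suc j + e"] by simp_all
    ultimately show ?thesis
      using \<delta>(1) by linarith
  qed
  have F0: "1 - 2 * \<delta> \<le> F 0" "F 0 \<le> 1"
    using close[of 0] F_upper[of 0] generatorD(2)[OF g] p0 by simp_all
  then have F0_pos: "0 < F 0"
    using \<delta> by linarith
  \<comment> \<open>The locale asks for positive radii and weights, so \<open>m = 0\<close> and
    vanishing differences are dropped; they contribute nothing for \<open>x \<ge> 0\<close>. The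
    factor \<open>real m ^ e\<close> in \<open>w\<close> comes from
    \<open>m - x / h = m * (1 - x / r m)\<close>.\<close>
  define I where "I = {m. m < M \<and> 1 \<le> m \<and> 0 < a m}"
  define w where "w m = a m * real m ^ e / (fact e * F 0)" for m
  define r where "r m = real m * h" for m
  have F_gen: "simplex_gen e I w r x = F x / F 0" if x: "0 \<le> x" for x
  proof -
    have "F x = (\<Sum>m\<in>I. a m / fact e * (max 0 (real m - x / h)) ^ e)"
      unfolding F_def
    proof (rule sum.mono_neutral_right)
      show "\<forall>m\<in>{..<M} - I. a m / fact e * (max 0 (real m - x / h)) ^ e = 0"
      proof
        fix m assume "m \<in> {..<M} - I"
        then have "m = 0 \<or> a m = 0"
          using a0[of m] by (force simp: I_def)
        moreover have "max 0 (real 0 - x / h) = 0"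
          using x h(1) by (intro max_absorb1) simp
        ultimately show "a m / fact e * (max 0 (real m - x / h)) ^ e = 0"
          using e by (auto simp: zero_power)
      qed
    qed (auto simp: I_def)
    also have "\<dots> = (\<Sum>m\<in>I. F 0 * (w m * (max 0 (1 - x / r m)) ^ e))"
    proof (rule sum.cong)
      fix m assume m: "m \<in> I"
      have "max 0 (real m - x / h) = real m * max 0 (1 - x / r m)"
        using m h(1) by (auto simp: I_def r_def max_def field_simps)
      then show "a m / fact e * (max 0 (real m - x / h)) ^ e = F 0 * (w m * (max 0 (1 - x / r m)) ^ e)"
        using F0_pos by (simp add: w_def power_mult_distrib field_simps)
    qed simp
    finally show ?thesis
      using F0_pos by (simp add: simplex_gen_def sum_distrib_left[symmetric])
  qed
  show ?thesis
  proof (rule that)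
    show "finite_mixture e I w r"
    proof
      show "sum w I = 1"
        using F_gen[of 0] F0_pos by (simp add: simplex_gen_def)
    qed (use e h(1) F0_pos in \<open>auto simp: I_def w_def r_def\<close>)
    fix x :: real assume x: "0 \<le> x"
    have "F x \<le> F 0"
      using F_anti x by blast
    then have "F x / F 0 - F x \<le> 1 - F 0"
      using F0_pos F0 mult_right_mono[of "F x" "F 0" "1 - F 0"] by (simp add: field_simps)
    moreover have "F x \<le> F x / F 0"
      using F0_pos F0 F_0[of x] by (simp add: le_divide_eq mult_left_le)
    ultimately show "\<bar>\<psi> x - simplex_gen e I w r x\<bar> \<le> \<epsilon>"
      using close[OF x] F0 \<delta> unfolding F_gen[OF x] by linarith
  qed
qed

section \<open>Distribution functions on the cube\<close>

lemma measurable_cube_coord: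
  assumes "i < d"
  shows "(\<lambda>y. y i) \<in> borel_measurable (cube_borel d)" "(\<lambda>y. y i) \<in> cube_borel d \<rightarrow>\<^sub>M unit_borel"
proof -
  show "(\<lambda>y. y i) \<in> cube_borel d \<rightarrow>\<^sub>M unit_borel"
    unfolding cube_borel_def using assms by (intro measurable_component_singleton) auto
  then show "(\<lambda>y. y i) \<in> borel_measurable (cube_borel d)"
    unfolding unit_borel_def by (simp add: measurable_restrict_space2_iff)
qed

lemma sets_cube_coord:
  assumes "i < d" "A \<in> sets borel"
  shows "{y \<in> unit_cube d. y i \<in> A} \<in> sets (cube_borel d)"
  using measurable_sets[OF measurable_cube_coord(1)[OF assms(1)] assms(2)]
  by (simp add: vimage_def Int_def conj_commute)

lemma sets_cube_coord_le: "i < d \<Longrightarrow> {y \<in> unit_cube d. y i \<le> u} \<in> sets (cube_borel d)"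
  using sets_cube_coord[of i d "{..u}"] by simp

lemma sets_lower_box: "{y \<in> unit_cube d. \<forall>i<d. y i \<le> x i} \<in> sets (cube_borel d)"
proof -
  have "{y \<in> space (cube_borel d). \<forall>i\<in>{..<d}. y i \<le> x i} \<in> sets (cube_borel d)"
    using measurable_cube_coord(1)[of _ d]
    by (intro sets.sets_Collect_finite_All) (auto simp: borel_measurable_iff_le)
  then show ?thesis
    by (simp only: space_cube_borel Ball_def lessThan_iff)
qed

lemma coord_restrict_mem_cube:
  "(\<And>i. i < d \<Longrightarrow> 0 \<le> f i) \<Longrightarrow> (\<And>i. i < d \<Longrightarrow> f i \<le> 1) \<Longrightarrow> (\<lambda>i\<in>{..<d}. f i) \<in> unit_cube d"
  by (auto simp: unit_cube_def)

lemma has_cdfD: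
  assumes "has_cdf d M C"
  shows "prob_space M" "sets M = sets (cube_borel d)" "space M = unit_cube d"
    "\<And>x. x \<in> unit_cube d \<Longrightarrow> measure M {y \<in> unit_cube d. \<forall>i<d. y i \<le> x i} = C x"
  using assms sets_eq_imp_space_eq[of M "cube_borel d"] by (auto simp: has_cdf_def)

lemma measurable_has_cdf:
  assumes "has_cdf d M C"
  shows "f \<in> M \<rightarrow>\<^sub>M N \<longleftrightarrow> f \<in> cube_borel d \<rightarrow>\<^sub>M N"
  using has_cdfD(2)[OF assms] measurable_cong_sets by blast

lemma coord_box_eq:
  assumes "i < d" "0 \<le> u" "u \<le> 1"
  shows "{y \<in> unit_cube d. y i \<le> u} =
    {y \<in> unit_cube d. \<forall>j<d. y j \<le> (\<lambda>j\<in>{..<d}. if j = i then u else 1) j}"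
  using assms unit_cubeD(2) by auto

text \<open>The event \<open>y i \<le> u\<close> is a lower box whose other sides are 1, and a law
  on the line is determined by its distribution function.\<close>

lemma has_cdf_uniform_marginal:
  assumes M: "has_cdf d M C" and i: "i < d"
    and u: "\<And>u. 0 \<le> u \<Longrightarrow> u \<le> 1 \<Longrightarrow> C (\<lambda>j\<in>{..<d}. if j = i then u else 1) = u"
  shows "distr M borel (\<lambda>x. x i) = uniform_measure lborel {0..1}"
proof (rule cdf_unique)
  interpret prob_space M
    by (rule has_cdfD(1)[OF M])
  have meas: "(\<lambda>x. x i) \<in> borel_measurable M"
    unfolding measurable_has_cdf[OF M] by (rule measurable_cube_coord[OF i])
  show "real_distribution (distr M borel (\<lambda>x. x i))"
    using prob_space_distr[OF meas] by (simp add: real_distribution_def real_distribution_axioms_def)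
  show "real_distribution (uniform_measure lborel {0..1})"
    using prob_space_uniform_measure[of lborel "{0..1::real}"]
    by (simp add: real_distribution_def real_distribution_axioms_def)
  show "cdf (distr M borel (\<lambda>x. x i)) = cdf (uniform_measure lborel {0..1})"
  proof
    fix t :: real
    have "cdf (distr M borel (\<lambda>x. x i)) t = measure M {y \<in> unit_cube d. y i \<le> t}"
      unfolding cdf_def using meas
      by (simp add: measure_distr vimage_def Int_def has_cdfD(3)[OF M] conj_commute)
    moreover have "cdf (uniform_measure lborel {0..1}) t = measure lborel ({0..1} \<inter> {..t})"
      unfolding cdf_def by (subst measure_uniform_measure) auto
    moreover consider "t < 0" | "0 \<le> t" "t \<le> 1" | "1 < t"
      by linarith
    then have "measure M {y \<in> unit_cube d. y i \<le> t} = measure lborel ({0..1} \<inter> {..t})"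
    proof cases
      case 1
      then have "{y \<in> unit_cube d. y i \<le> t} = {}" "{0..1} \<inter> {..t} = {}"
        using unit_cubeD(1)[OF _ i] by fastforce+
      then show ?thesis
        by (simp only: measure_empty)
    next
      case 2
      then have "{0..1} \<inter> {..t} = {0..t}"
        by auto
      moreover have "measure M {y \<in> unit_cube d. y i \<le> t} = t"
        unfolding coord_box_eq[OF i 2] using has_cdfD(4)[OF M] u[OF 2] 2
        by (subst has_cdfD(4)[OF M]) (auto intro!: coord_restrict_mem_cube)
      ultimately show ?thesis
        using 2 by simp
    next
      case 3
      then have "{y \<in> unit_cube d. y i \<le> t} = space M" "{0..1} \<inter> {..t} = {0..1}"
        using unit_cubeD(2)[OF _ i] has_cdfD(3)[OF M] by fastforce+
      then show ?thesis
        by (simp add: prob_space)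
    qed
    ultimately show "cdf (distr M borel (\<lambda>x. x i)) t = cdf (uniform_measure lborel {0..1}) t"
      by simp
  qed
qed

lemma copula_marginal:
  assumes C: "copula d C" and i: "i < d" and u: "0 \<le> u" "u \<le> 1"
  shows "measure (copula_measure d C) {y \<in> unit_cube d. y i \<le> u} = u"
proof -
  obtain M where M: "has_cdf d M C" "distr M borel (\<lambda>x. x i) = uniform_measure lborel {0..1}"
    using C i by (auto simp: copula_def)
  have eq: "copula_measure d C = M"
    by (rule has_cdf_unique[OF has_cdf_copula_measure[OF C] M(1)])
  have meas: "(\<lambda>x. x i) \<in> borel_measurable M"
    unfolding measurable_has_cdf[OF M(1)] by (rule measurable_cube_coord[OF i])
  have "measure M {y \<in> unit_cube d. y i \<le> u} = measure (distr M borel (\<lambda>x. x i)) {..u}"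
    using meas by (simp add: measure_distr vimage_def Int_def has_cdfD(3)[OF M(1)] conj_commute)
  also have "\<dots> = measure lborel ({0..1} \<inter> {..u})"
    unfolding M(2) by (subst measure_uniform_measure) auto
  also have "{0..1} \<inter> {..u} = {0..u}"
    using u by auto
  finally show ?thesis
    using u eq by simp
qed

text \<open>Leaving the lower box of \<open>y\<close> while staying in that of \<open>x\<close>
  forces some coordinate into the slab between \<open>y i\<close> and \<open>x i\<close>, and
  uniform marginals bound the mass of each slab by its width.\<close>

lemma copula_increment:
  assumes C: "copula d C" and x: "x \<in> unit_cube d" and y: "y \<in> unit_cube d"
  shows "C x - C y \<le> (\<Sum>i<d. \<bar>x i - y i\<bar>)"
proof -
  define M where "M = copula_measure d C"
  have M: "has_cdf d M C"
    unfolding M_def by (rule has_cdf_copula_measure[OF C])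
  interpret prob_space M
    by (rule has_cdfD(1)[OF M])
  define B where "B z = {v \<in> unit_cube d. \<forall>i<d. v i \<le> z i}" for z :: "nat \<Rightarrow> real"
  define S where "S i = {v \<in> unit_cube d. v i \<le> x i} - {v \<in> unit_cube d. v i \<le> y i}" for i
  have [measurable]: "B z \<in> sets M" for z
    unfolding B_def has_cdfD(2)[OF M] by (rule sets_lower_box)
  have coord: "{v \<in> unit_cube d. v i \<le> u} \<in> sets M" if "i < d" for i u
    using that sets_cube_coord_le has_cdfD(2)[OF M] by simp
  then have S_sets: "S i \<in> sets M" if "i < d" for i
    unfolding S_def using that by auto
  have S_le: "prob (S i) \<le> \<bar>x i - y i\<bar>" if i: "i < d" for i
  proof (cases "y i \<le> x i")
    case True
    have "prob (S i) = prob {v \<in> unit_cube d. v i \<le> x i} - prob {v \<in> unit_cube d. v i \<le> y i}"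
      unfolding S_def using coord[OF i] True by (intro finite_measure_Diff) auto
    then show ?thesis
      using copula_marginal[OF C i] unit_cubeD[OF x i] unit_cubeD[OF y i] unfolding M_def by simp
  next
    case False
    then have "S i = {}"
      by (auto simp: S_def)
    then show ?thesis
      by simp
  qed
  have "C x = prob (B x)" "C y = prob (B y)"
    unfolding B_def using has_cdfD(4)[OF M] x y by auto
  moreover have "prob (B x) \<le> prob (B y \<union> (\<Union>i<d. S i))"
  proof (rule finite_measure_mono)
    show "B x \<subseteq> B y \<union> (\<Union>i<d. S i)"
      unfolding B_def S_def by blast
  qed (use S_sets in auto)
  moreover have "\<dots> \<le> prob (B y) + prob (\<Union>i<d. S i)"
    using S_sets by (intro measure_Un_le) auto
  moreover have "prob (\<Union>i<d. S i) \<le> (\<Sum>i<d. prob (S i))"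
    using S_sets by (intro measure_UNION_le) auto
  moreover have "\<dots> \<le> (\<Sum>i<d. \<bar>x i - y i\<bar>)"
    using S_le by (intro sum_mono) auto
  ultimately show ?thesis
    by linarith
qed

lemma copula_lipschitz:
  assumes "copula d C" "x \<in> unit_cube d" "y \<in> unit_cube d"
  shows "\<bar>C x - C y\<bar> \<le> (\<Sum>i<d. \<bar>x i - y i\<bar>)"
  using copula_increment[OF assms] copula_increment[OF assms(1,3,2)] by (simp add: abs_minus_commute)

section \<open>Archimedean copulas evaluated along their generators\<close>

lemma archimedean_at_generator:
  assumes g: "generator \<psi>"
    and C: "\<And>x. x \<in> unit_cube d \<Longrightarrow> C x = gen_ext \<psi> (\<Sum>i<d. pseudo_inverse \<psi> (x i))"
    and z: "\<And>i. i < d \<Longrightarrow> 0 \<le> z i"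
  shows "C (\<lambda>i\<in>{..<d}. \<psi> (z i)) = \<psi> (\<Sum>i<d. z i)"
proof -
  have "(\<lambda>i\<in>{..<d}. \<psi> (z i)) \<in> unit_cube d"
    using generatorD(4,5)[OF g z] by (intro coord_restrict_mem_cube)
  then have "C (\<lambda>i\<in>{..<d}. \<psi> (z i)) = gen_ext \<psi> (\<Sum>i<d. pseudo_inverse \<psi> (\<psi> (z i)))"
    by (simp add: C)
  also have "\<dots> = \<psi> (\<Sum>i<d. z i)"
    using z by (intro gen_ext_pseudo_inverse_sum[OF g]) auto
  finally show ?thesis .
qed

text \<open>
  The \<open>d\<close>-th difference of the generator along a lattice is the probability of a box. The
  intermediate differences are the probabilities of boxes of which only the first \<open>k\<close> sides are
  bounded away from \<open>0\<close>.
\<close>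

lemma archimedean_bdiff_nonneg:
  assumes cop: "copula d C" and g: "generator \<psi>"
    and C: "\<And>x. x \<in> unit_cube d \<Longrightarrow> C x = gen_ext \<psi> (\<Sum>i<d. pseudo_inverse \<psi> (x i))"
    and d: "1 \<le> d" and h: "0 < h"
  shows "0 \<le> (bdiff ^^ d) (\<lambda>i. \<psi> (real i * h)) j"
proof -
  define p where "p = (\<lambda>i. \<psi> (real i * h))"
  define M where "M = copula_measure d C"
  have M: "has_cdf d M C"
    unfolding M_def by (rule has_cdf_copula_measure[OF cop])
  interpret prob_space M
    by (rule has_cdfD(1)[OF M])
  define S where "S k w = {y \<in> unit_cube d. (\<forall>i<k. p (Suc (w i)) < y i) \<and> (\<forall>i<d. y i \<le> p (w i))}"
    for k w
  have p_anti: "p b \<le> p a" if "a \<le> b" for a b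
    unfolding p_def using that h by (intro generatorD(6)[OF g]) auto
  have S: "k \<le> d \<Longrightarrow> S k w \<in> sets M \<and> prob (S k w) = (bdiff ^^ k) p (\<Sum>i<d. w i)" for k w
  proof (induction k arbitrary: w)
    case 0
    define x where "x = (\<lambda>i\<in>{..<d}. p (w i))"
    have x: "x \<in> unit_cube d"
      unfolding x_def p_def using h by (intro coord_restrict_mem_cube generatorD(4,5)[OF g]) auto
    have S: "S 0 w = {y \<in> unit_cube d. \<forall>i<d. y i \<le> x i}"
      by (auto simp: S_def x_def)
    have "C x = \<psi> (\<Sum>i<d. real (w i) * h)"
      unfolding x_def p_def using h by (intro archimedean_at_generator[OF g C]) auto
    then have "prob (S 0 w) = p (\<Sum>i<d. w i)"
      unfolding S has_cdfD(4)[OF M x] by (simp add: p_def sum_distrib_right)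
    moreover have "S 0 w \<in> sets M"
      unfolding S has_cdfD(2)[OF M] by (rule sets_lower_box)
    ultimately show ?case
      by simp
  next
    case (Suc k)
    \<comment> \<open>Raising \<open>w k\<close> by one lowers the upper side \<open>k\<close> from
      \<open>p (w k)\<close> to \<open>p (Suc (w k))\<close>. Removing that smaller box is exactly
      the new lower bound on \<open>y k\<close>.\<close>
    define w' where "w' = w(k := Suc (w k))"
    have IH: "S k v \<in> sets M" "prob (S k v) = (bdiff ^^ k) p (\<Sum>i<d. v i)" for v
      using Suc by auto
    have "S (Suc k) w = S k w - S k w'"
    proof (intro equalityI subsetI)
      fix y assume "y \<in> S k w - S k w'"
      then have y: "y \<in> S k w" "y \<notin> S k w'"
        by auto
      then obtain i where "i < d" "\<not> y i \<le> p (w' i)"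
        by (auto simp: S_def w'_def)
      then have "p (Suc (w k)) < y k"
        using y(1) by (cases "i = k") (auto simp: S_def w'_def)
      then show "y \<in> S (Suc k) w"
        using y(1) by (auto simp: S_def less_Suc_eq)
    next
      fix y assume y: "y \<in> S (Suc k) w"
      then have "\<not> y k \<le> p (w' k)"
        by (simp add: S_def w'_def not_le)
      then have "y \<notin> S k w'"
        using Suc.prems unfolding S_def by (metis (mono_tags, lifting) Suc_le_eq mem_Collect_eq)
      then show "y \<in> S k w - S k w'"
        using y by (simp add: S_def)
    qed
    moreover have "S k w' \<subseteq> S k w"
    proof
      fix y assume y: "y \<in> S k w'"
      have "y i \<le> p (w i)" if "i < d" for i
      proof -
        have "w i \<le> w' i"
          by (simp add: w'_def)
        then show ?thesis
          using y that p_anti[of "w i" "w' i"] by (auto simp: S_def intro: order_trans)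
      qed
      then show "y \<in> S k w"
        using y by (auto simp: S_def w'_def)
    qed
    moreover have "(\<Sum>i<d. w' i) = Suc (\<Sum>i<d. w i)"
    proof -
      have "sum w' ({..<d} - {k}) = sum w ({..<d} - {k})"
        by (intro sum.cong) (auto simp: w'_def)
      then show ?thesis
        using Suc.prems sum.remove[of "{..<d}" k w] sum.remove[of "{..<d}" k w'] by (simp add: w'_def)
    qed
    ultimately show ?case
      using IH by (simp add: finite_measure_Diff bdiff_pow_Suc del: funpow.simps)
  qed
  \<comment> \<open>Only the sum of the lattice indices enters, so all of \<open>j\<close> is put on
    coordinate 0, which exists because \<open>1 \<le> d\<close>.\<close>
  define v where "v = (\<lambda>i::nat. if i = 0 then j else 0)"
  have "(\<Sum>i<d. v i) = j"
    using d by (simp add: v_def sum.delta)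
  then have "(bdiff ^^ d) p j = prob (S d v)"
    using S[of d v] by (simp only: order_refl)
  then show ?thesis
    unfolding p_def[symmetric] by (simp only: measure_nonneg)
qed

text \<open>At equal arguments \<open>z\<close> the copulas take values at most
  \<open>\<epsilon>\<close> apart, but at different points; moving \<open>C'\<close> from one point
  to the other costs \<open>\<epsilon>\<close> per coordinate by the Lipschitz bound.\<close>

lemma archimedean_copulas_close:
  assumes C: "generator \<psi>" "\<And>x. x \<in> unit_cube d \<Longrightarrow> C x = gen_ext \<psi> (\<Sum>i<d. pseudo_inverse \<psi> (x i))"
    and C': "copula d C'" "generator \<psi>'"
      "\<And>x. x \<in> unit_cube d \<Longrightarrow> C' x = gen_ext \<psi>' (\<Sum>i<d. pseudo_inverse \<psi>' (x i))"
    and close: "\<And>z. 0 \<le> z \<Longrightarrow> \<bar>\<psi> z - \<psi>' z\<bar> \<le> \<epsilon>"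
    and x: "x \<in> unit_cube d"
  shows "\<bar>C x - C' x\<bar> \<le> (real d + 1) * \<epsilon>"
proof (cases "\<exists>k<d. x k = 0")
  case True
  then have "C x = 0" "C' x = 0"
    using archimedean_zero[OF C(1), of "{..<d}" _ x] archimedean_zero[OF C'(2), of "{..<d}" _ x]
    by (auto simp: C(2)[OF x] C'(3)[OF x])
  then show ?thesis
    using close[of 0] generatorD(2)[OF C(1)] generatorD(2)[OF C'(2)] by simp
next
  case False
  have "\<exists>z\<ge>0. \<psi> z = x i" if i: "i < d" for i
    using generator_attains[OF C(1), of "x i"] unit_cubeD[OF x i] False i
    by (metis order_le_less)
  then obtain z where z: "\<And>i. i < d \<Longrightarrow> 0 \<le> z i" "\<And>i. i < d \<Longrightarrow> \<psi> (z i) = x i"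
    by metis
  have x_eq: "x = (\<lambda>i\<in>{..<d}. \<psi> (z i))"
    using z(2) x by (auto simp: unit_cube_def PiE_iff extensional_def restrict_def)
  define x' where "x' = (\<lambda>i\<in>{..<d}. \<psi>' (z i))"
  have x': "x' \<in> unit_cube d"
    unfolding x'_def using generatorD(4,5)[OF C'(2) z(1)] by (intro coord_restrict_mem_cube)
  have "C x = \<psi> (\<Sum>i<d. z i)" "C' x' = \<psi>' (\<Sum>i<d. z i)"
    unfolding x_eq x'_def using z(1)
    by (intro archimedean_at_generator[OF C] archimedean_at_generator[OF C'(2,3)]; simp)+
  then have "\<bar>C x - C' x'\<bar> \<le> \<epsilon>"
    using close[of "\<Sum>i<d. z i"] sum_nonneg[of "{..<d}" z] z(1) by simp
  moreover have "\<bar>C' x - C' x'\<bar> \<le> (\<Sum>i<d. \<bar>x i - x' i\<bar>)"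
    by (rule copula_lipschitz[OF C'(1) x x'])
  moreover have "(\<Sum>i<d. \<bar>x i - x' i\<bar>) \<le> (\<Sum>i<d. \<epsilon>)"
    using close[OF z(1)] by (intro sum_mono) (simp add: x_eq x'_def)
  ultimately show ?thesis
    by (simp add: algebra_simps)
qed

section \<open>The uniform distribution on the standard simplex\<close>

text \<open>Probability that a uniform point of the standard simplex with \<open>e + 1\<close>
  coordinates exceeds thresholds of sum \<open>s\<close>. The case split replaces the power of
  \<open>max 0 (1 - s)\<close>, which would be 1 beyond \<open>s = 1\<close> for
  \<open>e = 0\<close>, where the induction on the dimension starts.\<close>

definition simplex_tail :: "nat \<Rightarrow> real \<Rightarrow> real" where
  "simplex_tail e s = (if s \<le> 1 then (1 - s) ^ e else 0)"

text \<open>The survival function and the carrying simplex are all that the computation of copulas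
  uses; this spares a surface measure on a hyperplane.\<close>

definition simplex_measure :: "nat \<Rightarrow> (nat \<Rightarrow> real) measure \<Rightarrow> bool" where
  "simplex_measure n M \<longleftrightarrow> prob_space M \<and> sets M = sets (PiM {..<n} (\<lambda>_. borel)) \<and>
     (AE y in M. (\<forall>i<n. 0 \<le> y i) \<and> (\<Sum>i<n. y i) = 1) \<and>
     (\<forall>z. (\<forall>i<n. 0 \<le> z i) \<longrightarrow>
       emeasure M {y \<in> space M. \<forall>i<n. z i \<le> y i} = ennreal (simplex_tail (n - 1) (\<Sum>i<n. z i)))"

lemma simplex_measure_1: "simplex_measure 1 (return (PiM {..<1} (\<lambda>_. borel)) (\<lambda>i\<in>{..<1}. 1))"
proof -
  let ?N = "PiM {..<1::nat} (\<lambda>_. borel :: real measure)"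
  let ?x = "\<lambda>i\<in>{..<1::nat}. 1::real"
  have x: "?x \<in> space ?N"
    by (auto simp: space_PiM)
  have [measurable]: "(\<lambda>y. y 0) \<in> borel_measurable ?N"
    by (rule measurable_component_singleton) simp
  have m: "{y \<in> space ?N. z \<le> y 0} \<in> sets ?N" for z
    by measurable
  have "AE y in return ?N ?x. 0 \<le> y 0 \<and> y 0 = 1"
    by (subst AE_return[OF x]) auto
  then show ?thesis
    unfolding simplex_measure_def using x m
    by (auto simp: prob_space_return simplex_tail_def indicator_def)
qed

text \<open>The recursion from \<open>n\<close> to \<open>n + 1\<close> coordinates: the power of
  \<open>v\<close> cancels the denominators and leaves \<open>n * (v - s) ^ (n - 1)\<close> on
  \<open>{s..1 - t}\<close>, with antiderivative \<open>(v - s) ^ n\<close>.\<close>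

lemma nn_integral_simplex_tail:
  assumes "1 \<le> n" "0 \<le> s" "0 \<le> t"
  shows "(\<integral>\<^sup>+v. ennreal (real n * v ^ (n - 1)) * indicator {0..1} v *
      (ennreal (simplex_tail (n - 1) (s / v)) * indicator {..1 - t} v) \<partial>lborel) =
    ennreal (simplex_tail n (s + t))"
proof -
  have "(\<integral>\<^sup>+v. ennreal (real n * v ^ (n - 1)) * indicator {0..1} v *
      (ennreal (simplex_tail (n - 1) (s / v)) * indicator {..1 - t} v) \<partial>lborel) =
    (\<integral>\<^sup>+v. ennreal (real n * (v - s) ^ (n - 1)) * indicator {s..1 - t} v \<partial>lborel)"
  proof (rule nn_integral_cong_AE)
    \<comment> \<open>For \<open>n = 1\<close> and \<open>s > 0\<close> the integrands can disagree
      at \<open>v = 0\<close>, where \<open>s / 0 = 0\<close>.\<close>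
    have "AE v in lborel. v \<noteq> (0::real)"
      by (rule AE_lborel_singleton)
    then show "AE v in lborel. ennreal (real n * v ^ (n - 1)) * indicator {0..1} v *
        (ennreal (simplex_tail (n - 1) (s / v)) * indicator {..1 - t} v) =
      ennreal (real n * (v - s) ^ (n - 1)) * indicator {s..1 - t} v"
    proof eventually_elim
      fix v :: real assume "v \<noteq> 0"
      show "ennreal (real n * v ^ (n - 1)) * indicator {0..1} v *
          (ennreal (simplex_tail (n - 1) (s / v)) * indicator {..1 - t} v) =
        ennreal (real n * (v - s) ^ (n - 1)) * indicator {s..1 - t} v"
      proof (cases "0 < v \<and> v \<le> 1 - t \<and> s \<le> v")
        case True
        have "v * (1 - s / v) = v - s"
          using True by (simp add: field_simps)
        then have "v ^ (n - 1) * (1 - s / v) ^ (n - 1) = (v - s) ^ (n - 1)"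
          by (simp only: power_mult_distrib[symmetric])
        then show ?thesis
          using True assms by (simp add: simplex_tail_def ennreal_mult[symmetric] mult.assoc)
      next
        case False
        then have "\<not> (0 < v \<and> v \<le> 1 - t) \<or> v < s"
          by auto
        then show ?thesis
          using assms \<open>v \<noteq> 0\<close> by (auto simp: simplex_tail_def indicator_def divide_le_eq)
      qed
    qed
  qed
  also have "\<dots> = ennreal (simplex_tail n (s + t))"
  proof (cases "s \<le> 1 - t")
    case True
    have "(\<integral>\<^sup>+v. ennreal (real n * (v - s) ^ (n - 1)) * indicator {s..1 - t} v \<partial>lborel) =
        ennreal ((1 - t - s) ^ n - (s - s) ^ n)"
      using True by (intro nn_integral_FTC_Icc) (auto intro!: derivative_eq_intros)
    then show ?thesis
      using True assms by (simp add: simplex_tail_def algebra_simps)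
  next
    case False
    then have "{s..1 - t} = {}"
      by auto
    then show ?thesis
      using False by (simp add: simplex_tail_def)
  qed
  finally show ?thesis .
qed

text \<open>
  If \<open>S\<close> is uniform on the simplex of \<open>n\<close> coordinates and \<open>V\<close> is independent of \<open>S\<close> with density
  \<open>n * v ^ (n - 1)\<close>, then \<open>(V * S, 1 - V)\<close> is uniform on the simplex of \<open>n + 1\<close> coordinates.
\<close>

lemma simplex_measure_Suc:
  assumes n: "1 \<le> n" and M: "simplex_measure n M"
  shows "\<exists>N. simplex_measure (Suc n) N"
proof -
  interpret M: prob_space M
    using M by (simp add: simplex_measure_def)
  have M_sets [measurable_cong]: "sets M = sets (PiM {..<n} (\<lambda>_. borel))"
    using M by (simp add: simplex_measure_def)
  have M_AE: "AE y in M. (\<forall>i<n. 0 \<le> y i) \<and> (\<Sum>i<n. y i) = 1"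
    using M by (simp add: simplex_measure_def)
  have M_tail: "emeasure M {y \<in> space M. \<forall>i<n. z i \<le> y i} = ennreal (simplex_tail (n - 1) (\<Sum>i<n. z i))"
    if "\<And>i. i < n \<Longrightarrow> 0 \<le> z i" for z
    using M that by (simp add: simplex_measure_def)
  define f where "f v = ennreal (real n * v ^ (n - 1)) * indicator {0..1} v" for v :: real
  have [measurable]: "f \<in> borel_measurable lborel"
    unfolding f_def by measurable
  define V where "V = density lborel f"
  have [measurable_cong]: "sets V = sets borel"
    by (simp add: V_def)
  have "emeasure V (space V) = (\<integral>\<^sup>+v. f v \<partial>lborel)"
    unfolding V_def by (simp add: emeasure_density)
  \<comment> \<open>The total mass is the integral of the recursion with all thresholds 0.\<close>
  also have "\<dots> = (\<integral>\<^sup>+v. f v * (ennreal (simplex_tail (n - 1) (0 / v)) * indicator {..1 - 0} v) \<partial>lborel)"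
    by (intro nn_integral_cong) (auto simp: f_def simplex_tail_def indicator_def)
  also have "\<dots> = ennreal (simplex_tail n (0 + 0))"
    unfolding f_def by (rule nn_integral_simplex_tail[OF n]) auto
  finally interpret V: prob_space V
    by (intro prob_spaceI) (simp add: simplex_tail_def)
  interpret MV: pair_prob_space M V ..
  define T where "T = (\<lambda>(s, v). \<lambda>i\<in>{..<Suc n}. if i < n then v * s i else 1 - v :: real)"
  let ?P = "PiM {..<Suc n} (\<lambda>_. borel :: real measure)"
  have coord [measurable]: "(\<lambda>x. fst x i) \<in> borel_measurable (M \<Otimes>\<^sub>M V)" if "i < n" for i
  proof -
    have "(\<lambda>y. y i) \<in> borel_measurable (PiM {..<n} (\<lambda>_. borel))"
      using that by (intro measurable_component_singleton) auto
    then have "(\<lambda>y. y i) \<in> borel_measurable M"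
      using M_sets measurable_cong_sets by blast
    from measurable_compose[OF measurable_fst this] show ?thesis .
  qed
  have T [measurable]: "T \<in> M \<Otimes>\<^sub>M V \<rightarrow>\<^sub>M ?P"
    unfolding T_def split_beta'
  proof (rule measurable_restrict)
    fix i assume "i \<in> {..<Suc n}"
    show "(\<lambda>x. if i < n then snd x * fst x i else 1 - snd x) \<in> borel_measurable (M \<Otimes>\<^sub>M V)"
      using coord[of i] by (cases "i < n") simp_all
  qed
  define N where "N = distr (M \<Otimes>\<^sub>M V) ?P T"
  have sp: "space N = space ?P"
    by (simp add: N_def)
  have coord': "(\<lambda>y. y i) \<in> borel_measurable ?P" if "i < Suc n" for i
    using that by (intro measurable_component_singleton) auto
  have meas: "{y \<in> space ?P. (\<forall>i<Suc n. 0 \<le> y i) \<and> (\<Sum>i<Suc n. y i) = 1} \<in> sets ?P"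
  proof -
    have "{y \<in> space ?P. (\<forall>i\<in>{..<Suc n}. 0 \<le> y i) \<and> (\<Sum>i\<in>{..<Suc n}. y i) = 1} \<in> sets ?P"
      using coord' by (intro sets.sets_Collect borel_measurable_eq borel_measurable_le
          borel_measurable_sum sets.sets_Collect_finite_All) auto
    then show ?thesis
      by (simp only: Ball_def lessThan_iff)
  qed
  have "AE x in M \<Otimes>\<^sub>M V. (\<forall>i<Suc n. 0 \<le> T x i) \<and> (\<Sum>i<Suc n. T x i) = 1"
  proof (rule MV.AE_pair_measure)
    show "{x \<in> space (M \<Otimes>\<^sub>M V). (\<forall>i<Suc n. 0 \<le> T x i) \<and> (\<Sum>i<Suc n. T x i) = 1} \<in> sets (M \<Otimes>\<^sub>M V)"
      using measurable_sets[OF T meas] measurable_space[OF T]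
      by (simp add: vimage_def Int_def conj_commute cong: conj_cong)
    have "AE v in V. 0 \<le> v \<and> v \<le> 1"
      unfolding V_def by (subst AE_density) (auto simp: f_def indicator_def)
    show "AE s in M. AE v in V. (\<forall>i<Suc n. 0 \<le> T (s, v) i) \<and> (\<Sum>i<Suc n. T (s, v) i) = 1"
      using M_AE
    proof eventually_elim
      fix s assume s: "(\<forall>i<n. 0 \<le> s i) \<and> (\<Sum>i<n. s i) = (1::real)"
      show "AE v in V. (\<forall>i<Suc n. 0 \<le> T (s, v) i) \<and> (\<Sum>i<Suc n. T (s, v) i) = 1"
        using \<open>AE v in V. 0 \<le> v \<and> v \<le> 1\<close>
      proof eventually_elim
        fix v :: real assume v: "0 \<le> v \<and> v \<le> 1"
        have "(\<Sum>i<n. T (s, v) i) = v * (\<Sum>i<n. s i)"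
          by (simp add: T_def sum_distrib_left)
        then show "(\<forall>i<Suc n. 0 \<le> T (s, v) i) \<and> (\<Sum>i<Suc n. T (s, v) i) = 1"
          using s v by (simp add: T_def)
      qed
    qed
  qed
  then have AE: "AE y in N. (\<forall>i<Suc n. 0 \<le> y i) \<and> (\<Sum>i<Suc n. y i) = 1"
    unfolding N_def using meas by (subst AE_distr_iff) auto
  have tail: "emeasure N {y \<in> space N. \<forall>i<Suc n. z i \<le> y i} = ennreal (simplex_tail n (\<Sum>i<Suc n. z i))"
    if z: "\<And>i. i < Suc n \<Longrightarrow> 0 \<le> z i" for z
  proof -
    let ?A = "{y \<in> space ?P. \<forall>i<Suc n. z i \<le> y i}"
    have A: "?A \<in> sets ?P"
    proof -
      have "{y \<in> space ?P. \<forall>i\<in>{..<Suc n}. z i \<le> y i} \<in> sets ?P"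
        using coord' by (intro borel_measurable_le sets.sets_Collect_finite_All) auto
      then show ?thesis
        by (simp only: Ball_def lessThan_iff)
    qed
    have "emeasure N ?A = emeasure (M \<Otimes>\<^sub>M V) (T -` ?A \<inter> space (M \<Otimes>\<^sub>M V))"
      unfolding N_def by (rule emeasure_distr[OF T A])
    \<comment> \<open>Given the value \<open>v\<close>, the event becomes
      \<open>z i / v \<le> s i\<close> for \<open>i < n\<close> together with
      \<open>v \<le> 1 - z n\<close>, whose probability is known from the smaller simplex.\<close>
    also have "\<dots> = (\<integral>\<^sup>+v. emeasure M ((\<lambda>s. (s, v)) -` (T -` ?A \<inter> space (M \<Otimes>\<^sub>M V))) \<partial>V)"
      by (rule MV.emeasure_pair_measure_alt2[OF measurable_sets[OF T A]])
    also have "\<dots> = (\<integral>\<^sup>+v. f v * emeasure M ((\<lambda>s. (s, v)) -` (T -` ?A \<inter> space (M \<Otimes>\<^sub>M V))) \<partial>lborel)"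
      unfolding V_def
    proof (rule nn_integral_density)
      show "(\<lambda>v. emeasure M ((\<lambda>s. (s, v)) -` (T -` ?A \<inter> space (M \<Otimes>\<^sub>M density lborel f)))) \<in> borel_measurable lborel"
        using MV.measurable_emeasure_Pair2[OF measurable_sets[OF T A]] by (simp add: V_def)
    qed simp
    also have "\<dots> = (\<integral>\<^sup>+v. f v * (ennreal (simplex_tail (n - 1) ((\<Sum>i<n. z i) / v)) * indicator {..1 - z n} v) \<partial>lborel)"
    proof (rule nn_integral_cong_AE)
      have "AE v in lborel. v \<noteq> (0::real)"
        by (rule AE_lborel_singleton)
      then show "AE v in lborel. f v * emeasure M ((\<lambda>s. (s, v)) -` (T -` ?A \<inter> space (M \<Otimes>\<^sub>M V))) =
          f v * (ennreal (simplex_tail (n - 1) ((\<Sum>i<n. z i) / v)) * indicator {..1 - z n} v)"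
      proof eventually_elim
        fix v :: real assume v0: "v \<noteq> 0"
        show "f v * emeasure M ((\<lambda>s. (s, v)) -` (T -` ?A \<inter> space (M \<Otimes>\<^sub>M V))) =
          f v * (ennreal (simplex_tail (n - 1) ((\<Sum>i<n. z i) / v)) * indicator {..1 - z n} v)"
        proof (cases "0 < v \<and> v \<le> 1")
          case False
          then have "f v = 0"
            using v0 by (auto simp: f_def indicator_def)
          then show ?thesis
            by simp
        next
          case True
          have "(\<lambda>s. (s, v)) -` (T -` ?A \<inter> space (M \<Otimes>\<^sub>M V)) =
              (if v \<le> 1 - z n then {s \<in> space M. \<forall>i<n. z i / v \<le> s i} else {})"
          proof -
            have iff: "(\<forall>i<Suc n. z i \<le> T (s, v) i) \<longleftrightarrow> (\<forall>i<n. z i / v \<le> s i) \<and> v \<le> 1 - z n" for s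
              using True by (auto simp: T_def less_Suc_eq pos_divide_le_eq mult.commute[of v])
            have "(s, v) \<in> T -` ?A \<inter> space (M \<Otimes>\<^sub>M V) \<longleftrightarrow>
                s \<in> space M \<and> (\<forall>i<n. z i / v \<le> s i) \<and> v \<le> 1 - z n" for s
              using measurable_space[OF T, of "(s, v)"] iff[of s] by (auto simp: space_pair_measure V_def)
            then show ?thesis
              by auto
          qed
          moreover have "emeasure M {s \<in> space M. \<forall>i<n. z i / v \<le> s i} =
              ennreal (simplex_tail (n - 1) ((\<Sum>i<n. z i) / v))"
            using True z M_tail[of "\<lambda>i. z i / v"] by (simp add: sum_divide_distrib)
          ultimately show ?thesis
            by simp
        qed
      qed
    qed
    also have "\<dots> = ennreal (simplex_tail n ((\<Sum>i<n. z i) + z n))"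
      unfolding f_def using z by (intro nn_integral_simplex_tail[OF n]) (auto intro: sum_nonneg)
    finally show ?thesis
      by (simp add: sp)
  qed
  have "prob_space N"
    unfolding N_def by (rule MV.prob_space_distr[OF T])
  then have "simplex_measure (Suc n) N"
    unfolding simplex_measure_def using AE tail by (simp add: N_def)
  then show ?thesis ..
qed

lemma simplex_measure_exists: "1 \<le> n \<Longrightarrow> \<exists>M. simplex_measure n M"
proof (induction n rule: dec_induct)
  case base
  then show ?case
    using simplex_measure_1 by blast
next
  case (step n)
  then show ?case
    using simplex_measure_Suc by blast
qed

section \<open>Copulas carried by finitely many hypersurfaces\<close>

context finite_mixture
begin

definition C :: "(nat \<Rightarrow> real) \<Rightarrow> real" where
  "C = (\<lambda>x\<in>unit_cube (Suc e). gen_ext G (\<Sum>i<Suc e. pseudo_inverse G (x i)))"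

text \<open>Agrees with \<open>pseudo_inverse G\<close> on \<open>{0..1}\<close>, with
  \<open>G_inv 0 = R\<close>, but is real-valued, so that the hypersurfaces are level sets of an
  ordinary sum.\<close>

definition G_inv :: "real \<Rightarrow> real" where
  "G_inv = the_inv_into {0..R} G"

definition support :: "(nat \<Rightarrow> real) set" where
  "support = {y \<in> unit_cube (Suc e). \<exists>m\<in>I. (\<Sum>i<Suc e. G_inv (y i)) = r m}"

lemma G_inv_G: "0 \<le> z \<Longrightarrow> z \<le> R \<Longrightarrow> G_inv (G z) = z"
  unfolding G_inv_def using the_inv_into_f_f[OF G_inj, of z] by simp

lemma G_le_iff: "0 \<le> a \<Longrightarrow> a \<le> R \<Longrightarrow> 0 \<le> b \<Longrightarrow> b \<le> R \<Longrightarrow> G a \<le> G b \<longleftrightarrow> b \<le> a"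
  using G_antimono[of b a] G_strict[of a b] by (meson linorder_not_le order_less_le_trans)

lemma G_inv_antimono:
  assumes "0 \<le> x" "x \<le> y" "y \<le> 1"
  shows "G_inv y \<le> G_inv x"
proof -
  obtain a where a: "0 \<le> a" "a \<le> R" "G a = x"
    using G_attains[of x] assms by auto
  obtain b where b: "0 \<le> b" "b \<le> R" "G b = y"
    using G_attains[of y] assms by auto
  show ?thesis
    using assms(2) a b G_inv_G G_le_iff by auto
qed

lemma G_inv_inj: "inj_on G_inv {0..1}"
proof (rule inj_onI)
  fix x y assume "x \<in> {0..1}" "y \<in> {0..1}" and eq: "G_inv x = G_inv y"
  then obtain a b where "0 \<le> a" "a \<le> R" "G a = x" "0 \<le> b" "b \<le> R" "G b = y"
    using G_attains[of x] G_attains[of y] by (metis atLeastAtMost_iff)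
  then show "x = y"
    using eq G_inv_G by metis
qed

lemma measurable_G_inv: "G_inv \<in> borel_measurable unit_borel"
proof -
  \<comment> \<open>Monotone functions are Borel; the sign makes the function
    non-decreasing.\<close>
  have "(\<lambda>x. - G_inv x) \<in> borel_measurable unit_borel"
    unfolding unit_borel_def using G_inv_antimono
    by (intro borel_measurable_mono_on_fnc) (auto simp: mono_on_def)
  then have "(\<lambda>x. - (- G_inv x)) \<in> borel_measurable unit_borel"
    by (rule borel_measurable_uminus)
  then show ?thesis
    by simp
qed

lemma measurable_G: "G \<in> borel_measurable borel"
  unfolding simplex_gen_def[abs_def] by measurable

lemma support_sets: "support \<in> sets (cube_borel (Suc e))"
proof -
  have *: "(\<lambda>y. G_inv (y i)) \<in> borel_measurable (cube_borel (Suc e))" if "i < Suc e" for i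
    using measurable_compose[OF measurable_cube_coord(2)[OF that] measurable_G_inv] .
  have "(\<lambda>y. \<Sum>i<Suc e. G_inv (y i)) \<in> borel_measurable (cube_borel (Suc e))"
    using * by (intro borel_measurable_sum) auto
  then have "{y \<in> space (cube_borel (Suc e)). \<exists>m\<in>I. (\<Sum>i<Suc e. G_inv (y i)) = r m} \<in> sets (cube_borel (Suc e))"
    by (intro sets.sets_Collect_finite_Ex borel_measurable_eq fin) auto
  then show ?thesis
    by (simp only: support_def space_cube_borel)
qed

text \<open>
  A random point of the standard simplex is multiplied by the random radius \<open>r m\<close>, where \<open>m\<close> has
  weight \<open>w m\<close>, and \<open>G\<close> is applied to all coordinates.
\<close>

lemma copula_C_aux:
  obtains M where "has_cdf (Suc e) M C" "measure M support = 1"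
proof -
  obtain S where S: "simplex_measure (Suc e) S"
    using simplex_measure_exists[of "Suc e"] by auto
  interpret S: prob_space S
    using S by (simp add: simplex_measure_def)
  have S_sets: "sets S = sets (PiM {..<Suc e} (\<lambda>_. borel))"
    using S by (simp add: simplex_measure_def)
  have S_AE: "AE y in S. (\<forall>i<Suc e. 0 \<le> y i) \<and> (\<Sum>i<Suc e. y i) = 1"
    using S by (simp add: simplex_measure_def)
  have S_tail: "emeasure S {y \<in> space S. \<forall>i<Suc e. z i \<le> y i} = ennreal (simplex_tail e (\<Sum>i<Suc e. z i))"
    if "\<And>i. i < Suc e \<Longrightarrow> 0 \<le> z i" for z
    using S that by (simp add: simplex_measure_def)
  \<comment> \<open>For \<open>m \<in> I\<close> the maximum acts only on the null set of points
    with a negative coordinate; it keeps \<open>T m\<close> inside the cube everywhere.\<close>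
  define T where "T m = (\<lambda>y. \<lambda>i\<in>{..<Suc e}. G (max 0 (r m * y i)))" for m
  have T: "T m \<in> S \<rightarrow>\<^sub>M cube_borel (Suc e)" for m
    unfolding T_def cube_borel_def
  proof (rule measurable_restrict)
    fix i assume "i \<in> {..<Suc e}"
    then have "(\<lambda>y. y i) \<in> borel_measurable (PiM {..<Suc e} (\<lambda>_. borel))"
      by (intro measurable_component_singleton) auto
    then have "(\<lambda>y. y i) \<in> borel_measurable S"
      using S_sets measurable_cong_sets by blast
    then have "(\<lambda>y. max 0 (r m * y i)) \<in> borel_measurable S"
      by (intro borel_measurable_max borel_measurable_times) auto
    then have "(\<lambda>y. G (max 0 (r m * y i))) \<in> borel_measurable S"
      by (rule measurable_compose[OF _ measurable_G])
    moreover have "0 \<le> G x" "0 \<le> x \<Longrightarrow> G x \<le> 1" for x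
      using G_nonneg G_antimono[of 0 x] G_0 by auto
    ultimately show "(\<lambda>y. G (max 0 (r m * y i))) \<in> S \<rightarrow>\<^sub>M unit_borel"
      unfolding unit_borel_def by (intro measurable_restrict_space2) auto
  qed
  define D where "D m = distr S (cube_borel (Suc e)) (T m)" for m
  define W where "W = point_measure I w"
  define M where "M = W \<bind> D"
  have W_space: "space W = I" "sets W = Pow I"
    by (simp_all add: W_def space_point_measure sets_point_measure)
  have W_int: "(\<integral>\<^sup>+m. f m \<partial>W) = (\<Sum>m\<in>I. ennreal (w m) * f m)" for f
    unfolding W_def by (rule nn_integral_point_measure_finite[OF fin])
  have "emeasure W (space W) = (\<integral>\<^sup>+m. 1 \<partial>W)"
    by simp
  also have "\<dots> = ennreal (\<Sum>m\<in>I. w m)"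
    unfolding W_int using w_pos by (simp add: sum_ennreal less_imp_le)
  finally interpret W: prob_space W
    by (intro prob_spaceI) (simp add: w_sum)
  have D_prob: "prob_space (D m)" for m
    unfolding D_def by (rule S.prob_space_distr[OF T])
  have D_meas: "D \<in> W \<rightarrow>\<^sub>M prob_algebra (cube_borel (Suc e))"
    unfolding measurable_def using D_prob W_space by (auto simp: space_prob_algebra D_def)
  have M_sets: "sets M = sets (cube_borel (Suc e))"
    unfolding M_def using D_meas nonempty W_space
    by (intro sets_bind) (auto simp: D_def)
  have M_space: "space M = unit_cube (Suc e)"
    using sets_eq_imp_space_eq[OF M_sets] by simp
  interpret M: prob_space M
    unfolding M_def by (rule W.prob_space_bind[OF _ measurable_prob_algebraD[OF D_meas]]) (use D_prob in simp)
  have M_emeasure: "emeasure M X = (\<Sum>m\<in>I. ennreal (w m) * emeasure S {y \<in> space S. T m y \<in> X})"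
    if X: "X \<in> sets (cube_borel (Suc e))" for X
  proof -
    have "emeasure M X = (\<integral>\<^sup>+m. emeasure (D m) X \<partial>W)"
      unfolding M_def using nonempty W_space X
      by (intro emeasure_bind[OF _ measurable_prob_algebraD[OF D_meas]]) auto
    also have "\<dots> = (\<Sum>m\<in>I. ennreal (w m) * emeasure (D m) X)"
      by (rule W_int)
    finally show ?thesis
      using X by (simp add: D_def emeasure_distr[OF T] vimage_def Int_def conj_commute)
  qed
  have sets_T: "{y \<in> space S. T m y \<in> X} \<in> sets S" if "X \<in> sets (cube_borel (Suc e))" for m X
    using measurable_sets[OF T that, of m] by (simp add: vimage_def Int_def conj_commute)
  have S_range: "0 \<le> r m * y i \<and> r m * y i \<le> R"
    if m: "m \<in> I" and y: "(\<forall>i<Suc e. 0 \<le> y i) \<and> (\<Sum>i<Suc e. y i) = 1" and i: "i < Suc e" for m y i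
  proof -
    have "y i \<le> 1"
      using y i member_le_sum[of i "{..<Suc e}" y] by simp
    then have "r m * y i \<le> r m"
      using r_pos[OF m] by (simp add: mult_left_le)
    then have "r m * y i \<le> R"
      using r_le_R[OF m] by linarith
    moreover have "0 \<le> r m * y i"
      using r_pos[OF m] y i by simp
    ultimately show ?thesis
      by blast
  qed
  have C_eq: "C x = gen_ext G (\<Sum>i<Suc e. pseudo_inverse G (x i))" if "x \<in> unit_cube (Suc e)" for x
    using that by (simp add: C_def)
  have cdf: "measure M {y \<in> unit_cube (Suc e). \<forall>i<Suc e. y i \<le> x i} = C x" if x: "x \<in> unit_cube (Suc e)" for x
  proof -
    have "\<exists>z. 0 \<le> z \<and> z \<le> R \<and> G z = x i" if "i < Suc e" for i
      using G_attains[OF unit_cubeD[OF x that]] by blast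
    then obtain z where z: "\<And>i. i < Suc e \<Longrightarrow> 0 \<le> z i" "\<And>i. i < Suc e \<Longrightarrow> z i \<le> R"
      "\<And>i. i < Suc e \<Longrightarrow> G (z i) = x i"
      by metis
    have x_eq: "x = (\<lambda>i\<in>{..<Suc e}. G (z i))"
      using z(3) x by (auto simp: unit_cube_def PiE_iff extensional_def restrict_def)
    define A where "A = {y \<in> unit_cube (Suc e). \<forall>i<Suc e. y i \<le> x i}"
    have A: "A \<in> sets (cube_borel (Suc e))"
      unfolding A_def by (rule sets_lower_box)
    \<comment> \<open>With the radius fixed, the decreasing \<open>G\<close> turns the lower box
      into the orthant \<open>z i / r m \<le> y i\<close>, for which the simplex law is
      known.\<close>
    have part: "emeasure S {y \<in> space S. T m y \<in> A} = ennreal ((max 0 (1 - (\<Sum>i<Suc e. z i) / r m)) ^ e)"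
      if m: "m \<in> I" for m
    proof -
      have meas: "{y \<in> space S. \<forall>i<Suc e. z i / r m \<le> y i} \<in> sets S"
      proof -
        have "{y \<in> space (PiM {..<Suc e} (\<lambda>_. borel :: real measure)). \<forall>i\<in>{..<Suc e}. z i / r m \<le> y i}
            \<in> sets (PiM {..<Suc e} (\<lambda>_. borel))"
          by (intro borel_measurable_le sets.sets_Collect_finite_All measurable_component_singleton) auto
        then show ?thesis
          using S_sets sets_eq_imp_space_eq[OF S_sets] by (simp only: Ball_def lessThan_iff)
      qed
      have "emeasure S {y \<in> space S. T m y \<in> A} = emeasure S {y \<in> space S. \<forall>i<Suc e. z i / r m \<le> y i}"
      proof (rule emeasure_eq_AE[OF _ sets_T[OF A] meas])
        show "AE y in S. (y \<in> {y \<in> space S. T m y \<in> A}) = (y \<in> {y \<in> space S. \<forall>i<Suc e. z i / r m \<le> y i})"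
          using S_AE AE_space
        proof eventually_elim
          fix y assume y: "(\<forall>i<Suc e. 0 \<le> y i) \<and> (\<Sum>i<Suc e. y i) = 1" and sp: "y \<in> space S"
          have "T m y i \<le> x i \<longleftrightarrow> z i / r m \<le> y i" if i: "i < Suc e" for i
          proof -
            note rng = S_range[OF m y i]
            have "T m y i \<le> x i \<longleftrightarrow> G (r m * y i) \<le> G (z i)"
              using rng i z(3)[OF i] by (simp add: T_def max_absorb2)
            also have "\<dots> \<longleftrightarrow> z i \<le> r m * y i"
              using rng z(1,2)[OF i] by (intro G_le_iff) auto
            finally show ?thesis
              using r_pos[OF m] by (simp add: divide_le_eq mult.commute)
          qed
          moreover have "T m y \<in> unit_cube (Suc e)"
            using measurable_space[OF T sp] by simp
          ultimately show "(y \<in> {y \<in> space S. T m y \<in> A}) = (y \<in> {y \<in> space S. \<forall>i<Suc e. z i / r m \<le> y i})"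
            using sp by (simp add: A_def)
        qed
      qed
      also have "\<dots> = ennreal (simplex_tail e (\<Sum>i<Suc e. z i / r m))"
        using z(1) r_pos[OF m] by (intro S_tail) (auto simp: less_imp_le)
      also have "(\<Sum>i<Suc e. z i / r m) = (\<Sum>i<Suc e. z i) / r m"
        by (rule sum_divide_distrib[symmetric])
      \<comment> \<open>Since \<open>1 \<le> e\<close>, the case split in
        \<open>simplex_tail\<close> agrees with the truncated power.\<close>
      also have "simplex_tail e ((\<Sum>i<Suc e. z i) / r m) = (max 0 (1 - (\<Sum>i<Suc e. z i) / r m)) ^ e"
        using e_pos by (auto simp: simplex_tail_def zero_power max_def)
      finally show ?thesis .
    qed
    have "emeasure M A = (\<Sum>m\<in>I. ennreal (w m) * ennreal ((max 0 (1 - (\<Sum>i<Suc e. z i) / r m)) ^ e))"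
      unfolding M_emeasure[OF A] using part by (intro sum.cong) auto
    also have "\<dots> = ennreal (G (\<Sum>i<Suc e. z i))"
      unfolding simplex_gen_def using w_pos
      by (subst sum_ennreal[symmetric]) (auto simp: ennreal_mult less_imp_le intro!: sum.cong)
    finally have "measure M A = G (\<Sum>i<Suc e. z i)"
      using G_nonneg by (simp add: measure_def)
    also have "\<dots> = C x"
      unfolding x_eq using z(1) by (intro archimedean_at_generator[OF generator_G C_eq, symmetric])
    finally show ?thesis
      unfolding A_def .
  qed
  \<comment> \<open>\<open>G_inv\<close> undoes \<open>G\<close> on \<open>{0..R}\<close>, so
    applying it to the coordinates of \<open>T m y\<close> yields the sum \<open>r m\<close> times
    1.\<close>
  have "emeasure M support = (\<Sum>m\<in>I. ennreal (w m) * 1)"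
    unfolding M_emeasure[OF support_sets]
  proof (intro sum.cong arg_cong2[where f = times] refl)
    fix m assume m: "m \<in> I"
    show "emeasure S {y \<in> space S. T m y \<in> support} = 1"
    proof (subst S.emeasure_eq_1_AE[OF sets_T[OF support_sets]])
      show "AE y in S. y \<in> {y \<in> space S. T m y \<in> support}"
        using S_AE AE_space
      proof eventually_elim
        fix y assume y: "(\<forall>i<Suc e. 0 \<le> y i) \<and> (\<Sum>i<Suc e. y i) = 1" and sp: "y \<in> space S"
        have "(\<Sum>i<Suc e. G_inv (T m y i)) = (\<Sum>i<Suc e. r m * y i)"
        proof (rule sum.cong)
          fix i assume "i \<in> {..<Suc e}"
          then have i: "i < Suc e"
            by simp
          show "G_inv (T m y i) = r m * y i"
            using S_range[OF m y i] i by (simp add: T_def max_absorb2 G_inv_G)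
        qed simp
        also have "\<dots> = r m"
          unfolding sum_distrib_left[symmetric] using y by simp
        finally show "y \<in> {y \<in> space S. T m y \<in> support}"
          using measurable_space[OF T sp, of m] sp m by (auto simp: support_def)
      qed
    qed simp
  qed
  also have "\<dots> = ennreal (\<Sum>m\<in>I. w m)"
    using w_pos by (simp add: sum_ennreal less_imp_le)
  finally have "measure M support = 1"
    by (simp add: measure_def w_sum)
  moreover have "has_cdf (Suc e) M C"
    unfolding has_cdf_def using M.prob_space_axioms M_sets cdf by blast
  ultimately show ?thesis
    using that by blast
qed

lemma C_eq: "x \<in> unit_cube (Suc e) \<Longrightarrow> C x = gen_ext G (\<Sum>i<Suc e. pseudo_inverse G (x i))"
  by (simp add: C_def)

lemma copula_C: "copula (Suc e) C"
proof -
  obtain M where M: "has_cdf (Suc e) M C"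
    by (rule copula_C_aux)
  have "distr M borel (\<lambda>x. x i) = uniform_measure lborel {0..1}" if i: "i < Suc e" for i
  proof (rule has_cdf_uniform_marginal[OF M i])
    fix u :: real assume u: "0 \<le> u" "u \<le> 1"
    obtain z where z: "0 \<le> z" "z \<le> R" "G z = u"
      by (rule G_attains[OF u])
    have "(\<lambda>j\<in>{..<Suc e}. if j = i then u else 1) = (\<lambda>j\<in>{..<Suc e}. G (if j = i then z else 0))"
      using z(3) G_0 by auto
    moreover have "C (\<lambda>j\<in>{..<Suc e}. G (if j = i then z else 0)) = G (\<Sum>j<Suc e. if j = i then z else 0)"
      using z(1) by (intro archimedean_at_generator[OF generator_G C_eq]) auto
    ultimately have "C (\<lambda>j\<in>{..<Suc e}. if j = i then u else 1) = G (\<Sum>j<Suc e. if j = i then z else 0)"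
      by (simp only:)
    also have "(\<Sum>j<Suc e. if j = i then z else 0) = z"
      using i by (subst sum.delta) auto
    finally show "C (\<lambda>j\<in>{..<Suc e}. if j = i then u else 1) = u"
      using z(3) by (simp only:)
  qed
  then show ?thesis
    unfolding copula_def using M by (auto simp: C_def)
qed

lemma archimedean_C: "C \<in> archimedean_copulas (Suc e)"
  unfolding archimedean_copulas_def using copula_C generator_G C_eq by blast

lemma measure_support: "measure (copula_measure (Suc e) C) support = 1"
proof -
  obtain M where M: "has_cdf (Suc e) M C" "measure M support = 1"
    by (rule copula_C_aux)
  then show ?thesis
    using has_cdf_unique[OF has_cdf_copula_measure[OF copula_C] M(1)] by simp
qed

text \<open>Once the first \<open>e\<close> coordinates and \<open>m\<close> are fixed, the equation
  of the hypersurface determines \<open>G_inv\<close> of the last coordinate, and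
  \<open>G_inv\<close> is injective.\<close>

lemma support_slice: "finite {t \<in> {0..1}. x(e := t) \<in> support}"
proof -
  define s where "s = (\<Sum>i<e. G_inv (x i))"
  have "{t \<in> {0..1}. x(e := t) \<in> support} \<subseteq> G_inv -` ((\<lambda>m. r m - s) ` I) \<inter> {0..1}"
  proof
    fix t assume t: "t \<in> {t \<in> {0..1}. x(e := t) \<in> support}"
    then obtain m where m: "m \<in> I" "(\<Sum>i<Suc e. G_inv ((x(e := t)) i)) = r m"
      by (auto simp: support_def)
    have "(\<Sum>i<e. G_inv ((x(e := t)) i)) = s"
      unfolding s_def by (intro sum.cong) auto
    then have "G_inv t = r m - s"
      using m(2) by simp
    then show "t \<in> G_inv -` ((\<lambda>m. r m - s) ` I) \<inter> {0..1}"
      using m(1) t by auto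
  qed
  then show ?thesis
    using finite_vimage_IntI[OF finite_imageI[OF fin] G_inv_inj] by (rule finite_subset)
qed

end

lemma archimedean_dense_mixture:
  assumes C: "C0 \<in> archimedean_copulas (Suc e)" and e: "1 \<le> e" and eps: "0 < \<epsilon>"
  obtains I w r where "finite_mixture e I w r" "uniform_dist (Suc e) C0 (finite_mixture.C e I w r) \<le> \<epsilon>"
proof -
  obtain \<psi> where \<psi>: "copula (Suc e) C0" "generator \<psi>"
    "\<And>x. x \<in> unit_cube (Suc e) \<Longrightarrow> C0 x = gen_ext \<psi> (\<Sum>i<Suc e. pseudo_inverse \<psi> (x i))"
    using C by (auto simp: archimedean_copulas_def)
  \<comment> \<open>The passage from generators to copulas loses the factor
    \<open>real (Suc e) + 1\<close>.\<close>
  define \<epsilon>' where "\<epsilon>' = \<epsilon> / (real (Suc e) + 1)"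
  have eps': "0 < \<epsilon>'"
    unfolding \<epsilon>'_def using eps by (intro divide_pos_pos) auto
  have "0 \<le> (bdiff ^^ Suc e) (\<lambda>i. \<psi> (real i * h)) j" if "0 < h" for h j
    by (rule archimedean_bdiff_nonneg[OF \<psi> _ that]) simp_all
  from generator_approximation[OF \<psi>(2) e eps' this]
  obtain I w r where G: "finite_mixture e I w r"
    "\<And>x. 0 \<le> x \<Longrightarrow> \<bar>\<psi> x - simplex_gen e I w r x\<bar> \<le> \<epsilon>'"
    by blast
  interpret finite_mixture e I w r
    by (rule G(1))
  have le: "\<bar>C0 x - C x\<bar> \<le> \<epsilon>" if "x \<in> unit_cube (Suc e)" for x
  proof -
    have "\<bar>C0 x - C x\<bar> \<le> (real (Suc e) + 1) * \<epsilon>'"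
      by (rule archimedean_copulas_close[OF \<psi>(2,3) copula_C generator_G C_eq G(2) that])
    also have "\<dots> = \<epsilon>"
      by (simp add: \<epsilon>'_def del: of_nat_Suc)
    finally show ?thesis .
  qed
  have "unit_cube (Suc e) \<noteq> {}"
    by (auto simp: unit_cube_def PiE_eq_empty_iff)
  then have "uniform_dist (Suc e) C0 C \<le> \<epsilon>"
    unfolding uniform_dist_eq[OF \<psi>(1) copula_C] using le by (intro cSUP_least) auto
  then show ?thesis
    using that G(1) by blast
qed

section \<open>Lebesgue decomposition and absolute continuity\<close>

text \<open>The property that \<open>ac_part\<close> selects by \<open>THE\<close>, named so that
  existence and uniqueness can be proved separately.\<close>

definition is_ac_part :: "'a measure \<Rightarrow> 'a measure \<Rightarrow> 'a measure \<Rightarrow> bool" where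
  "is_ac_part L N A \<longleftrightarrow> sets A = sets L \<and> absolutely_continuous L A \<and>
     (\<exists>S. sets S = sets L \<and> mutually_singular L S \<and>
       (\<forall>B\<in>sets L. emeasure N B = emeasure A B + emeasure S B))"

text \<open>Off a null set carrying the singular part, \<open>N\<close> and \<open>A\<close> agree,
  and \<open>A\<close> ignores null sets. Allowing any larger null set \<open>Z'\<close> lets two
  decompositions be compared off a common one.\<close>

lemma is_ac_part_outside:
  assumes A: "is_ac_part L N A"
  obtains Z where "Z \<in> null_sets L"
    "\<And>B Z'. B \<in> sets L \<Longrightarrow> Z' \<in> null_sets L \<Longrightarrow> Z \<subseteq> Z' \<Longrightarrow> emeasure A B = emeasure N (B - Z')"
proof -
  obtain S Z where S: "sets A = sets L" "absolutely_continuous L A" "sets S = sets L"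
    "Z \<in> sets L" "emeasure L Z = 0" "emeasure S (space L - Z) = 0"
    "\<And>B. B \<in> sets L \<Longrightarrow> emeasure N B = emeasure A B + emeasure S B"
    using A unfolding is_ac_part_def mutually_singular_def by blast
  show ?thesis
  proof (rule that)
    show "Z \<in> null_sets L"
      using S by (simp add: null_sets_def)
    fix B Z' assume B: "B \<in> sets L" and Z': "Z' \<in> null_sets L" "Z \<subseteq> Z'"
    have "B - Z' \<subseteq> space L - Z"
      using Z'(2) sets.sets_into_space[OF B] by blast
    then have "emeasure S (B - Z') = 0"
      using emeasure_mono[of "B - Z'" "space L - Z" S] S by auto
    then have "emeasure N (B - Z') = emeasure A (B - Z')"
      using S(7)[of "B - Z'"] B Z' by auto
    also have "\<dots> = emeasure A B"
    proof (rule emeasure_Diff_null_set)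
      show "Z' \<in> null_sets A"
        using S(2) Z' by (auto simp: absolutely_continuous_def)
    qed (use B S in simp)
    finally show "emeasure A B = emeasure N (B - Z')"
      by simp
  qed
qed

lemma is_ac_part_unique:
  assumes A: "is_ac_part L N A" and A': "is_ac_part L N A'"
  shows "A = A'"
proof (rule measure_eqI)
  show "sets A = sets A'"
    using A A' by (simp add: is_ac_part_def)
  obtain Z where Z: "Z \<in> null_sets L"
    "\<And>B Z'. B \<in> sets L \<Longrightarrow> Z' \<in> null_sets L \<Longrightarrow> Z \<subseteq> Z' \<Longrightarrow> emeasure A B = emeasure N (B - Z')"
    using A by (rule is_ac_part_outside) blast
  obtain Y where Y: "Y \<in> null_sets L"
    "\<And>B Z'. B \<in> sets L \<Longrightarrow> Z' \<in> null_sets L \<Longrightarrow> Y \<subseteq> Z' \<Longrightarrow> emeasure A' B = emeasure N (B - Z')"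
    using A' by (rule is_ac_part_outside) blast
  fix B assume "B \<in> sets A"
  then have "B \<in> sets L"
    using A by (simp add: is_ac_part_def)
  moreover have "Z \<union> Y \<in> null_sets L"
    using Z(1) Y(1) by (rule null_sets.Un)
  ultimately show "emeasure A B = emeasure A' B"
    using Z(2)[of B "Z \<union> Y"] Y(2)[of B "Z \<union> Y"] by simp
qed

text \<open>The singular part is carried by an \<open>L\<close>-null set of largest measure.\<close>

lemma is_ac_part_exists:
  assumes "finite_measure N" and NL: "sets N = sets L"
  shows "\<exists>A. is_ac_part L N A"
proof -
  interpret finite_measure N by fact
  define s where "s = (SUP Z\<in>null_sets L. measure N Z)"
  have bdd: "bdd_above (measure N ` null_sets L)"
    using bounded_measure by (intro bdd_aboveI[of _ "measure N (space N)"]) auto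
  have le_s: "measure N Z \<le> s" if "Z \<in> null_sets L" for Z
    unfolding s_def using that bdd by (rule cSUP_upper)
  \<comment> \<open>Null sets are closed under countable unions, so a union of near-maximisers
    attains the supremum.\<close>
  have "\<exists>Z\<in>null_sets L. s - 1 / real (Suc n) < measure N Z" for n
  proof -
    have "s - 1 / real (Suc n) < s"
      by simp
    then show ?thesis
      unfolding s_def using bdd by (subst (asm) less_cSUP_iff) auto
  qed
  then obtain Y where Y: "\<And>n. Y n \<in> null_sets L" "\<And>n. s - 1 / real (Suc n) < measure N (Y n)"
    by metis
  define Z where "Z = (\<Union>n. Y n)"
  have Z: "Z \<in> null_sets L"
    unfolding Z_def using Y(1) by auto
  have ZN: "Z \<in> sets N"
    using Z NL by auto
  have "s \<le> measure N Z"
  proof (rule LIMSEQ_le_const2)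
    show "(\<lambda>n. s - 1 / real (Suc n)) \<longlonglongrightarrow> s"
      using tendsto_diff[OF tendsto_const LIMSEQ_inverse_real_of_nat, of s] by (simp add: inverse_eq_divide)
    have "measure N (Y n) \<le> measure N Z" for n
      using ZN by (intro finite_measure_mono) (auto simp: Z_def)
    then have "s - 1 / real (Suc n) \<le> measure N Z" for n
      using Y(2)[of n] by (meson less_imp_le order_trans)
    then show "\<exists>M. \<forall>n\<ge>M. s - 1 / real (Suc n) \<le> measure N Z"
      by blast
  qed
  then have Z_max: "measure N Z = s"
    using le_s[OF Z] by simp
  define A where "A = density N (indicator (space N - Z))"
  define S where "S = density N (indicator Z)"
  have A_eq: "emeasure A B = emeasure N (B - Z)" if "B \<in> sets N" for B
  proof -
    have "emeasure A B = (\<integral>\<^sup>+x. indicator (space N - Z) x * indicator B x \<partial>N)"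
      unfolding A_def using that ZN by (intro emeasure_density) auto
    also have "\<dots> = (\<integral>\<^sup>+x. indicator (B - Z) x \<partial>N)"
      using sets.sets_into_space[OF that] by (intro nn_integral_cong) (auto simp: indicator_def)
    finally show ?thesis
      using that ZN by simp
  qed
  have S_eq: "emeasure S B = emeasure N (B \<inter> Z)" if "B \<in> sets N" for B
  proof -
    have "emeasure S B = (\<integral>\<^sup>+x. indicator Z x * indicator B x \<partial>N)"
      unfolding S_def using that ZN by (intro emeasure_density) auto
    also have "\<dots> = (\<integral>\<^sup>+x. indicator (B \<inter> Z) x \<partial>N)"
      by (intro nn_integral_cong) (auto simp: indicator_def)
    finally show ?thesis
      using that ZN by simp
  qed
  have "is_ac_part L N A"
    unfolding is_ac_part_def
  proof (intro conjI exI[of _ S] ballI)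
    show "sets A = sets L" "sets S = sets L"
      using NL by (simp_all add: A_def S_def)
    show "absolutely_continuous L A"
      unfolding absolutely_continuous_def
    proof
      fix B assume B: "B \<in> null_sets L"
      then have BN: "B \<in> sets N"
        using NL by auto
      \<comment> \<open>A null set with mass outside \<open>Z\<close> would make
        \<open>Z \<union> B\<close> a null set of measure above \<open>s\<close>.\<close>
      have "measure N Z + measure N (B - Z) = measure N (Z \<union> B)"
        using finite_measure_Union[of Z "B - Z"] BN ZN by auto
      then have "measure N (B - Z) \<le> 0"
        using le_s[OF null_sets.Un[OF Z B]] Z_max by linarith
      then have "measure N (B - Z) = 0"
        using measure_nonneg[of N "B - Z"] by linarith
      then have "emeasure A B = 0"
        unfolding A_eq[OF BN] by (simp add: emeasure_eq_measure)
      then show "B \<in> null_sets A"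
        using BN by (auto simp: null_sets_def A_def)
    qed
    show "mutually_singular L S"
      unfolding mutually_singular_def
    proof (intro bexI conjI)
      show "Z \<in> sets L" "emeasure L Z = 0"
        using Z by auto
      have "(space L - Z) \<inter> Z = {}"
        by auto
      moreover have "space L - Z \<in> sets N"
        using Z NL by auto
      ultimately show "emeasure S (space L - Z) = 0"
        by (simp add: S_eq)
    qed
    fix B assume "B \<in> sets L"
    then have B: "B \<in> sets N"
      using NL by simp
    show "emeasure N B = emeasure A B + emeasure S B"
      unfolding A_eq[OF B] S_eq[OF B] using B ZN by (subst plus_emeasure) (auto intro!: arg_cong[of _ _ "emeasure N"])
  qed
  then show ?thesis ..
qed

lemma is_ac_part_ac_part:
  assumes "finite_measure N" "sets N = sets L"
  shows "is_ac_part L N (ac_part L N)"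
proof -
  obtain A where A: "is_ac_part L N A"
    using is_ac_part_exists[OF assms] by blast
  have "ac_part L N = (THE A. is_ac_part L N A)"
    by (simp add: ac_part_def is_ac_part_def)
  then show ?thesis
    using theI[of "is_ac_part L N", OF A] is_ac_part_unique[OF _ A] by simp
qed

lemma ac_part_le:
  assumes "finite_measure N" "sets N = sets L" "B \<in> sets L"
  shows "emeasure (ac_part L N) B \<le> emeasure N B"
proof -
  obtain S where "\<And>B. B \<in> sets L \<Longrightarrow> emeasure N B = emeasure (ac_part L N) B + emeasure S B"
    using is_ac_part_ac_part[OF assms(1,2)] unfolding is_ac_part_def by blast
  then show ?thesis
    using assms(3) by simp
qed

lemma ac_part_full:
  assumes N: "finite_measure N" "sets N = sets L"
    and full: "emeasure (ac_part L N) (space L) = emeasure N (space L)"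
  shows "absolutely_continuous L N"
proof -
  interpret finite_measure N by fact
  obtain S where S: "sets (ac_part L N) = sets L" "absolutely_continuous L (ac_part L N)" "sets S = sets L"
    "\<And>B. B \<in> sets L \<Longrightarrow> emeasure N B = emeasure (ac_part L N) B + emeasure S B"
    using is_ac_part_ac_part[OF N] unfolding is_ac_part_def by blast
  have "emeasure N (space L) + 0 = emeasure N (space L) + emeasure S (space L)"
    using S(4)[of "space L"] full by simp
  then have "emeasure S (space L) = 0"
    by (simp add: ennreal_add_left_cancel)
  then have S0: "emeasure S B = 0" if "B \<in> sets L" for B
    using emeasure_mono[of B "space L" S] S(3) sets.sets_into_space[OF that] by simp
  show ?thesis
    unfolding absolutely_continuous_def
  proof
    fix B assume B: "B \<in> null_sets L"
    then have "emeasure (ac_part L N) B = 0"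
      using S(2) unfolding absolutely_continuous_def by blast
    then show "B \<in> null_sets N"
      using B S(4)[of B] S0[of B] N(2) by (auto simp: null_sets_def)
  qed
qed

text \<open>Meant for the mass of \<open>ac_part\<close> of a kernel, whose measurability is not at
  hand. The integral is a supremum over simple functions below \<open>f\<close>, so some measurable
  minorant \<open>g\<close> has the same integral, and then \<open>1 - g\<close> integrates to
  0.\<close>

lemma (in prob_space) AE_eq_1_of_nn_integral:
  assumes le: "\<And>x. x \<in> space M \<Longrightarrow> f x \<le> 1" and int: "(\<integral>\<^sup>+x. f x \<partial>M) = 1"
  shows "AE x in M. f x = 1"
proof -
  obtain g where g: "g \<in> borel_measurable M" "\<And>x. g x \<le> f x" "(\<integral>\<^sup>+x. g x \<partial>M) = 1"
  proof -
    have "\<exists>g. g \<in> borel_measurable M \<and> (\<forall>x. g x \<le> f x) \<and> ennreal (1 - 1 / real (Suc n)) \<le> (\<integral>\<^sup>+x. g x \<partial>M)" for n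
    proof -
      have "ennreal (1 - 1 / real (Suc n)) < ennreal 1"
        by (intro ennreal_lessI) auto
      then have "ennreal (1 - 1 / real (Suc n)) < (\<integral>\<^sup>+x. f x \<partial>M)"
        using int by simp
      then obtain g where "simple_function M g" "g \<le> f" "ennreal (1 - 1 / real (Suc n)) < integral\<^sup>S M g"
        unfolding nn_integral_def by (auto simp: less_SUP_iff)
      then show ?thesis
        by (intro exI[of _ g]) (auto simp: nn_integral_eq_simple_integral le_fun_def borel_measurable_simple_function)
    qed
    then obtain h where h: "\<And>n. h n \<in> borel_measurable M" "\<And>n x. h n x \<le> f x"
      "\<And>n. ennreal (1 - 1 / real (Suc n)) \<le> (\<integral>\<^sup>+x. h n x \<partial>M)"
      by metis
    show ?thesis
    proof (rule that)
      show meas: "(\<lambda>x. SUP n. h n x) \<in> borel_measurable M"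
        using h(1) by (intro borel_measurable_SUP) auto
      show le_f: "(SUP n. h n x) \<le> f x" for x
        using h(2) by (intro SUP_least)
      have "(\<integral>\<^sup>+x. (SUP n. h n x) \<partial>M) \<le> 1"
        using nn_integral_mono[of M "\<lambda>x. SUP n. h n x" f] le_f int by simp
      moreover have "1 \<le> (\<integral>\<^sup>+x. (SUP n. h n x) \<partial>M)"
      proof (rule LIMSEQ_le_const2)
        have "(\<lambda>n. ennreal (1 - 1 / real (Suc n))) \<longlonglongrightarrow> ennreal (1 - 0)"
          using LIMSEQ_inverse_real_of_nat by (intro tendsto_intros) (simp add: inverse_eq_divide)
        then show "(\<lambda>n. ennreal (1 - 1 / real (Suc n))) \<longlonglongrightarrow> 1"
          by simp
        have "ennreal (1 - 1 / real (Suc n)) \<le> (\<integral>\<^sup>+x. (SUP n. h n x) \<partial>M)" for n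
        proof -
          have "ennreal (1 - 1 / real (Suc n)) \<le> (\<integral>\<^sup>+x. h n x \<partial>M)"
            by (rule h(3))
          also have "\<dots> \<le> (\<integral>\<^sup>+x. (SUP n. h n x) \<partial>M)"
            by (intro nn_integral_mono SUP_upper) simp
          finally show ?thesis .
        qed
        then show "\<exists>N. \<forall>n\<ge>N. ennreal (1 - 1 / real (Suc n)) \<le> (\<integral>\<^sup>+x. (SUP n. h n x) \<partial>M)"
          by blast
      qed
      ultimately show "(\<integral>\<^sup>+x. (SUP n. h n x) \<partial>M) = 1"
        by (rule antisym)
    qed
  qed
  have g1: "g x \<le> 1" if "x \<in> space M" for x
    using g(2)[of x] le[OF that] by (rule order_trans)
  have "(\<integral>\<^sup>+x. 1 - g x \<partial>M) = (\<integral>\<^sup>+x. 1 \<partial>M) - (\<integral>\<^sup>+x. g x \<partial>M)"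
    using g g1 by (intro nn_integral_diff) auto
  then have "(\<integral>\<^sup>+x. 1 - g x \<partial>M) = 0"
    using g(3) by (simp add: emeasure_space_1)
  then have "AE x in M. 1 - g x = 0"
    using g(1) by (subst (asm) nn_integral_0_iff_AE) auto
  then show ?thesis
    using AE_space
  proof eventually_elim
    fix x assume x: "1 - g x = 0" "x \<in> space M"
    have "1 \<le> g x"
      using x(1) by (simp add: diff_eq_0_iff_ennreal)
    then show "f x = 1"
      using g(2)[of x] le[OF x(2)] by (auto intro: antisym order_trans)
  qed
qed

section \<open>Absolute continuity and approximation from a generating algebra\<close>

lemma absolutely_continuous_eps_delta:
  assumes "finite_measure M" "finite_measure N" and MN: "sets M = sets N"
    and ac: "absolutely_continuous N M" and \<epsilon>: "0 < \<epsilon>"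
  shows "\<exists>n::nat. \<forall>X\<in>sets N. measure N X < 1 / real (Suc n) \<longrightarrow> measure M X \<le> \<epsilon>"
proof (rule ccontr)
  interpret M: finite_measure M by fact
  interpret N: finite_measure N by fact
  assume "\<not> ?thesis"
  then have *: "\<exists>X\<in>sets N. measure N X < 1 / real (Suc n) \<and> \<epsilon> < measure M X" for n
    by (meson not_le)
  \<comment> \<open>Geometric bounds make the measures summable: by Borel-Cantelli the limsup of the
    counterexamples is \<open>N\<close>-null, while its \<open>M\<close>-measure stays at least
    \<open>\<epsilon>\<close>.\<close>
  have "\<exists>X\<in>sets N. measure N X < (1 / 2) ^ n \<and> \<epsilon> < measure M X" for n
  proof -
    have "1 / real (Suc (2 ^ n)) \<le> 1 / 2 ^ n"
      by (intro frac_le) auto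
    also have "\<dots> = (1 / 2) ^ n"
      by (simp add: power_one_over)
    finally have "1 / real (Suc (2 ^ n)) \<le> (1 / 2) ^ n" .
    then show ?thesis
      using *[of "2 ^ n"] by (meson less_le_trans)
  qed
  then obtain X where X: "\<And>n. X n \<in> sets N" "\<And>n. measure N (X n) < (1 / 2) ^ n" "\<And>n. \<epsilon> < measure M (X n)"
    by metis
  have "summable (\<lambda>n. measure N (X n))"
  proof (rule summable_comparison_test)
    show "summable (\<lambda>n. (1 / 2 :: real) ^ n)"
      by (rule summable_geometric) simp
    show "\<exists>N0. \<forall>n\<ge>N0. norm (measure N (X n)) \<le> (1 / 2) ^ n"
      using X(2) by (auto intro!: less_imp_le)
  qed
  then have "limsup X \<in> null_sets N"
    using X(1) by (intro borel_cantelli_limsup1) (auto simp: N.emeasure_eq_measure)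
  then have "measure M (limsup X) = 0"
    using ac by (auto simp: absolutely_continuous_def null_sets_def measure_def)
  moreover have "\<epsilon> \<le> measure M (limsup X)"
  proof (rule LIMSEQ_le_const)
    define F where "F n = (\<Union>m\<in>{n..}. X m)" for n
    have F: "F n \<in> sets M" for n
      unfolding F_def MN using X(1) by auto
    have "limsup X = (\<Inter>n. F n)"
      by (simp add: limsup_INF_SUP F_def)
    moreover have "decseq F"
      unfolding F_def by (intro antimonoI UN_mono) auto
    ultimately show "(\<lambda>n. measure M (F n)) \<longlonglongrightarrow> measure M (limsup X)"
      using F M.finite_Lim_measure_decseq[of F] by auto
    have "\<epsilon> \<le> measure M (F n)" for n
      using X(3)[of n] M.finite_measure_mono[OF _ F, of "X n" n] by (force simp: F_def)
    then show "\<exists>N. \<forall>n\<ge>N. \<epsilon> \<le> measure M (F n)"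
      by blast
  qed
  ultimately show False
    using \<epsilon> by linarith
qed

text \<open>One \<open>V\<close> has to serve both measures, so the induction over the generated
  sigma-algebra carries both estimates together.\<close>

lemma measure_algebra_approximation:
  assumes "algebra \<Omega> \<A>" and M: "finite_measure M" "sets M = sigma_sets \<Omega> \<A>"
    and N: "finite_measure N" "sets N = sigma_sets \<Omega> \<A>"
    and A: "A \<in> sigma_sets \<Omega> \<A>" and \<epsilon>: "0 < \<epsilon>"
  shows "\<exists>V\<in>\<A>. measure M ((A - V) \<union> (V - A)) < \<epsilon> \<and> measure N ((A - V) \<union> (V - A)) < \<epsilon>"
  using A \<epsilon>
proof (induction arbitrary: \<epsilon> rule: sigma_sets.induct)
  interpret algebra \<Omega> \<A> by fact
  interpret M: finite_measure M by fact
  interpret N: finite_measure N by fact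
  {
    case (Basic a)
    then show ?case
      by (intro bexI[of _ a]) auto
  next
    case Empty
    then show ?case
      by (intro bexI[of _ "{}"]) auto
  next
    case (Compl a)
    then obtain V where V: "V \<in> \<A>" "measure M ((a - V) \<union> (V - a)) < \<epsilon>" "measure N ((a - V) \<union> (V - a)) < \<epsilon>"
      by blast
    have "a \<subseteq> \<Omega>" "V \<subseteq> \<Omega>"
      using sigma_sets_into_sp[OF space_closed Compl.hyps] V(1) space_closed by auto
    then have "(\<Omega> - a - (\<Omega> - V)) \<union> (\<Omega> - V - (\<Omega> - a)) = (a - V) \<union> (V - a)"
      by auto
    then show ?case
      using V by (intro bexI[of _ "\<Omega> - V"]) auto
  next
    case (Union a)
    have a_sets: "a i \<in> sets M" "a i \<in> sets N" for i
      using Union.hyps M N by auto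
    have V_sets: "V \<in> sets M" "V \<in> sets N" if "V \<in> \<A>" for V
      using that M N by auto
    define U where "U n = (\<Union>i<n. a i)" for n
    have lim: "(\<lambda>n. measure K (U n)) \<longlonglongrightarrow> measure K (\<Union>i. a i)"
      if "finite_measure K" "\<And>i. a i \<in> sets K" for K
    proof -
      have "(\<Union>n. U n) = (\<Union>i. a i)"
        unfolding U_def by blast
      moreover have "(\<lambda>n. measure K (U n)) \<longlonglongrightarrow> measure K (\<Union>n. U n)"
      proof (rule finite_measure.finite_Lim_measure_incseq)
        show "incseq U"
          unfolding U_def by (intro monoI UN_mono) auto
      qed (use that in \<open>auto simp: U_def\<close>)
      ultimately show ?thesis
        by simp
    qed
    have ev: "eventually (\<lambda>n. measure K (\<Union>i. a i) - \<epsilon> / 2 < measure K (U n)) sequentially"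
      if "finite_measure K" "\<And>i. a i \<in> sets K" for K
      using lim[OF that] Union.prems by (intro order_tendstoD) auto
    obtain n where n: "measure M (\<Union>i. a i) - \<epsilon> / 2 < measure M (U n)"
      "measure N (\<Union>i. a i) - \<epsilon> / 2 < measure N (U n)"
      using eventually_happens[OF eventually_conj[OF ev[OF M(1) a_sets(1)] ev[OF N(1) a_sets(2)]]] by auto
    \<comment> \<open>Half of \<open>\<epsilon>\<close> covers the tail of the union, the other half
      is shared by the \<open>n\<close> approximations; \<open>Suc n\<close> avoids division by
      zero.\<close>
    define \<eta> where "\<eta> = \<epsilon> / (2 * real (Suc n))"
    have \<eta>: "0 < \<eta>"
      unfolding \<eta>_def using Union.prems by (intro divide_pos_pos) auto
    have "\<exists>V\<in>\<A>. measure M ((a i - V) \<union> (V - a i)) < \<eta> \<and> measure N ((a i - V) \<union> (V - a i)) < \<eta>" for i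
      using Union.IH[OF \<eta>] .
    then obtain V where V: "\<And>i. V i \<in> \<A>"
      "\<And>i. measure M ((a i - V i) \<union> (V i - a i)) < \<eta>" "\<And>i. measure N ((a i - V i) \<union> (V i - a i)) < \<eta>"
      by metis
    define W where "W = (\<Union>i<n. V i)"
    have W: "W \<in> \<A>"
      unfolding W_def using V(1) by (intro finite_UN) auto
    have bound: "measure K (((\<Union>i. a i) - W) \<union> (W - (\<Union>i. a i))) < \<epsilon>"
      if K: "finite_measure K" and aK: "\<And>i. a i \<in> sets K" and VK: "\<And>i. V i \<in> sets K"
        and nK: "measure K (\<Union>i. a i) - \<epsilon> / 2 < measure K (U n)"
        and small: "\<And>i. measure K ((a i - V i) \<union> (V i - a i)) < \<eta>" for K
    proof -
      interpret K: finite_measure K by fact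
      have UK: "U n \<in> sets K"
        unfolding U_def using aK by auto
      have "((\<Union>i. a i) - W) \<union> (W - (\<Union>i. a i)) \<subseteq>
          ((\<Union>i. a i) - U n) \<union> (\<Union>i<n. (a i - V i) \<union> (V i - a i))"
        unfolding U_def W_def by blast
      then have "measure K (((\<Union>i. a i) - W) \<union> (W - (\<Union>i. a i))) \<le>
          measure K (((\<Union>i. a i) - U n) \<union> (\<Union>i<n. (a i - V i) \<union> (V i - a i)))"
        using aK VK UK by (intro K.finite_measure_mono) auto
      also have "\<dots> \<le> measure K ((\<Union>i. a i) - U n) + measure K (\<Union>i<n. (a i - V i) \<union> (V i - a i))"
        using aK VK UK by (intro measure_Un_le) auto
      also have "measure K ((\<Union>i. a i) - U n) = measure K (\<Union>i. a i) - measure K (U n)"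
        using aK UK by (intro K.finite_measure_Diff) (auto simp: U_def)
      also have "measure K (\<Union>i<n. (a i - V i) \<union> (V i - a i)) \<le> (\<Sum>i<n. measure K ((a i - V i) \<union> (V i - a i)))"
        using aK VK by (intro measure_UNION_le) auto
      also have "(\<Sum>i<n. measure K ((a i - V i) \<union> (V i - a i))) \<le> (\<Sum>i<n. \<eta>)"
        using small by (intro sum_mono less_imp_le)
      also have "(\<Sum>i<n. \<eta>) \<le> \<epsilon> / 2"
      proof -
        have "real n * \<eta> \<le> real (Suc n) * \<eta>"
          using \<eta> by simp
        also have "\<dots> = \<epsilon> / 2"
          unfolding \<eta>_def by (simp del: of_nat_Suc)
        finally show ?thesis
          by simp
      qed
      finally show ?thesis
        using nK by linarith
    qed
    show ?case
      using bound[OF M(1) a_sets(1) V_sets(1)[OF V(1)] n(1) V(2)]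
        bound[OF N(1) a_sets(2) V_sets(2)[OF V(1)] n(2) V(3)] W by blast
  }
qed

section \<open>The product of the front marginal and Lebesgue measure\<close>

lemma copula_measure_eqI: "has_cdf d M C \<Longrightarrow> copula_measure d C = M"
  unfolding copula_measure_def by (rule the_equality) (auto intro: has_cdf_unique)

lemma cube_upd: "x \<in> unit_cube e \<Longrightarrow> 0 \<le> t \<Longrightarrow> t \<le> 1 \<Longrightarrow> x(e := t) \<in> unit_cube (Suc e)"
  by (auto simp: unit_cube_def PiE_iff extensional_def less_Suc_eq)

lemma cube_restrict: "x \<in> unit_cube (Suc e) \<Longrightarrow> restrict x {..<e} \<in> unit_cube e"
  by (auto simp: unit_cube_def PiE_iff)

lemma cube_restrict_upd: "x \<in> unit_cube (Suc e) \<Longrightarrow> (restrict x {..<e})(e := t) = x(e := t)"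
  by (auto simp: unit_cube_def PiE_iff extensional_def)

lemma measurable_cube_restrict: "(\<lambda>x. restrict x {..<e}) \<in> cube_borel (Suc e) \<rightarrow>\<^sub>M cube_borel e"
  unfolding cube_borel_def by (rule measurable_restrict_subset) auto

lemma measurable_cube_upd: "(\<lambda>(x, t). x(e := t)) \<in> cube_borel e \<Otimes>\<^sub>M unit_borel \<rightarrow>\<^sub>M cube_borel (Suc e)"
  using measurable_add_dim[of e "{..<e}" "\<lambda>_. unit_borel"] by (simp add: cube_borel_def lessThan_Suc)

lemma has_cdf_front_marginal:
  assumes "copula (Suc e) C"
  shows "has_cdf e (copula_measure e (front_marginal (Suc e) C)) (front_marginal (Suc e) C)"
proof -
  define M where "M = copula_measure (Suc e) C"
  have M: "has_cdf (Suc e) M C"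
    unfolding M_def by (rule has_cdf_copula_measure[OF assms])
  interpret prob_space M
    by (rule has_cdfD(1)[OF M])
  have meas: "(\<lambda>x. restrict x {..<e}) \<in> M \<rightarrow>\<^sub>M cube_borel e"
    unfolding measurable_has_cdf[OF M] by (rule measurable_cube_restrict)
  have "has_cdf e (distr M (cube_borel e) (\<lambda>x. restrict x {..<e})) (front_marginal (Suc e) C)"
    unfolding has_cdf_def
  proof (intro conjI ballI)
    show "prob_space (distr M (cube_borel e) (\<lambda>x. restrict x {..<e}))"
      by (rule prob_space_distr[OF meas])
    fix x assume x: "x \<in> unit_cube e"
    have x1: "x(e := 1) \<in> unit_cube (Suc e)"
      using x by (rule cube_upd) auto
    have "measure (distr M (cube_borel e) (\<lambda>x. restrict x {..<e})) {y \<in> unit_cube e. \<forall>i<e. y i \<le> x i} =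
        measure M ((\<lambda>x. restrict x {..<e}) -` {y \<in> unit_cube e. \<forall>i<e. y i \<le> x i} \<inter> space M)"
      by (rule measure_distr[OF meas sets_lower_box])
    also have "(\<lambda>x. restrict x {..<e}) -` {y \<in> unit_cube e. \<forall>i<e. y i \<le> x i} \<inter> space M =
        {y \<in> unit_cube (Suc e). \<forall>i<Suc e. y i \<le> (x(e := 1)) i}"
      unfolding has_cdfD(3)[OF M] using unit_cubeD(2)[of _ "Suc e" e] cube_restrict
      by (auto simp: less_Suc_eq)
    also have "measure M \<dots> = C (x(e := 1))"
      by (rule has_cdfD(4)[OF M x1])
    also have "C (x(e := 1)) = front_marginal (Suc e) C x"
      using x by (simp add: front_marginal_def)
    finally show "measure (distr M (cube_borel e) (\<lambda>x. restrict x {..<e})) {y \<in> unit_cube e. \<forall>i<e. y i \<le> x i} =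
        front_marginal (Suc e) C x" .
  qed simp
  then show ?thesis
    using copula_measure_eqI by metis
qed

lemma space_unit_lebesgue: "space unit_lebesgue = {0..1}"
  by (simp add: unit_lebesgue_def space_restrict_space)

lemma emeasure_unit_lebesgue:
  assumes "A \<subseteq> {0..1}"
  shows "emeasure unit_lebesgue A = emeasure lborel A"
  unfolding unit_lebesgue_def using assms by (intro emeasure_restrict_space) auto

lemma prob_space_unit_lebesgue: "prob_space unit_lebesgue"
  by (rule prob_spaceI) (simp add: space_unit_lebesgue emeasure_unit_lebesgue)

text \<open>Transported to the cube, so that it lives on the same sigma-algebra as the measure of
  \<open>C\<close>.\<close>

definition front_product :: "nat \<Rightarrow> ((nat \<Rightarrow> real) \<Rightarrow> real) \<Rightarrow> (nat \<Rightarrow> real) measure" where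
  "front_product e C = distr (copula_measure e (front_marginal (Suc e) C) \<Otimes>\<^sub>M unit_lebesgue)
     (cube_borel (Suc e)) (\<lambda>(x, t). x(e := t))"

lemma sets_front_product: "sets (front_product e C) = sets (cube_borel (Suc e))"
  by (simp add: front_product_def)

context
  fixes e :: nat and C :: "(nat \<Rightarrow> real) \<Rightarrow> real"
  assumes cop: "copula (Suc e) C"
begin

private abbreviation "F \<equiv> copula_measure e (front_marginal (Suc e) C)"

private lemma front_cdf: "has_cdf e F (front_marginal (Suc e) C)"
  by (rule has_cdf_front_marginal[OF cop])

private lemma measurable_front_upd: "(\<lambda>(x, t). x(e := t)) \<in> F \<Otimes>\<^sub>M unit_lebesgue \<rightarrow>\<^sub>M cube_borel (Suc e)"
  using measurable_cube_upd
    measurable_cong_sets[OF sets_pair_measure_cong[OF has_cdfD(2)[OF front_cdf] sets_unit_lebesgue] refl]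
  by blast

private lemma pair_prob_space_front: "pair_prob_space F unit_lebesgue"
proof -
  interpret F: prob_space F
    by (rule has_cdfD(1)[OF front_cdf])
  interpret L: prob_space unit_lebesgue
    by (rule prob_space_unit_lebesgue)
  show ?thesis ..
qed

lemma prob_space_front_product: "prob_space (front_product e C)"
proof -
  interpret P: pair_prob_space F unit_lebesgue
    by (rule pair_prob_space_front)
  show ?thesis
    unfolding front_product_def by (rule P.prob_space_distr[OF measurable_front_upd])
qed

lemma emeasure_front_product:
  assumes X: "X \<in> sets (cube_borel (Suc e))"
  shows "emeasure (front_product e C) X =
    (\<integral>\<^sup>+x. emeasure unit_lebesgue {t \<in> {0..1}. x(e := t) \<in> X} \<partial>F)"
proof -
  interpret pair_prob_space F unit_lebesgue
    by (rule pair_prob_space_front)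
  have "emeasure (front_product e C) X =
      emeasure (F \<Otimes>\<^sub>M unit_lebesgue) ((\<lambda>(x, t). x(e := t)) -` X \<inter> space (F \<Otimes>\<^sub>M unit_lebesgue))"
    unfolding front_product_def by (rule emeasure_distr[OF measurable_front_upd X])
  also have "\<dots> = (\<integral>\<^sup>+x. emeasure unit_lebesgue
      (Pair x -` ((\<lambda>(x, t). x(e := t)) -` X \<inter> space (F \<Otimes>\<^sub>M unit_lebesgue))) \<partial>F)"
    by (rule M2.emeasure_pair_measure_alt[OF measurable_sets[OF measurable_front_upd X]])
  also have "\<dots> = (\<integral>\<^sup>+x. emeasure unit_lebesgue {t \<in> {0..1}. x(e := t) \<in> X} \<partial>F)"
    by (intro nn_integral_cong arg_cong[of _ _ "emeasure unit_lebesgue"])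
      (auto simp: space_pair_measure space_unit_lebesgue)
  finally show ?thesis .
qed

text \<open>The value is expressed by \<open>C\<close> alone, so it varies continuously with
  \<open>C\<close> although the product measure itself changes.\<close>

lemma measure_front_product_lower_box:
  assumes x: "x \<in> unit_cube (Suc e)"
  shows "measure (front_product e C) {y \<in> unit_cube (Suc e). \<forall>i<Suc e. y i \<le> x i} = C (x(e := 1)) * x e"
proof -
  interpret F: prob_space F
    by (rule has_cdfD(1)[OF front_cdf])
  have xe: "0 \<le> x e" "x e \<le> 1"
    using unit_cubeD[OF x, of e] by auto
  define B where "B = {y \<in> unit_cube e. \<forall>i<e. y i \<le> (restrict x {..<e}) i}"
  have "emeasure (front_product e C) {y \<in> unit_cube (Suc e). \<forall>i<Suc e. y i \<le> x i} =
      (\<integral>\<^sup>+y. ennreal (x e) * indicator B y \<partial>F)"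
    unfolding emeasure_front_product[OF sets_lower_box]
  proof (rule nn_integral_cong)
    fix y assume "y \<in> space F"
    then have y: "y \<in> unit_cube e"
      by (simp add: has_cdfD(3)[OF front_cdf])
    have "{t \<in> {0..1}. y(e := t) \<in> {y \<in> unit_cube (Suc e). \<forall>i<Suc e. y i \<le> x i}} =
        (if y \<in> B then {0..x e} else {})"
      using y xe cube_upd[OF y] by (auto simp: B_def less_Suc_eq)
    then show "emeasure unit_lebesgue {t \<in> {0..1}. y(e := t) \<in> {y \<in> unit_cube (Suc e). \<forall>i<Suc e. y i \<le> x i}} =
        ennreal (x e) * indicator B y"
      using xe by (simp add: emeasure_unit_lebesgue)
  qed
  also have "\<dots> = ennreal (x e) * emeasure F B"
    using sets_lower_box[of e "restrict x {..<e}"] has_cdfD(2)[OF front_cdf]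
    by (intro nn_integral_cmult_indicator) (simp only: B_def)
  also have "emeasure F B = ennreal (front_marginal (Suc e) C (restrict x {..<e}))"
    unfolding B_def F.emeasure_eq_measure has_cdfD(4)[OF front_cdf cube_restrict[OF x]] ..
  also have "front_marginal (Suc e) C (restrict x {..<e}) = C (x(e := 1))"
    using cube_restrict[OF x] cube_restrict_upd[OF x] by (simp add: front_marginal_def)
  finally have *: "emeasure (front_product e C) {y \<in> unit_cube (Suc e). \<forall>i<Suc e. y i \<le> x i} =
      ennreal (x e) * ennreal (C (x(e := 1)))" .
  have x1: "x(e := 1) \<in> unit_cube (Suc e)"
    using cube_upd[OF cube_restrict[OF x], of 1] by (simp add: cube_restrict_upd[OF x])
  have "0 \<le> C (x(e := 1))"
    unfolding has_cdfD(4)[OF has_cdf_copula_measure[OF cop] x1, symmetric] by (rule measure_nonneg)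
  then show ?thesis
    using * xe by (simp add: measure_def ennreal_mult[symmetric] mult.commute)
qed

text \<open>\<open>cond_kernel\<close> prescribes rectangles only. Mixing the kernels over the front
  marginal gives a measure with distribution function \<open>C\<close>, and uniqueness extends the
  formula to all Borel sets.\<close>

lemma emeasure_copula_kernel:
  assumes K: "cond_kernel (Suc e) C K" and X: "X \<in> sets (cube_borel (Suc e))"
  shows "emeasure (copula_measure (Suc e) C) X = (\<integral>\<^sup>+x. emeasure (K x) {t \<in> {0..1}. x(e := t) \<in> X} \<partial>F)"
proof -
  define M where "M = copula_measure (Suc e) C"
  have M: "has_cdf (Suc e) M C"
    unfolding M_def by (rule has_cdf_copula_measure[OF cop])
  interpret M: prob_space M
    by (rule has_cdfD(1)[OF M])
  interpret F: prob_space F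
    by (rule has_cdfD(1)[OF front_cdf])
  have K_meas: "K \<in> F \<rightarrow>\<^sub>M prob_algebra unit_borel"
    using K measurable_cong_sets[OF has_cdfD(2)[OF front_cdf] refl] unfolding cond_kernel_def by auto
  have K_prob: "prob_space (K x)" "sets (K x) = sets unit_borel" if "x \<in> space F" for x
    using measurable_space[OF K_meas that] by (auto simp: space_prob_algebra)
  have K_space: "space (K x) = {0..1}" if "x \<in> space F" for x
    using sets_eq_imp_space_eq[OF K_prob(2)[OF that]] by simp
  define D where "D x = distr (K x) (cube_borel (Suc e)) (\<lambda>t. x(e := t))" for x
  have upd: "(\<lambda>(x, t). x(e := t)) \<in> F \<Otimes>\<^sub>M unit_borel \<rightarrow>\<^sub>M cube_borel (Suc e)"
    using measurable_cube_upd
      measurable_cong_sets[OF sets_pair_measure_cong[OF has_cdfD(2)[OF front_cdf] refl] refl]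
    by blast
  have D_meas: "D \<in> F \<rightarrow>\<^sub>M subprob_algebra (cube_borel (Suc e))"
    unfolding D_def using upd measurable_prob_algebraD[OF K_meas] by (intro measurable_distr2) auto
  have upd_x: "(\<lambda>t. x(e := t)) \<in> K x \<rightarrow>\<^sub>M cube_borel (Suc e)" if x: "x \<in> space F" for x
    using measurable_compose[OF measurable_Pair1'[OF x] upd]
      measurable_cong_sets[OF K_prob(2)[OF x] refl, of "cube_borel (Suc e)"] by simp
  have D_prob: "prob_space (D x)" if "x \<in> space F" for x
    unfolding D_def by (rule prob_space.prob_space_distr[OF K_prob(1)[OF that] upd_x[OF that]])
  define N where "N = F \<bind> D"
  have N_emeasure: "emeasure N Y = (\<integral>\<^sup>+x. emeasure (K x) {t \<in> {0..1}. x(e := t) \<in> Y} \<partial>F)"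
    if Y: "Y \<in> sets (cube_borel (Suc e))" for Y
  proof -
    have "emeasure N Y = (\<integral>\<^sup>+x. emeasure (D x) Y \<partial>F)"
      unfolding N_def by (rule emeasure_bind[OF F.not_empty D_meas Y])
    also have "\<dots> = (\<integral>\<^sup>+x. emeasure (K x) {t \<in> {0..1}. x(e := t) \<in> Y} \<partial>F)"
    proof (rule nn_integral_cong)
      fix x assume x: "x \<in> space F"
      have "emeasure (D x) Y = emeasure (K x) ((\<lambda>t. x(e := t)) -` Y \<inter> space (K x))"
        unfolding D_def by (rule emeasure_distr[OF upd_x[OF x] Y])
      then show "emeasure (D x) Y = emeasure (K x) {t \<in> {0..1}. x(e := t) \<in> Y}"
        by (simp add: K_space[OF x] vimage_def Int_def conj_commute)
    qed
    finally show ?thesis .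
  qed
  have "has_cdf (Suc e) N C"
    unfolding has_cdf_def
  proof (intro conjI ballI)
    show "prob_space N"
      unfolding N_def using D_prob by (intro F.prob_space_bind[OF _ D_meas] AE_I2)
    show "sets N = sets (cube_borel (Suc e))"
      unfolding N_def by (rule sets_bind[OF _ F.not_empty]) (simp add: D_def)
    fix x assume x: "x \<in> unit_cube (Suc e)"
    define A where "A = {y \<in> unit_cube (Suc e). \<forall>i<Suc e. y i \<le> x i}"
    define B where "B = {y \<in> unit_cube e. \<forall>i<e. y i \<le> (restrict x {..<e}) i}"
    have xe: "0 \<le> x e" "x e \<le> 1"
      using unit_cubeD[OF x, of e] by auto
    have B: "B \<in> sets (cube_borel e)"
      unfolding B_def by (rule sets_lower_box)
    have I: "{0..x e} \<in> sets unit_borel"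
      unfolding unit_borel_def using xe by (subst sets_restrict_space_iff) auto
    have A: "A \<in> sets (cube_borel (Suc e))"
      unfolding A_def by (rule sets_lower_box)
    have rect: "\<forall>E\<in>sets (cube_borel e). \<forall>H\<in>sets unit_borel.
        emeasure M {y \<in> unit_cube (Suc e). restrict y {..<e} \<in> E \<and> y e \<in> H} =
        (\<integral>\<^sup>+y\<in>E. emeasure (K y) H \<partial>F)"
      using K unfolding cond_kernel_def M_def diff_Suc_1 by blast
    have "A = {y \<in> unit_cube (Suc e). restrict y {..<e} \<in> B \<and> y e \<in> {0..x e}}"
      using unit_cubeD[of _ "Suc e" e] cube_restrict by (auto simp: A_def B_def less_Suc_eq)
    then have "emeasure M A = (\<integral>\<^sup>+y\<in>B. emeasure (K y) {0..x e} \<partial>F)"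
      using rect[THEN bspec, OF B, THEN bspec, OF I] by (simp only:)
    also have "\<dots> = emeasure N A"
      unfolding N_emeasure[OF A]
    proof (rule nn_integral_cong)
      fix y assume "y \<in> space F"
      then have y: "y \<in> unit_cube e"
        by (simp add: has_cdfD(3)[OF front_cdf])
      have "{t \<in> {0..1}. y(e := t) \<in> A} = (if y \<in> B then {0..x e} else {})"
        using y xe cube_upd[OF y] by (auto simp: A_def B_def less_Suc_eq)
      then show "emeasure (K y) {0..x e} * indicator B y = emeasure (K y) {t \<in> {0..1}. y(e := t) \<in> A}"
        by simp
    qed
    finally have "measure N A = measure M A"
      by (simp add: measure_def)
    then show "measure N {y \<in> unit_cube (Suc e). \<forall>i<Suc e. y i \<le> x i} = C x"
      using has_cdfD(4)[OF M x] unfolding A_def by simp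
  qed
  then have "M = N"
    by (rule has_cdf_unique[OF M])
  then show ?thesis
    using N_emeasure[OF X] unfolding M_def by simp
qed

text \<open>Total mass 1 of the absolutely continuous component forces almost every kernel to be
  absolutely continuous. A null set of the product measure has Lebesgue null slices almost
  everywhere, which these kernels ignore.\<close>

lemma abs_cont_copula_imp_absolutely_continuous:
  assumes "abs_cont_copula (Suc e) C"
  shows "absolutely_continuous (front_product e C) (copula_measure (Suc e) C)"
proof -
  obtain K where K: "cond_kernel (Suc e) C K" "abs_component (Suc e) C K (unit_cube e) {0..1} = 1"
    using assms by (auto simp: abs_cont_copula_def)
  interpret F: prob_space F
    by (rule has_cdfD(1)[OF front_cdf])
  have K_meas: "K \<in> F \<rightarrow>\<^sub>M prob_algebra unit_borel"
    using K(1) measurable_cong_sets[OF has_cdfD(2)[OF front_cdf] refl] unfolding cond_kernel_def by auto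
  have K_prob: "prob_space (K x)" "sets (K x) = sets unit_lebesgue" if "x \<in> space F" for x
    using measurable_space[OF K_meas that] by (auto simp: space_prob_algebra sets_unit_lebesgue)
  have K_fin: "finite_measure (K x)" if "x \<in> space F" for x
    using K_prob(1)[OF that] by (simp add: prob_space_def)
  have K_one: "emeasure (K x) {0..1} = 1" if "x \<in> space F" for x
    using prob_space.emeasure_space_1[OF K_prob(1)[OF that]] sets_eq_imp_space_eq[OF K_prob(2)[OF that]]
    by (simp add: space_unit_lebesgue)
  have I: "{0..1} \<in> sets unit_lebesgue"
    using sets.top[of unit_lebesgue] by (simp add: space_unit_lebesgue)
  have "AE x in F. emeasure (ac_part unit_lebesgue (K x)) {0..1} = 1"
  proof (rule F.AE_eq_1_of_nn_integral)
    fix x assume x: "x \<in> space F"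
    show "emeasure (ac_part unit_lebesgue (K x)) {0..1} \<le> 1"
      using ac_part_le[OF K_fin[OF x] K_prob(2)[OF x] I] K_one[OF x] by simp
  next
    have "(\<integral>\<^sup>+x. emeasure (ac_part unit_lebesgue (K x)) {0..1} \<partial>F) =
        (\<integral>\<^sup>+x\<in>unit_cube e. emeasure (ac_part unit_lebesgue (K x)) {0..1} \<partial>F)"
      by (intro nn_integral_cong) (simp add: has_cdfD(3)[OF front_cdf])
    then show "(\<integral>\<^sup>+x. emeasure (ac_part unit_lebesgue (K x)) {0..1} \<partial>F) = 1"
      using K(2) by (simp add: abs_component_def)
  qed
  then have K_ac: "AE x in F. absolutely_continuous unit_lebesgue (K x)"
    using AE_space
  proof eventually_elim
    fix x assume "emeasure (ac_part unit_lebesgue (K x)) {0..1} = 1" "x \<in> space F"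
    then show "absolutely_continuous unit_lebesgue (K x)"
      using K_fin K_prob(2) K_one by (intro ac_part_full) (auto simp: space_unit_lebesgue)
  qed
  show ?thesis
    unfolding absolutely_continuous_def
  proof
    fix X assume X_null: "X \<in> null_sets (front_product e C)"
    then have X: "X \<in> sets (cube_borel (Suc e))"
      by (auto simp: sets_front_product)
    interpret pair_prob_space F unit_lebesgue
      by (rule pair_prob_space_front)
    have slice: "{t \<in> {0..1}. x(e := t) \<in> X} = Pair x -` ((\<lambda>(x, t). x(e := t)) -` X \<inter> space (F \<Otimes>\<^sub>M unit_lebesgue))"
      if "x \<in> space F" for x
      using that by (auto simp: space_pair_measure space_unit_lebesgue)
    note P = measurable_sets[OF measurable_front_upd X]
    have slice_sets: "{t \<in> {0..1}. x(e := t) \<in> X} \<in> sets unit_lebesgue" if "x \<in> space F" for x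
      unfolding slice[OF that] by (rule sets_Pair1[OF P])
    have "(\<lambda>x. emeasure unit_lebesgue (Pair x -` ((\<lambda>(x, t). x(e := t)) -` X \<inter> space (F \<Otimes>\<^sub>M unit_lebesgue))))
        \<in> borel_measurable F"
      by (rule M2.measurable_emeasure_Pair[OF P])
    then have meas: "(\<lambda>x. emeasure unit_lebesgue {t \<in> {0..1}. x(e := t) \<in> X}) \<in> borel_measurable F"
      using slice by (subst measurable_cong) auto
    have "(\<integral>\<^sup>+x. emeasure unit_lebesgue {t \<in> {0..1}. x(e := t) \<in> X} \<partial>F) = 0"
      using X_null emeasure_front_product[OF X] by auto
    then have "AE x in F. emeasure unit_lebesgue {t \<in> {0..1}. x(e := t) \<in> X} = 0"
      using nn_integral_0_iff_AE[OF meas] by simp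
    then have "AE x in F. emeasure (K x) {t \<in> {0..1}. x(e := t) \<in> X} = 0"
      using K_ac AE_space
    proof eventually_elim
      fix x assume "emeasure unit_lebesgue {t \<in> {0..1}. x(e := t) \<in> X} = 0"
        "absolutely_continuous unit_lebesgue (K x)" "x \<in> space F"
      then show "emeasure (K x) {t \<in> {0..1}. x(e := t) \<in> X} = 0"
        using slice_sets[of x] by (auto simp: absolutely_continuous_def null_sets_def)
    qed
    then have "(\<integral>\<^sup>+x. emeasure (K x) {t \<in> {0..1}. x(e := t) \<in> X} \<partial>F) = (\<integral>\<^sup>+x. 0 \<partial>F)"
      by (intro nn_integral_cong_AE) auto
    then have "emeasure (copula_measure (Suc e) C) X = 0"
      using emeasure_copula_kernel[OF K(1) X] by simp
    then show "X \<in> null_sets (copula_measure (Suc e) C)"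
      using X has_cdfD(2)[OF has_cdf_copula_measure[OF cop]] by (auto simp: null_sets_def)
  qed
qed

end

lemma (in finite_mixture) front_product_support: "emeasure (front_product e C) support = 0"
proof -
  have "emeasure unit_lebesgue {t \<in> {0..1}. x(e := t) \<in> support} = 0" for x
    using emeasure_lborel_countable[OF countable_finite[OF support_slice]]
    by (subst emeasure_unit_lebesgue) auto
  then show ?thesis
    unfolding emeasure_front_product[OF copula_C support_sets] by simp
qed

section \<open>The algebra generated by lower boxes\<close>

text \<open>
  Integrals of these functions are linear combinations of values of the distribution function and
  hence depend continuously on it.
\<close>

inductive_set box_funs :: "nat \<Rightarrow> ((nat \<Rightarrow> real) \<Rightarrow> real) set" for d where
  box: "x \<in> unit_cube d \<Longrightarrow> indicator {y \<in> unit_cube d. \<forall>i<d. y i \<le> x i} \<in> box_funs d"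
| diff: "f \<in> box_funs d \<Longrightarrow> g \<in> box_funs d \<Longrightarrow> (\<lambda>y. f y - g y) \<in> box_funs d"

text \<open>Encoding through the indicator hands over an expression by box indicators and replaces a
  normal form for Boolean combinations.\<close>

definition box_algebra :: "nat \<Rightarrow> (nat \<Rightarrow> real) set set" where
  "box_algebra d = {V. V \<subseteq> unit_cube d \<and> indicator V \<in> box_funs d}"

lemma box_funs_borel: "f \<in> box_funs d \<Longrightarrow> f \<in> borel_measurable (cube_borel d)"
proof (induction rule: box_funs.induct)
  case (box x)
  then show ?case
    using sets_lower_box by (intro borel_measurable_indicator)
next
  case (diff f g)
  then show ?case
    by (intro borel_measurable_diff)
qed

lemma box_funs_integrable:
  assumes "f \<in> box_funs d" "finite_measure M" "sets M = sets (cube_borel d)"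
  shows "integrable M f"
  using assms(1)
proof induction
  case (box x)
  interpret finite_measure M by fact
  have fin: "emeasure M A < \<infinity>" for A
    by (simp add: emeasure_eq_measure)
  have "{y \<in> unit_cube d. \<forall>i<d. y i \<le> x i} \<in> sets M"
    unfolding assms(3) by (rule sets_lower_box)
  then show ?case
    by (rule integrable_real_indicator[OF _ fin])
qed auto

lemma box_funs_zero: "(\<lambda>_. 0) \<in> box_funs d"
proof -
  have "(\<lambda>i\<in>{..<d}. 1) \<in> unit_cube d"
    by (intro coord_restrict_mem_cube) auto
  from box_funs.diff[OF box_funs.box[OF this] box_funs.box[OF this]] show ?thesis
    by simp
qed

lemma indicator_cube_box_funs: "indicator (unit_cube d) \<in> box_funs d"
proof -
  have 1: "(\<lambda>i\<in>{..<d}. 1) \<in> unit_cube d"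
    by (intro coord_restrict_mem_cube) auto
  have "{y \<in> unit_cube d. \<forall>i<d. y i \<le> (\<lambda>i\<in>{..<d}. 1) i} = unit_cube d"
    using unit_cubeD(2) by fastforce
  then show ?thesis
    using box_funs.box[OF 1] by simp
qed

text \<open>Two lower boxes intersect in the lower box at the coordinatewise minimum. This closes
  \<open>box_funs\<close> under products, hence \<open>box_algebra\<close> under
  intersections.\<close>

lemma box_funs_mult_box:
  assumes "f \<in> box_funs d" and x: "x \<in> unit_cube d"
  shows "(\<lambda>y. f y * indicator {y \<in> unit_cube d. \<forall>i<d. y i \<le> x i} y) \<in> box_funs d"
  using assms(1)
proof induction
  case (box x')
  have m: "(\<lambda>i\<in>{..<d}. min (x' i) (x i)) \<in> unit_cube d"
    using unit_cubeD[OF x] unit_cubeD[OF box]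
    by (intro coord_restrict_mem_cube) (auto simp: min_le_iff_disj)
  have "(\<lambda>y. indicator {y \<in> unit_cube d. \<forall>i<d. y i \<le> x' i} y * indicator {y \<in> unit_cube d. \<forall>i<d. y i \<le> x i} y :: real) =
      indicator {y \<in> unit_cube d. \<forall>i<d. y i \<le> (\<lambda>i\<in>{..<d}. min (x' i) (x i)) i}"
    by (auto simp: indicator_def fun_eq_iff)
  then show ?case
    using box_funs.box[OF m] by simp
next
  case (diff f g)
  then show ?case
    using box_funs.diff by (simp add: left_diff_distrib)
qed

lemma box_funs_mult:
  assumes "f \<in> box_funs d" "g \<in> box_funs d"
  shows "(\<lambda>y. f y * g y) \<in> box_funs d"
  using assms(2)
proof induction
  case (box x)
  then show ?case
    by (rule box_funs_mult_box[OF assms(1)])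
next
  case (diff g h)
  then show ?case
    using box_funs.diff by (simp add: right_diff_distrib)
qed

lemma algebra_box_algebra: "algebra (unit_cube d) (box_algebra d)"
  unfolding algebra_iff_Int
proof (intro conjI ballI)
  show "box_algebra d \<subseteq> Pow (unit_cube d)"
    by (auto simp: box_algebra_def)
  show "{} \<in> box_algebra d"
    using box_funs_zero by (simp add: box_algebra_def indicator_def[abs_def])
  fix A assume A: "A \<in> box_algebra d"
  have "indicator (unit_cube d - A) = (\<lambda>y. indicator (unit_cube d) y - indicator A y :: real)"
    using A by (auto simp: box_algebra_def indicator_def fun_eq_iff)
  then show "unit_cube d - A \<in> box_algebra d"
    using A box_funs.diff[OF indicator_cube_box_funs] by (simp add: box_algebra_def)
  fix B assume B: "B \<in> box_algebra d"
  have "indicator (A \<inter> B) = (\<lambda>y. indicator A y * indicator B y :: real)"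
    by (auto simp: indicator_def fun_eq_iff)
  then show "A \<inter> B \<in> box_algebra d"
    using A B box_funs_mult by (auto simp: box_algebra_def)
qed

lemma box_algebra_sets:
  assumes "V \<in> box_algebra d"
  shows "V \<in> sets (cube_borel d)"
proof -
  have "(indicator V :: _ \<Rightarrow> real) \<in> borel_measurable (cube_borel d)"
    using assms by (intro box_funs_borel) (simp add: box_algebra_def)
  moreover have "V \<inter> space (cube_borel d) = V"
    using assms by (auto simp: box_algebra_def)
  ultimately show ?thesis
    by (simp add: borel_measurable_indicator_iff)
qed

lemma sigma_sets_box_algebra: "sigma_sets (unit_cube d) (box_algebra d) = sets (cube_borel d)"
proof
  show "sigma_sets (unit_cube d) (box_algebra d) \<subseteq> sets (cube_borel d)"
    using sets.sigma_sets_subset[of "box_algebra d" "cube_borel d"] box_algebra_sets by auto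
  show "sets (cube_borel d) \<subseteq> sigma_sets (unit_cube d) (box_algebra d)"
    unfolding sets_cube_borel_eq
    by (rule sigma_sets_mono') (auto simp: box_algebra_def intro: box_funs.box)
qed

lemma copula_diff_le_uniform_dist:
  assumes "copula d C" "copula d C'" "x \<in> unit_cube d"
  shows "\<bar>C x - C' x\<bar> \<le> uniform_dist d C C'"
  unfolding uniform_dist_eq[OF assms(1,2)]
proof (rule cSUP_upper[OF assms(3)])
  have range: "0 \<le> A y \<and> A y \<le> 1" if A: "copula d A" and y: "y \<in> unit_cube d" for A y
    unfolding has_cdfD(4)[OF has_cdf_copula_measure[OF A] y, symmetric]
    using prob_space.prob_le_1[OF has_cdfD(1)[OF has_cdf_copula_measure[OF A]]] by simp
  have "\<bar>C y - C' y\<bar> \<le> 1" if "y \<in> unit_cube d" for y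
    using range[OF assms(1) that] range[OF assms(2) that] by linarith
  then show "bdd_above ((\<lambda>y. \<bar>C y - C' y\<bar>) ` unit_cube d)"
    by (intro bdd_aboveI[of _ 1]) auto
qed

text \<open>On a lower box the integrals are \<open>C x\<close> and
  \<open>C (x(e := 1)) * x e\<close>, each changing by at most the distance, and the constants add
  along differences. \<open>K\<close> depends on \<open>f\<close> but not on the copulas.\<close>

lemma box_funs_integral_continuous:
  assumes "f \<in> box_funs (Suc e)"
  shows "\<exists>K\<ge>0. \<forall>C C'. copula (Suc e) C \<longrightarrow> copula (Suc e) C' \<longrightarrow>
    \<bar>integral\<^sup>L (copula_measure (Suc e) C) f - integral\<^sup>L (copula_measure (Suc e) C') f\<bar> \<le> K * uniform_dist (Suc e) C C' \<and>
    \<bar>integral\<^sup>L (front_product e C) f - integral\<^sup>L (front_product e C') f\<bar> \<le> K * uniform_dist (Suc e) C C'"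
  using assms
proof induction
  case (box x)
  let ?B = "{y \<in> unit_cube (Suc e). \<forall>i<Suc e. y i \<le> x i}"
  have x1: "x(e := 1) \<in> unit_cube (Suc e)"
    using cube_upd[OF cube_restrict[OF box], of 1] by (simp add: cube_restrict_upd[OF box])
  have xe: "0 \<le> x e" "x e \<le> 1"
    using unit_cubeD[OF box, of e] by auto
  have int1: "integral\<^sup>L (copula_measure (Suc e) C) (indicator ?B) = C x" if C: "copula (Suc e) C" for C
  proof -
    note cdf = has_cdf_copula_measure[OF C]
    have "?B \<inter> space (copula_measure (Suc e) C) = ?B"
      unfolding has_cdfD(3)[OF cdf] by blast
    then show ?thesis
      by (simp only: Bochner_Integration.integral_indicator has_cdfD(4)[OF cdf box])
  qed
  have int2: "integral\<^sup>L (front_product e C) (indicator ?B) = C (x(e := 1)) * x e" if C: "copula (Suc e) C" for C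
  proof -
    have "?B \<inter> space (front_product e C) = ?B"
      by (auto simp: front_product_def)
    then show ?thesis
      by (simp only: Bochner_Integration.integral_indicator measure_front_product_lower_box[OF C box])
  qed
  show ?case
  proof (intro exI[of _ 1] conjI allI impI)
    fix C C' assume C: "copula (Suc e) C" "copula (Suc e) C'"
    show "\<bar>integral\<^sup>L (copula_measure (Suc e) C) (indicator ?B) - integral\<^sup>L (copula_measure (Suc e) C') (indicator ?B)\<bar>
        \<le> 1 * uniform_dist (Suc e) C C'"
      unfolding int1[OF C(1)] int1[OF C(2)] using copula_diff_le_uniform_dist[OF C box] by simp
    have "\<bar>C (x(e := 1)) * x e - C' (x(e := 1)) * x e\<bar> = \<bar>C (x(e := 1)) - C' (x(e := 1))\<bar> * x e"
      unfolding left_diff_distrib[symmetric] abs_mult using xe by simp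
    also have "\<dots> \<le> \<bar>C (x(e := 1)) - C' (x(e := 1))\<bar>"
      using xe by (simp add: mult_left_le)
    finally show "\<bar>integral\<^sup>L (front_product e C) (indicator ?B) - integral\<^sup>L (front_product e C') (indicator ?B)\<bar>
        \<le> 1 * uniform_dist (Suc e) C C'"
      unfolding int2[OF C(1)] int2[OF C(2)] using copula_diff_le_uniform_dist[OF C x1] by simp
  qed simp
next
  case (diff f g)
  obtain K where K: "0 \<le> K" "\<And>C C'. copula (Suc e) C \<Longrightarrow> copula (Suc e) C' \<Longrightarrow>
    \<bar>integral\<^sup>L (copula_measure (Suc e) C) f - integral\<^sup>L (copula_measure (Suc e) C') f\<bar> \<le> K * uniform_dist (Suc e) C C' \<and>
    \<bar>integral\<^sup>L (front_product e C) f - integral\<^sup>L (front_product e C') f\<bar> \<le> K * uniform_dist (Suc e) C C'"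
    using diff.IH(1) by blast
  obtain L where L: "0 \<le> L" "\<And>C C'. copula (Suc e) C \<Longrightarrow> copula (Suc e) C' \<Longrightarrow>
    \<bar>integral\<^sup>L (copula_measure (Suc e) C) g - integral\<^sup>L (copula_measure (Suc e) C') g\<bar> \<le> L * uniform_dist (Suc e) C C' \<and>
    \<bar>integral\<^sup>L (front_product e C) g - integral\<^sup>L (front_product e C') g\<bar> \<le> L * uniform_dist (Suc e) C C'"
    using diff.IH(2) by blast
  have split: "integral\<^sup>L M (\<lambda>y. f y - g y) = integral\<^sup>L M f - integral\<^sup>L M g"
    if "prob_space M" "sets M = sets (cube_borel (Suc e))" for M
    using that diff.hyps by (intro Bochner_Integration.integral_diff box_funs_integrable) (auto simp: prob_space_def)
  show ?case
  proof (intro exI[of _ "K + L"] conjI allI impI)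
    fix C C' assume C: "copula (Suc e) C" "copula (Suc e) C'"
    note cdf = has_cdf_copula_measure[OF C(1)] has_cdf_copula_measure[OF C(2)]
    show "\<bar>integral\<^sup>L (copula_measure (Suc e) C) (\<lambda>y. f y - g y) - integral\<^sup>L (copula_measure (Suc e) C') (\<lambda>y. f y - g y)\<bar>
        \<le> (K + L) * uniform_dist (Suc e) C C'"
      using K(2)[OF C] L(2)[OF C] unfolding split[OF has_cdfD(1,2)[OF cdf(1)]] split[OF has_cdfD(1,2)[OF cdf(2)]]
      by (auto simp: distrib_right)
    show "\<bar>integral\<^sup>L (front_product e C) (\<lambda>y. f y - g y) - integral\<^sup>L (front_product e C') (\<lambda>y. f y - g y)\<bar>
        \<le> (K + L) * uniform_dist (Suc e) C C'"
      using K(2)[OF C] L(2)[OF C]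
      unfolding split[OF prob_space_front_product[OF C(1)] sets_front_product]
        split[OF prob_space_front_product[OF C(2)] sets_front_product]
      by (auto simp: distrib_right)
  qed (use K(1) L(1) in simp)
qed

section \<open>The category argument\<close>

text \<open>The complement of the \<open>n\<close>-th closed set within the Archimedean copulas.
  Strict inequalities make it open; 1 / 2 is a fixed level between 0 and 1.\<close>

definition concentrated_copulas :: "nat \<Rightarrow> nat \<Rightarrow> ((nat \<Rightarrow> real) \<Rightarrow> real) set" where
  "concentrated_copulas e n = {C \<in> archimedean_copulas (Suc e). \<exists>V\<in>box_algebra (Suc e).
     measure (front_product e C) V < 1 / real (Suc n) \<and> 1 / 2 < measure (copula_measure (Suc e) C) V}"

lemma archimedean_copulaD: "C \<in> archimedean_copulas d \<Longrightarrow> copula d C"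
  by (simp add: archimedean_copulas_def)

lemma concentrated_copulas_open:
  assumes "C \<in> concentrated_copulas e n"
  shows "\<exists>\<delta>>0. \<forall>C'\<in>archimedean_copulas (Suc e). uniform_dist (Suc e) C C' < \<delta> \<longrightarrow> C' \<in> concentrated_copulas e n"
proof -
  obtain V where C: "copula (Suc e) C" and V: "V \<in> box_algebra (Suc e)"
    "measure (front_product e C) V < 1 / real (Suc n)" "1 / 2 < measure (copula_measure (Suc e) C) V"
    using assms by (auto simp: concentrated_copulas_def archimedean_copulaD)
  obtain K where K: "0 \<le> K" "\<And>C C'. copula (Suc e) C \<Longrightarrow> copula (Suc e) C' \<Longrightarrow>
    \<bar>integral\<^sup>L (copula_measure (Suc e) C) (indicator V) - integral\<^sup>L (copula_measure (Suc e) C') (indicator V)\<bar>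
      \<le> K * uniform_dist (Suc e) C C' \<and>
    \<bar>integral\<^sup>L (front_product e C) (indicator V) - integral\<^sup>L (front_product e C') (indicator V)\<bar>
      \<le> K * uniform_dist (Suc e) C C'"
    using box_funs_integral_continuous[of "indicator V" e] V(1) by (auto simp: box_algebra_def)
  have int1: "integral\<^sup>L (copula_measure (Suc e) C) (indicator V) = measure (copula_measure (Suc e) C) V"
    if "copula (Suc e) C" for C
    using V(1) has_cdfD(3)[OF has_cdf_copula_measure[OF that]] by (simp add: box_algebra_def Int_absorb2)
  have int2: "integral\<^sup>L (front_product e C) (indicator V) = measure (front_product e C) V" for C
    using V(1) by (simp add: box_algebra_def front_product_def Int_absorb2)
  define \<eta> where "\<eta> = min (1 / real (Suc n) - measure (front_product e C) V)
    (measure (copula_measure (Suc e) C) V - 1 / 2)"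
  have \<eta>: "0 < \<eta>"
    using V by (simp add: \<eta>_def)
  \<comment> \<open>The denominator \<open>K + 1\<close> stays positive when
    \<open>K = 0\<close>.\<close>
  show ?thesis
  proof (intro exI[of _ "\<eta> / (K + 1)"] conjI ballI impI)
    show "0 < \<eta> / (K + 1)"
      using \<eta> K(1) by simp
    fix C' assume C': "C' \<in> archimedean_copulas (Suc e)" "uniform_dist (Suc e) C C' < \<eta> / (K + 1)"
    note cop' = archimedean_copulaD[OF C'(1)]
    have "0 \<le> uniform_dist (Suc e) C C'"
      using copula_diff_le_uniform_dist[OF C cop', of "\<lambda>i\<in>{..<Suc e}. 1"]
        coord_restrict_mem_cube[of "Suc e" "\<lambda>_. 1"] by simp
    then have "K * uniform_dist (Suc e) C C' \<le> (K + 1) * uniform_dist (Suc e) C C'"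
      by (simp add: distrib_right)
    also have "\<dots> < \<eta>"
      using C'(2) K(1) by (simp add: less_divide_eq mult.commute)
    finally have small: "K * uniform_dist (Suc e) C C' < \<eta>" .
    have "measure (front_product e C') V < 1 / real (Suc n)" "1 / 2 < measure (copula_measure (Suc e) C') V"
      using K(2)[OF C cop'] small unfolding int1[OF C] int1[OF cop'] int2 \<eta>_def by linarith+
    then show "C' \<in> concentrated_copulas e n"
      using C'(1) V(1) by (auto simp: concentrated_copulas_def)
  qed
qed

text \<open>\<open>support\<close> has full mass for the copula and none for the product measure; a
  member of the algebra close to it in both measures inherits this up to a small error.\<close>

lemma (in finite_mixture) C_concentrated: "C \<in> concentrated_copulas e n"
proof -
  define M where "M = copula_measure (Suc e) C"
  define N where "N = front_product e C"
  have M: "has_cdf (Suc e) M C"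
    unfolding M_def by (rule has_cdf_copula_measure[OF copula_C])
  interpret M: prob_space M
    by (rule has_cdfD(1)[OF M])
  interpret N: prob_space N
    unfolding N_def by (rule prob_space_front_product[OF copula_C])
  have sets: "sets M = sigma_sets (unit_cube (Suc e)) (box_algebra (Suc e))"
    "sets N = sigma_sets (unit_cube (Suc e)) (box_algebra (Suc e))"
    using has_cdfD(2)[OF M] by (simp_all add: N_def sets_front_product sigma_sets_box_algebra)
  have supp: "support \<in> sets M" "support \<in> sets N"
    using support_sets by (simp_all add: sets sigma_sets_box_algebra)
  \<comment> \<open>Losing less than 1 / 2 from mass 1 leaves more than 1 / 2, and less than
    \<open>1 / real (Suc n)\<close> is added to mass 0.\<close>
  define \<epsilon> where "\<epsilon> = min (1 / real (Suc n)) (1 / 2)"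
  have "0 < \<epsilon>"
    by (simp add: \<epsilon>_def)
  then obtain V where V: "V \<in> box_algebra (Suc e)"
    "measure M ((support - V) \<union> (V - support)) < \<epsilon>" "measure N ((support - V) \<union> (V - support)) < \<epsilon>"
    using measure_algebra_approximation[OF algebra_box_algebra M.finite_measure_axioms sets(1)
        N.finite_measure_axioms sets(2), of support \<epsilon>] supp sets by auto
  have V_sets: "V \<in> sets M" "V \<in> sets N"
    using box_algebra_sets[OF V(1)] by (simp_all add: sets sigma_sets_box_algebra)
  have "measure M support \<le> measure M (V \<union> ((support - V) \<union> (V - support)))"
    using supp V_sets by (intro M.finite_measure_mono) auto
  also have "\<dots> \<le> measure M V + measure M ((support - V) \<union> (V - support))"
    using supp V_sets by (intro measure_Un_le) auto
  finally have "1 / 2 < measure M V"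
    using V(2) measure_support by (simp add: M_def[symmetric] \<epsilon>_def)
  moreover have "measure N V \<le> measure N (support \<union> ((support - V) \<union> (V - support)))"
    using supp V_sets by (intro N.finite_measure_mono) auto
  then have "measure N V \<le> measure N support + measure N ((support - V) \<union> (V - support))"
    using supp V_sets measure_Un_le[of support N "(support - V) \<union> (V - support)"] by auto
  then have "measure N V < 1 / real (Suc n)"
    using V(3) front_product_support by (simp add: N_def[symmetric] measure_def \<epsilon>_def)
  ultimately show ?thesis
    unfolding concentrated_copulas_def using archimedean_C V(1) by (auto simp: M_def N_def)
qed

lemma abs_cont_not_concentrated:
  assumes "C \<in> abs_cont_archimedean_copulas (Suc e)"
  shows "\<exists>n. C \<notin> concentrated_copulas e n"
proof -
  have C: "copula (Suc e) C" and ac: "abs_cont_copula (Suc e) C"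
    using assms by (auto simp: abs_cont_archimedean_copulas_def archimedean_copulaD)
  note cdf = has_cdf_copula_measure[OF C]
  have "\<exists>n::nat. \<forall>X\<in>sets (front_product e C). measure (front_product e C) X < 1 / real (Suc n) \<longrightarrow>
      measure (copula_measure (Suc e) C) X \<le> 1 / 2"
    using has_cdfD(1,2)[OF cdf] prob_space_front_product[OF C]
    by (intro absolutely_continuous_eps_delta abs_cont_copula_imp_absolutely_continuous[OF C ac])
      (auto simp: prob_space_def sets_front_product)
  then obtain n :: nat where n: "\<And>X. X \<in> sets (front_product e C) \<Longrightarrow>
      measure (front_product e C) X < 1 / real (Suc n) \<Longrightarrow> measure (copula_measure (Suc e) C) X \<le> 1 / 2"
    by blast
  have "C \<notin> concentrated_copulas e n"
    using n box_algebra_sets unfolding concentrated_copulas_def sets_front_product by fastforce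
  then show ?thesis ..
qed

theorem theorem6p9:
  fixes d :: nat
  assumes "2 \<le> d"
  shows "first_category_in (Metric_space.mtopology (archimedean_copulas d) (uniform_dist d))
           (abs_cont_archimedean_copulas d)"
proof -
  obtain e where d: "d = Suc e" and e: "1 \<le> e"
    using assms by (cases d) auto
  interpret Metric_space "archimedean_copulas d" "uniform_dist d"
    by (rule Metric_space_archimedean_copulas)
  define N where "N n = archimedean_copulas d - concentrated_copulas e n" for n
  have "nowhere_dense_in mtopology (N n)" for n
    unfolding nowhere_dense_in_def
  proof
    show "N n \<subseteq> topspace mtopology"
      by (auto simp: N_def)
    have "openin mtopology (concentrated_copulas e n)"
      unfolding openin_mtopology
    proof (intro conjI allI impI)
      show "concentrated_copulas e n \<subseteq> archimedean_copulas d"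
        by (auto simp: concentrated_copulas_def d)
      fix C assume "C \<in> concentrated_copulas e n"
      then show "\<exists>\<delta>>0. mball C \<delta> \<subseteq> concentrated_copulas e n"
        using concentrated_copulas_open[of C e n] unfolding d[symmetric] by (meson in_mball subsetI)
    qed
    then have "mtopology closure_of (N n) = N n"
      unfolding N_def by (intro closure_of_closedin) (metis closedin_diff closedin_topspace topspace_mtopology)
    moreover have "mtopology interior_of (N n) = {}"
    proof (rule ccontr)
      assume "mtopology interior_of (N n) \<noteq> {}"
      then obtain C0 where "C0 \<in> mtopology interior_of (N n)"
        by blast
      then obtain \<delta> where \<delta>: "0 < \<delta>" "mball C0 \<delta> \<subseteq> N n"
        using openin_interior_of[of mtopology "N n"] interior_of_subset[of mtopology "N n"]
        unfolding openin_mtopology by blast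
      have C0: "C0 \<in> archimedean_copulas d"
        using \<open>C0 \<in> mtopology interior_of (N n)\<close> interior_of_subset[of mtopology "N n"] by (auto simp: N_def)
      \<comment> \<open>Half the radius, because the approximation bound is not strict while the
        ball is open.\<close>
      obtain I w r where G: "finite_mixture e I w r" "uniform_dist d C0 (finite_mixture.C e I w r) \<le> \<delta> / 2"
        using archimedean_dense_mixture[of C0 e "\<delta> / 2"] C0 e \<delta>(1) unfolding d by auto
      interpret finite_mixture e I w r
        by (rule G(1))
      have "C \<in> mball C0 \<delta>"
        unfolding in_mball using C0 archimedean_C G(2) \<delta>(1) by (simp add: d)
      then show False
        using \<delta>(2) C_concentrated[of n] by (auto simp: N_def)
    qed
    ultimately show "mtopology interior_of (mtopology closure_of (N n)) = {}"
      by simp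
  qed
  moreover have "abs_cont_archimedean_copulas d \<subseteq> (\<Union>n. N n)"
    using abs_cont_not_concentrated[of _ e] by (auto simp: N_def d abs_cont_archimedean_copulas_def)
  ultimately show ?thesis
    unfolding first_category_in_def by (intro exI[of _ "range N"]) auto
qed

end
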